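(* In the setting of the context (bounded self-adjoint $A$, bilinear $Q$, and equilibria $u^\pm$ with $Q'(u^\pm)$ satisfying the Kawashima condition), there exists $\eta^*>0$ such that for every $\eta\in(0,\eta^* )$ the operators $$\mathcal L^\pm_\eta=A\partial_\tau-Q'(u^\pm)\mp\eta A$$ (upper signs together, lower signs together) are invertible with bounded inverse on $L^2(\mathbb R,\mathbb H)$.
   Context: $\mathbb H$ is a complex Hilbert space; $A\in\mathcal B(\mathbb H)$ is bounded and self-adjoint; $\mathbb V\subsetneq\mathbb H$ is a proper closed subspace with $\dim\mathbb V^\perp<\infty$; $B:\mathbb H\times\mathbb H\to\mathbb V$ is bilinear, symmetric and continuous, and $Q(u)=B(u,u)$, so $Q'(u)w=2B(u,w)$. Equilibria: $u^+,u^-\in\mathbb H$ satisfy $Q(u^\pm)=0$, and for each sign the operator $T=Q'(u^\pm)\in\mathcal B(\mathbb H)$ satisfies the Kawashima condition: (i) $T$ is self-adjoint and $\ker T=\mathbb V^\perp$; (ii) there is $\delta_\pm>0$ with $\langle Tv,v\rangle\le-\delta_\pm\|v\|^2$ for all $v\in\mathbb V$; (iii) there are $K_\pm\in\mathcal B(\mathbb H)$ with $K_\pm^*=-K_\pm$ and $\gamma_\pm>0$ with $\mathrm{Re}(K_\pm A-T)\ge\gamma_\pm I$, where $\mathrm{Re}\,M=\frac12(M+M^* )$. $\mathcal L^\pm_\eta$ is regarded as a closed, densely defined operator on $L^2(\mathbb R,\mathbb H)$ with maximal domain $\{u\in L^2(\mathbb R,\mathbb H): Au'\in L^2(\mathbb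 R,\mathbb H)\}$, where $Au'=(Au)'$ is the distributional derivative. *)

theory Defs
  imports "HOL-Analysis.Analysis"
begin

section \<open>Complex Hilbert spaces\<close>

text \<open>
  The superclass \<open>real_inner\<close> carries the real part of the complex inner product; in particular
  \<open>norm x = sqrt (Re (cinner x x))\<close>. The product is linear in the first argument and
  antilinear in the second. No separability is assumed.
\<close>

class complex_hilbert = real_inner + complete_space +
  fixes scaleC :: "complex \<Rightarrow> 'a \<Rightarrow> 'a"
    and cinner :: "'a \<Rightarrow> 'a \<Rightarrow> complex"
  assumes scaleC_add_right: "scaleC a (x + y) = scaleC a x + scaleC a y"
    and scaleC_add_left: "scaleC (a + b) x = scaleC a x + scaleC b x"
    and scaleC_scaleC: "scaleC a (scaleC b x) = scaleC (a * b) x"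
    and scaleC_of_real: "scaleC (complex_of_real r) x = r *\<^sub>R x"
    and cinner_add_left: "cinner (x + y) z = cinner x z + cinner y z"
    and cinner_scaleC_left: "cinner (scaleC a x) y = a * cinner x y"
    and cinner_commute: "cinner x y = cnj (cinner y x)"
    and inner_eq_Re_cinner: "inner x y = Re (cinner x y)"

global_interpretation cvec: vector_space "scaleC :: complex \<Rightarrow> 'h::complex_hilbert \<Rightarrow> 'h"
proof
  show "scaleC 1 x = x" for x :: 'h
    using scaleC_of_real[of 1 x] by simp
qed (simp_all add: scaleC_add_right scaleC_add_left scaleC_scaleC)

definition orth_compl :: "'h::complex_hilbert set \<Rightarrow> 'h set"
  where "orth_compl V = {x. \<forall>v\<in>V. cinner x v = 0}"

definition cfinite_dim :: "'h::complex_hilbert set \<Rightarrow> bool"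
  where "cfinite_dim W \<longleftrightarrow> (\<exists>S. finite S \<and> cvec.span S = W)"


section \<open>Bounded operators\<close>

definition bounded_clinear :: "('h::complex_hilbert \<Rightarrow> 'h) \<Rightarrow> bool"
  where "bounded_clinear M \<longleftrightarrow> bounded_linear M \<and> (\<forall>c x. M (scaleC c x) = scaleC c (M x))"

definition is_adjoint :: "('h::complex_hilbert \<Rightarrow> 'h) \<Rightarrow> ('h \<Rightarrow> 'h) \<Rightarrow> bool"
  where "is_adjoint M N \<longleftrightarrow> (\<forall>x y. cinner (M x) y = cinner x (N y))"

definition cadjoint :: "('h::complex_hilbert \<Rightarrow> 'h) \<Rightarrow> ('h \<Rightarrow> 'h)"
  where "cadjoint M = (THE N. is_adjoint M N)"

definition selfadjoint :: "('h::complex_hilbert \<Rightarrow> 'h) \<Rightarrow> bool"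
  where "selfadjoint M \<longleftrightarrow> bounded_clinear M \<and> is_adjoint M M"

definition skewadjoint :: "('h::complex_hilbert \<Rightarrow> 'h) \<Rightarrow> bool"
  where "skewadjoint M \<longleftrightarrow> bounded_clinear M \<and> is_adjoint M (\<lambda>x. - M x)"

definition op_Re :: "('h::complex_hilbert \<Rightarrow> 'h) \<Rightarrow> ('h \<Rightarrow> 'h)"
  where "op_Re M = (\<lambda>x. (1/2) *\<^sub>R (M x + cadjoint M x))"

text \<open>
  The operator inequality \<open>M \<ge> \<gamma> I\<close> for self-adjoint \<open>M\<close>; the quadratic form is then real
  and \<open>Re\<close> only serves as the coercion to \<open>real\<close>.
\<close>

definition op_ge :: "('h::complex_hilbert \<Rightarrow> 'h) \<Rightarrow> real \<Rightarrow> bool"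
  where "op_ge M \<gamma> \<longleftrightarrow> (\<forall>v. \<gamma> * (norm v)\<^sup>2 \<le> Re (cinner (M v) v))"

definition kawashima ::
    "('h::complex_hilbert \<Rightarrow> 'h) \<Rightarrow> 'h set \<Rightarrow> ('h \<Rightarrow> 'h) \<Rightarrow> bool"
  where "kawashima A V T \<longleftrightarrow>
    selfadjoint T \<and> {x. T x = 0} = orth_compl V \<and>
    (\<exists>\<delta>>0. \<forall>v\<in>V. Re (cinner (T v) v) \<le> - \<delta> * (norm v)\<^sup>2) \<and>
    (\<exists>K. skewadjoint K \<and> (\<exists>\<gamma>>0. op_ge (op_Re (\<lambda>x. K (A x) - T x)) \<gamma>))"


section \<open>The quadratic nonlinearity\<close>

definition bounded_cbilinear_sym :: "('h::complex_hilbert \<Rightarrow> 'h \<Rightarrow> 'h) \<Rightarrow> bool"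
  where "bounded_cbilinear_sym B \<longleftrightarrow>
    bounded_bilinear B \<and> (\<forall>c x y. B (scaleC c x) y = scaleC c (B x y)) \<and>
    (\<forall>x y. B x y = B y x)"

definition Qmap :: "('h::complex_hilbert \<Rightarrow> 'h \<Rightarrow> 'h) \<Rightarrow> 'h \<Rightarrow> 'h"
  where "Qmap B u = B u u"

definition dQ :: "('h::complex_hilbert \<Rightarrow> 'h \<Rightarrow> 'h) \<Rightarrow> 'h \<Rightarrow> 'h \<Rightarrow> 'h"
  where "dQ B u w = 2 *\<^sub>R B u w"

lemma Qmap_has_derivative:
  assumes "bounded_cbilinear_sym B"
  shows "(Qmap B has_derivative dQ B u) (at u)"
proof -
  interpret bounded_bilinear B
    using assms by (simp add: bounded_cbilinear_sym_def)
  have "((\<lambda>x. B x x) has_derivative (\<lambda>w. B u w + B w u)) (at u)"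
    by (rule FDERIV) (rule has_derivative_ident)+
  moreover have "(\<lambda>w. B u w + B w u) = dQ B u"
    using assms by (auto simp: dQ_def bounded_cbilinear_sym_def fun_eq_iff scaleR_2)
  moreover have "(\<lambda>x. B x x) = Qmap B"
    by (auto simp: Qmap_def)
  ultimately show ?thesis by simp
qed


section \<open>The space of square integrable functions on the line\<close>

text \<open>
  Elements of \<open>L\<^sup>2(\<real>, \<bbbH>)\<close> are represented by functions, identified when equal almost
  everywhere. Measurability is Bochner measurability, as the space of values need not be separable.
\<close>

definition strongly_measurable :: "(real \<Rightarrow> 'h::complex_hilbert) \<Rightarrow> bool"
  where "strongly_measurable f \<longleftrightarrow>
    (\<exists>s. (\<forall>n::nat. simple_function lebesgue (s n)) \<and>
         (AE t in lebesgue. (\<lambda>n. s n t) \<longlonglongrightarrow> f t))"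

definition L2 :: "(real \<Rightarrow> 'h::complex_hilbert) set"
  where "L2 = {f. strongly_measurable f \<and> integrable lebesgue (\<lambda>t. (norm (f t))\<^sup>2)}"

definition L2_norm :: "(real \<Rightarrow> 'h::complex_hilbert) \<Rightarrow> real"
  where "L2_norm f = sqrt (LINT t|lebesgue. (norm (f t))\<^sup>2)"

definition test_function :: "(real \<Rightarrow> real) \<Rightarrow> bool"
  where "test_function \<phi> \<longleftrightarrow>
    (\<forall>k t. (deriv ^^ k) \<phi> differentiable (at t)) \<and> compact (closure {t. \<phi> t \<noteq> 0})"

text \<open>
  \<open>w\<close> is the distributional derivative of \<open>g\<close>. The identity \<open>\<integral> \<phi>' g = - \<integral> \<phi> w\<close> of vectors is
  expressed through its inner products with all vectors \<open>h\<close>, because the library's Bochner integral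
  is restricted to separable spaces. Real test functions suffice by linearity. For \<open>g, w\<close> in \<open>L2\<close>,
  as below, both integrands are integrable.
\<close>

definition has_distr_deriv ::
    "(real \<Rightarrow> 'h::complex_hilbert) \<Rightarrow> (real \<Rightarrow> 'h) \<Rightarrow> bool"
  where "has_distr_deriv g w \<longleftrightarrow>
    (\<forall>\<phi> h. test_function \<phi> \<longrightarrow>
      (LINT t|lebesgue. complex_of_real (deriv \<phi> t) * cinner (g t) h) =
      - (LINT t|lebesgue. complex_of_real (\<phi> t) * cinner (w t) h))"


section \<open>The linearized operators\<close>

text \<open>
  An operator on \<open>L2\<close> is represented by its graph. The following is the graph of
  \<open>A \<partial> - T - c A\<close>, with maximal domain: \<open>w\<close> is \<open>A u' = (A u)'\<close>.
\<close>

definition lin_op ::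
    "('h::complex_hilbert \<Rightarrow> 'h) \<Rightarrow> ('h \<Rightarrow> 'h) \<Rightarrow> real \<Rightarrow> ((real \<Rightarrow> 'h) \<times> (real \<Rightarrow> 'h)) set"
  where "lin_op A T c =
    {(u, f). u \<in> L2 \<and> f \<in> L2 \<and>
       (\<exists>w\<in>L2. has_distr_deriv (\<lambda>t. A (u t)) w \<and>
          (AE t in lebesgue. f t = w t - T (u t) - c *\<^sub>R A (u t)))}"

text \<open>Surjectivity onto \<open>L2\<close>, injectivity, and boundedness of the inverse.\<close>

definition boundedly_invertible :: "((real \<Rightarrow> 'h::complex_hilbert) \<times> (real \<Rightarrow> 'h)) set \<Rightarrow> bool"
  where "boundedly_invertible G \<longleftrightarrow>
    (\<forall>f\<in>L2. \<exists>u. (u, f) \<in> G) \<and>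
    (\<forall>u v f g. (u, f) \<in> G \<and> (v, g) \<in> G \<and> (AE t in lebesgue. f t = g t) \<longrightarrow>
       (AE t in lebesgue. u t = v t)) \<and>
    (\<exists>C. \<forall>(u, f)\<in>G. L2_norm u \<le> C * L2_norm f)"

end

theory Submission
  imports Defs
begin

text \<open>
  Only the real inner product \<open>Re \<langle>x, y\<rangle>\<close> is used, and no Fourier transform. The vectors \<open>e\<close> with
  \<open>T e \<in> A (ker T)\<close> span the part of \<open>\<bbbH>\<close> on which \<open>A \<partial> - T\<close> degenerates; by the Kawashima
  condition finitely many of them suffice for a coercivity inequality
  \<open>\<parallel>x\<parallel>\<^sup>2 \<le> \<kappa> (- \<langle>T x, x\<rangle> + \<Sum>\<^sub>e \<langle>A x, e\<rangle>\<^sup>2)\<close>. If \<open>A u' - T u - c A u = f\<close>, then each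
  \<open>\<langle>A u, e\<rangle>\<close> solves a scalar equation \<open>y' = c y + g\<close>, hence is bounded by \<open>f\<close> since \<open>c \<noteq> 0\<close>, and pairing
  the equation with \<open>u\<close> itself bounds \<open>- \<integral> \<langle>T u, u\<rangle>\<close>, because \<open>\<integral> \<langle>A u', u\<rangle> = 0\<close> for self-adjoint \<open>A\<close>.
  For small \<open>c\<close> this yields \<open>\<parallel>u\<parallel> \<le> C \<parallel>f\<parallel>\<close>. So the operator is injective with closed range, and the
  range is dense because the adjoint is of the same form with \<open>A\<close> and \<open>c\<close> replaced by \<open>- A\<close> and \<open>- c\<close>.
\<close>


section \<open>Projections and the generalized kernel\<close>

text \<open>\<open>T\<close> is negative on \<open>V\<close> and vanishes on its complement, so
  pairing the equation with \<open>u\<close> says nothing about the component of \<open>u\<close> in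
  ker \<open>T\<close>. That component is seen only through the scalars <A u, e>: the compensator
  \<open>K\<close> makes \<open>A\<close> injective on ker \<open>T\<close>, and as \<open>V\<close>
  is the range of \<open>T\<close>, every nonzero \<open>v\<close> in ker \<open>T\<close> has <A v,
  e> nonzero for some \<open>e\<close>. Compactness of the unit sphere of the finite-dimensional ker
  \<open>T\<close> makes finitely many \<open>e\<close> suffice. A chain has at most two links,
  \<open>T e = A e'\<close> and \<open>T e' = 0\<close>, so the scalar equations close after two
  steps, each costing a factor 1/c^2 in the squared norm; this is harmless, since \<open>c\<close>
  is fixed before the bound is sought. Smallness of \<open>c\<close> absorbs the term c <A u, u>.
  The analytic obstacle is the identity for <A u', u>: only \<open>A u\<close>, not
  \<open>u\<close>, is weakly differentiable, so the derivative is taken on translations of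
  \<open>A u\<close> tested against \<open>u\<close>. No sign of \<open>c\<close> is preferred, so
  both operators and their adjoints are instances of one estimate.\<close>

instance complex_hilbert \<subseteq> banach ..

section \<open>Minimizing sequences, projections and coercive equations\<close>

text \<open>The parallelogram law makes minimizing sequences Cauchy: \<open>F\<close> stands for the
  squared distance to the target, \<open>D\<close> for the squared distance of two candidates and
  \<open>m\<close> for their midpoint, where \<open>F m\<close> is at least the infimum. The
  abstract index set serves closed subspaces of a Hilbert space as well as sets of representatives
  in \<open>L2\<close>, which do not form a type.\<close>

lemma minimizing_sequence:
  fixes F :: "'i \<Rightarrow> real" and D :: "'i \<Rightarrow> 'i \<Rightarrow> real"
  assumes "I \<noteq> {}" and nonneg: "\<And>i. i \<in> I \<Longrightarrow> 0 \<le> F i"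
    and par: "\<And>i j. i \<in> I \<Longrightarrow> j \<in> I \<Longrightarrow> \<exists>m\<in>I. D i j \<le> 2 * F i + 2 * F j - 4 * F m"
  obtains x :: "nat \<Rightarrow> 'i" where "\<And>n. x n \<in> I"
    and "\<And>n i. i \<in> I \<Longrightarrow> F (x n) \<le> F i + 1 / Suc n"
    and "\<And>m n. D (x m) (x n) \<le> 2 / Suc m + 2 / Suc n"
proof -
  have bdd: "bdd_below (F ` I)"
    using nonneg by (auto intro: bdd_belowI[of _ 0])
  define d where "d = Inf (F ` I)"
  have d: "d \<le> F i" if "i \<in> I" for i
    unfolding d_def using that bdd by (auto intro: cInf_lower)
  have "\<exists>i\<in>I. F i < d + 1 / Suc n" for n
    using cInf_lessD[of "F ` I" "d + 1 / Suc n"] \<open>I \<noteq> {}\<close> unfolding d_def by auto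
  then obtain x where x: "\<And>n. x n \<in> I" "\<And>n. F (x n) < d + 1 / Suc n" by metis
  show thesis
  proof (rule that[of x])
    show "x n \<in> I" for n by (rule x)
    show "F (x n) \<le> F i + 1 / Suc n" if "i \<in> I" for n i
      using x(2)[of n] d[OF that] by simp
    show "D (x m) (x n) \<le> 2 / Suc m + 2 / Suc n" for m n
    proof -
      obtain k where "k \<in> I" "D (x m) (x n) \<le> 2 * F (x m) + 2 * F (x n) - 4 * F k"
        using par x(1) by blast
      moreover have "2 / Suc m = 2 * (1 / Suc m)" "2 / Suc n = 2 * (1 / Suc n)" by simp_all
      ultimately show ?thesis using x(2)[of m] x(2)[of n] d[of k] by linarith
    qed
  qed
qed

lemma Cauchy_of_inverse_bound:
  fixes D :: "nat \<Rightarrow> nat \<Rightarrow> real"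
  assumes "\<And>m n. D m n \<le> 2 / Suc m + 2 / Suc n" and "0 < e"
  shows "\<exists>N. \<forall>m\<ge>N. \<forall>n\<ge>N. D m n < e"
proof -
  obtain N :: nat where N: "4 / e < N" using reals_Archimedean2 by blast
  have N0: "0 < N" using N \<open>0 < e\<close> by (metis divide_pos_pos gr0I less_asym of_nat_0 zero_less_numeral)
  have "2 / Suc m \<le> 2 / real N" if "m \<ge> N" for m
    using that N0 by (intro divide_left_mono) auto
  moreover have "2 / real N + 2 / real N < e"
    using N \<open>0 < e\<close> N0 by (simp add: field_simps)
  ultimately have "\<forall>m\<ge>N. \<forall>n\<ge>N. D m n < e"
    using assms(1) by (smt (verit))
  then show ?thesis by blast
qed

text \<open>The parabola in \<open>s\<close> has its minimum at \<open>s = 0\<close>.\<close>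

lemma linear_coeff_eq_zero:
  fixes a b :: real
  assumes "\<And>s. 0 \<le> 2 * s * a + s\<^sup>2 * b"
  shows "a = 0"
proof (rule ccontr)
  assume "a \<noteq> 0"
  define c where "c = \<bar>b\<bar> + 1"
  have c: "c > 0" "b \<le> c" by (auto simp: c_def)
  have "0 \<le> 2 * (- a / c) * a + (- a / c)\<^sup>2 * b" by (rule assms)
  also have "\<dots> \<le> 2 * (- a / c) * a + (- a / c)\<^sup>2 * c"
    using c by (intro add_left_mono mult_left_mono) auto
  also have "\<dots> = - a\<^sup>2 / c" using c by (simp add: power2_eq_square divide_simps)
  also have "\<dots> < 0" using c \<open>a \<noteq> 0\<close> by simp
  finally show False by simp
qed

lemma closed_subspace_projection:
  fixes V :: "'a::{real_inner, complete_space} set"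
  assumes V: "subspace V" "closed V"
  shows "\<exists>v\<in>V. \<forall>z\<in>V. inner (x - v) z = 0"
proof -
  have par: "(norm (i - j))\<^sup>2 \<le> 2 * (norm (x - i))\<^sup>2 + 2 * (norm (x - j))\<^sup>2
      - 4 * (norm (x - (1/2) *\<^sub>R (i + j)))\<^sup>2" for i j :: 'a
    by (simp add: power2_norm_eq_inner inner_simps inner_commute algebra_simps)
  obtain v where v: "\<And>n. v n \<in> V" "\<And>n i. i \<in> V \<Longrightarrow> (norm (x - v n))\<^sup>2 \<le> (norm (x - i))\<^sup>2 + 1 / Suc n"
      "\<And>m n. (norm (v m - v n))\<^sup>2 \<le> 2 / Suc m + 2 / Suc n"
  proof (rule minimizing_sequence[of V "\<lambda>i. (norm (x - i))\<^sup>2" "\<lambda>i j. (norm (i - j))\<^sup>2"])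
    show "V \<noteq> {}" using V subspace_0 by blast
    show "\<exists>m\<in>V. (norm (i - j))\<^sup>2 \<le> 2 * (norm (x - i))\<^sup>2 + 2 * (norm (x - j))\<^sup>2 - 4 * (norm (x - m))\<^sup>2"
      if "i \<in> V" "j \<in> V" for i j
      using par V that by (intro bexI[of _ "(1/2) *\<^sub>R (i + j)"]) (auto simp: subspace_add subspace_scale)
  qed auto
  have "Cauchy v"
  proof (rule metric_CauchyI)
    fix e :: real assume "0 < e"
    then obtain N where N: "\<forall>m\<ge>N. \<forall>n\<ge>N. (norm (v m - v n))\<^sup>2 < e\<^sup>2"
      using Cauchy_of_inverse_bound[OF v(3), of "e\<^sup>2"] by auto
    then show "\<exists>N. \<forall>m\<ge>N. \<forall>n\<ge>N. dist (v m) (v n) < e"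
      using \<open>0 < e\<close> by (auto simp: dist_norm intro!: exI[of _ N] intro: power2_less_imp_less)
  qed
  then obtain l where l: "v \<longlonglongrightarrow> l" using Cauchy_convergent convergent_def by blast
  have "l \<in> V" using closed_sequentially[OF V(2)] v(1) l by blast
  have min: "(norm (x - l))\<^sup>2 \<le> (norm (x - i))\<^sup>2" if "i \<in> V" for i
  proof (rule LIMSEQ_le)
    show "(\<lambda>n. (norm (x - v n))\<^sup>2) \<longlonglongrightarrow> (norm (x - l))\<^sup>2"
      by (intro tendsto_intros l)
    show "(\<lambda>n. (norm (x - i))\<^sup>2 + 1 / Suc n) \<longlonglongrightarrow> (norm (x - i))\<^sup>2"
      using tendsto_add[OF tendsto_const lim_inverse_n'[THEN LIMSEQ_Suc]] by force
  qed (use v(2)[OF that] in auto)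
  have "inner (x - l) z = 0" if "z \<in> V" for z
  proof -
    \<comment> \<open>In the expansion of the squared norm of x - l - s z the coefficient of 2 s is
      - <x - l, z>, hence the sign.\<close>
    have "- inner (x - l) z = 0"
    proof (rule linear_coeff_eq_zero[where b = "inner z z"])
      fix s
      have "l + s *\<^sub>R z \<in> V"
        using V that \<open>l \<in> V\<close> by (simp add: subspace_add subspace_scale)
      from min[OF this] show "0 \<le> 2 * s * - inner (x - l) z + s\<^sup>2 * inner z z"
        by (simp only: power2_norm_eq_inner) (simp add: inner_simps inner_commute algebra_simps power2_eq_square)
    qed
    then show ?thesis by simp
  qed
  then show ?thesis using \<open>l \<in> V\<close> by blast
qed

text \<open>Lax-Milgram by Banach's fixed point theorem: \<open>T\<close> is negative on
  \<open>V\<close>, so a short step from \<open>v\<close> along \<open>T v - b\<close> contracts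
  \<open>V\<close>, and its fixed point solves the equation.\<close>

lemma coercive_solvable:
  fixes T :: "'a::{real_inner, complete_space} \<Rightarrow> 'a"
  assumes "bounded_linear T" and V: "subspace V" "closed V"
    and TV: "\<And>v. v \<in> V \<Longrightarrow> T v \<in> V"
    and "0 < \<delta>" and coer: "\<And>v. v \<in> V \<Longrightarrow> inner (T v) v \<le> - \<delta> * (norm v)\<^sup>2"
    and "b \<in> V"
  shows "\<exists>v\<in>V. T v = b"
proof -
  interpret T: bounded_linear T by fact
  obtain M where M: "0 < M" "\<And>x. norm (T x) \<le> norm x * M"
    using T.pos_bounded by blast
  \<comment> \<open>This step length minimizes
    \<open>1 - 2 * \<tau> * \<delta> + \<tau>\<^sup>2 * M\<^sup>2\<close> and turns it into
    \<open>1 - \<tau> * \<delta>\<close>.\<close>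
  define \<tau> where "\<tau> = \<delta> / M\<^sup>2"
  have \<tau>: "0 < \<tau>" using \<open>0 < \<delta>\<close> M(1) by (simp add: \<tau>_def)
  define q where "q = 1 - 2 * \<tau> * \<delta> + \<tau>\<^sup>2 * M\<^sup>2"
  have "\<tau>\<^sup>2 * M\<^sup>2 = \<tau> * \<delta>" using M(1) by (simp add: \<tau>_def power2_eq_square)
  then have "q < 1" using mult_pos_pos[OF \<tau> \<open>0 < \<delta>\<close>] unfolding q_def by linarith
  \<comment> \<open>The maximum with 0 keeps the contraction factor nonnegative: if \<open>V\<close>
    is trivial, \<open>\<delta>\<close> may exceed \<open>M\<close>, and then \<open>q\<close> is
    negative.\<close>
  have contr: "norm (x + \<tau> *\<^sub>R T x) \<le> sqrt (max 0 q) * norm x" if "x \<in> V" for x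
  proof -
    have "(norm (x + \<tau> *\<^sub>R T x))\<^sup>2 = (norm x)\<^sup>2 + 2 * \<tau> * inner (T x) x + \<tau>\<^sup>2 * (norm (T x))\<^sup>2"
      by (simp only: power2_norm_eq_inner) (simp add: inner_simps inner_commute power2_eq_square)
    also have "\<dots> \<le> (norm x)\<^sup>2 + 2 * \<tau> * (- \<delta> * (norm x)\<^sup>2) + \<tau>\<^sup>2 * (norm x * M)\<^sup>2"
      using coer[OF that] M(2)[of x] \<tau> by (intro add_mono mult_left_mono power_mono) auto
    also have "\<dots> = q * (norm x)\<^sup>2"
      by (simp add: q_def algebra_simps power_mult_distrib)
    also have "\<dots> \<le> max 0 q * (norm x)\<^sup>2" by (intro mult_right_mono) auto
    finally have "sqrt ((norm (x + \<tau> *\<^sub>R T x))\<^sup>2) \<le> sqrt (max 0 q * (norm x)\<^sup>2)"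
      by (rule real_sqrt_le_mono)
    then show ?thesis by (simp add: real_sqrt_mult)
  qed
  have "\<exists>!v\<in>V. v + \<tau> *\<^sub>R (T v - b) = v"
  proof (rule Banach_fix)
    show "complete V" using V(2) by (simp add: complete_eq_closed)
    show "V \<noteq> {}" using \<open>b \<in> V\<close> by blast
    show "0 \<le> sqrt (max 0 q)" "sqrt (max 0 q) < 1" using \<open>q < 1\<close> by auto
    show "(\<lambda>v. v + \<tau> *\<^sub>R (T v - b)) ` V \<subseteq> V"
      using V TV \<open>b \<in> V\<close> by (auto intro!: subspace_add subspace_scale subspace_diff)
    show "dist (x + \<tau> *\<^sub>R (T x - b)) (y + \<tau> *\<^sub>R (T y - b)) \<le> sqrt (max 0 q) * dist x y"
      if "x \<in> V" "y \<in> V" for x y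
    proof -
      from that have "x - y \<in> V" using V by (simp add: subspace_diff)
      from contr[OF this] show "dist (x + \<tau> *\<^sub>R (T x - b)) (y + \<tau> *\<^sub>R (T y - b)) \<le> sqrt (max 0 q) * dist x y"
        by (simp add: dist_norm T.diff algebra_simps)
    qed
  qed
  then show ?thesis using \<tau> by auto
qed

section \<open>Compactness in finite dimension and the generalized kernel\<close>

text \<open>Adding one vector to \<open>S\<close> adds a compact segment, and sums of compact sets
  are compact. Boxes of coefficients replace balls of a coordinate space, whose dimension would have
  to be encoded in a type.\<close>

lemma compact_box_image:
  fixes S :: "'a::real_normed_vector set"
  assumes "finite S"
  shows "compact {\<Sum>b\<in>S. c b *\<^sub>R b | c. \<forall>b\<in>S. \<bar>c b\<bar> \<le> (1::real)}"
  using assms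
proof (induction S)
  case empty
  then show ?case by simp
next
  case (insert a S)
  have 1: "compact ((\<lambda>r. r *\<^sub>R a) ` {-1..1})"
    by (intro compact_continuous_image continuous_intros compact_Icc)
  have "{\<Sum>b\<in>insert a S. c b *\<^sub>R b | c. \<forall>b\<in>insert a S. \<bar>c b\<bar> \<le> 1} =
      {x + y | x y. x \<in> (\<lambda>r. r *\<^sub>R a) ` {-1..1} \<and> y \<in> {\<Sum>b\<in>S. c b *\<^sub>R b | c. \<forall>b\<in>S. \<bar>c b\<bar> \<le> 1}}"
    (is "?L = ?R")
  proof (intro equalityI subsetI)
    fix z assume "z \<in> ?L"
    then obtain c where c: "\<forall>b\<in>insert a S. \<bar>c b\<bar> \<le> 1" "z = (\<Sum>b\<in>insert a S. c b *\<^sub>R b)" by blast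
    then show "z \<in> ?R" using insert.hyps by (fastforce simp: abs_le_iff)
  next
    fix z assume "z \<in> ?R"
    then obtain r c where rc: "r \<in> {-1..1}" "\<forall>b\<in>S. \<bar>c b\<bar> \<le> 1" "z = r *\<^sub>R a + (\<Sum>b\<in>S. c b *\<^sub>R b)" by blast
    have "(\<Sum>b\<in>S. (c(a := r)) b *\<^sub>R b) = (\<Sum>b\<in>S. c b *\<^sub>R b)"
      using insert.hyps by (intro sum.cong) auto
    then have "z = (\<Sum>b\<in>insert a S. (c(a := r)) b *\<^sub>R b)"
      using rc insert.hyps by simp
    moreover have "\<forall>b\<in>insert a S. \<bar>(c(a := r)) b\<bar> \<le> 1" using rc by auto
    ultimately show "z \<in> ?L" by blast
  qed
  then show ?case using compact_sums[OF 1 insert.IH] by simp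
qed

text \<open>The coefficients of a unit vector in an orthonormal system are at most 1 in absolute
  value by Cauchy-Schwarz, so the sphere is a closed subset of a compact box image.\<close>

lemma compact_sphere_span:
  fixes S :: "'a::real_inner set"
  assumes "finite S" "closed W" "W \<subseteq> span S"
  shows "compact (W \<inter> sphere 0 1)"
proof -
  obtain C where C: "finite C" "span C = span S" "pairwise orthogonal C"
    using basis_orthogonal[OF \<open>finite S\<close>] by blast
  \<comment> \<open>An orthogonal spanning set may contain 0, which has to go before
    normalization.\<close>
  define C' where "C' = (\<lambda>b. b /\<^sub>R norm b) ` (C - {0})"
  have C'1: "finite C'" "\<And>b. b \<in> C' \<Longrightarrow> norm b = 1"
    using C(1) unfolding C'_def by (auto simp del: left_inverse) (metis left_inverse norm_eq_zero)
  have orth: "inner a b = 0" if "a \<in> C'" "b \<in> C'" "a \<noteq> b" for a b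
  proof -
    obtain a' b' where ab: "a' \<in> C" "b' \<in> C" "a = a' /\<^sub>R norm a'" "b = b' /\<^sub>R norm b'"
      using \<open>a \<in> C'\<close> \<open>b \<in> C'\<close> unfolding C'_def by blast
    then have "a' \<noteq> b'" using \<open>a \<noteq> b\<close> by blast
    then have "inner a' b' = 0" using C(3) ab(1,2) by (auto simp: pairwise_def orthogonal_def)
    then show ?thesis by (simp add: ab(3,4))
  qed
  have "span C' = span C"
    unfolding C'_def
  proof (intro span_eq[THEN iffD2] conjI subsetI)
    fix x assume "x \<in> (\<lambda>b. b /\<^sub>R norm b) ` (C - {0})"
    then show "x \<in> span C" by (auto intro: span_scale span_base)
  next
    fix x assume "x \<in> C"
    show "x \<in> span ((\<lambda>b. b /\<^sub>R norm b) ` (C - {0}))"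
    proof (cases "x = 0")
      case False
      then have "norm x *\<^sub>R (x /\<^sub>R norm x) \<in> span ((\<lambda>b. b /\<^sub>R norm b) ` (C - {0}))"
        using \<open>x \<in> C\<close> by (intro span_scale span_base) auto
      then show ?thesis using False by simp
    qed (simp add: span_0)
  qed
  have sub: "W \<inter> sphere 0 1 \<subseteq> {\<Sum>b\<in>C'. c b *\<^sub>R b | c. \<forall>b\<in>C'. \<bar>c b\<bar> \<le> (1::real)}"
  proof
    fix x assume x: "x \<in> W \<inter> sphere 0 1"
    then have "x \<in> span C'" using assms C \<open>span C' = span C\<close> by blast
    then obtain c where c: "x = (\<Sum>b\<in>C'. c b *\<^sub>R b)"
      using span_finite[OF C'1(1)] by auto
    have "\<bar>c b\<bar> \<le> 1" if "b \<in> C'" for b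
    proof -
      have "inner x b = (\<Sum>a\<in>C'. c a * inner a b)" by (simp add: c inner_sum_left)
      also have "\<dots> = (\<Sum>a\<in>C'. if a = b then c b else 0)"
        using orth C'1(2) that by (intro sum.cong) (auto simp: dot_square_norm)
      also have "\<dots> = c b" using that C'1 by simp
      finally show ?thesis using Cauchy_Schwarz_ineq2[of x b] x C'1(2)[OF that] by simp
    qed
    then show "x \<in> {\<Sum>b\<in>C'. c b *\<^sub>R b | c. \<forall>b\<in>C'. \<bar>c b\<bar> \<le> (1::real)}" using c by blast
  qed
  have "closed (W \<inter> sphere 0 1)"
  proof (intro closed_Int assms)
    have "closed {x :: 'a. norm x = 1}" by (intro closed_Collect_eq continuous_intros)
    then show "closed (sphere (0 :: 'a) 1)" by (simp add: sphere_def dist_norm)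
  qed
  then show ?thesis
    using compact_Int_closed[OF compact_box_image[OF C'1(1)], of "W \<inter> sphere 0 1"]
    by (simp only: Int_absorb1[OF sub])
qed

lemma norm_add_sq_le: "(norm (x + y))\<^sup>2 \<le> 2 * (norm x)\<^sup>2 + 2 * (norm (y::'a::real_inner))\<^sup>2"
proof -
  have "(norm (x + y))\<^sup>2 \<le> (norm x + norm y)\<^sup>2" by (simp add: norm_triangle_ineq power_mono)
  then show ?thesis using sum_squares_bound[of "norm x" "norm y"] by (simp add: power2_sum)
qed

text \<open>
  The vectors \<open>e\<close> with \<open>T e \<in> A (ker T)\<close> form the generalized kernel of the pencil
  \<open>A \<partial> - T\<close>; all its Jordan chains have length at most two.
\<close>

lemma generalized_kernel_detects:
  fixes A T :: "'a::{real_inner, complete_space} \<Rightarrow> 'a"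
  assumes A: "bounded_linear A" "\<And>x y. inner (A x) y = inner x (A y)"
    and T: "bounded_linear T" "\<And>x y. inner (T x) y = inner x (T y)"
    and V: "subspace V" "closed V"
    and ker: "\<And>x. T x = 0 \<longleftrightarrow> (\<forall>v\<in>V. inner x v = 0)"
    and "0 < \<delta>" and coer: "\<And>v. v \<in> V \<Longrightarrow> inner (T v) v \<le> - \<delta> * (norm v)\<^sup>2"
    and fin: "finite S" "{x. T x = 0} \<subseteq> span S"
    and inj: "\<And>v. T v = 0 \<Longrightarrow> A v = 0 \<Longrightarrow> v = 0"
  obtains F \<kappa> where "finite F" "0 < \<kappa>"
    "\<And>e. e \<in> F \<Longrightarrow> \<exists>e'. T e' = 0 \<and> T e = A e'"
    "\<And>u. (norm u)\<^sup>2 \<le> \<kappa> * (- inner (T u) u + (\<Sum>e\<in>F. (inner (A u) e)\<^sup>2))"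
proof -
  interpret A: bounded_linear A by fact
  interpret T: bounded_linear T by fact
  have decomp: "\<exists>v1 v2. T v1 = 0 \<and> v2 \<in> V \<and> u = v1 + v2" for u
  proof -
    obtain v where "v \<in> V" "\<forall>z\<in>V. inner (u - v) z = 0"
      using closed_subspace_projection[OF V] by blast
    then show ?thesis using ker by (intro exI[of _ "u - v"] exI[of _ v]) auto
  qed
  \<comment> \<open>\<open>V\<close> is closed, so the complement of its complement ker
    \<open>T\<close> is no larger than \<open>V\<close>.\<close>
  have biorth: "x \<in> V" if "\<And>y. T y = 0 \<Longrightarrow> inner x y = 0" for x
  proof -
    obtain v1 v2 where v: "T v1 = 0" "v2 \<in> V" "x = v1 + v2" using decomp by blast
    have "inner v1 v2 = 0" using ker v by blast
    then have "inner v1 v1 = 0" using that[OF v(1)] v by (simp add: inner_simps inner_commute)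
    then show ?thesis using v by simp
  qed
  have TV: "T v \<in> V" for v
    by (rule biorth) (simp add: T(2))
  define E where "E = {e. \<exists>e'. T e' = 0 \<and> T e = A e'}"
  have kerE: "e \<in> E" if "T e = 0" for e
    using that unfolding E_def by (intro CollectI exI[of _ 0]) (simp add: T.zero A.zero)
  \<comment> \<open>If \<open>A v\<close> annihilated all of \<open>E\<close>, it would be
    orthogonal to ker \<open>T\<close>, hence lie in \<open>V\<close> and equal \<open>T e\<close>
    for some \<open>e\<close> in \<open>V\<close>. This \<open>e\<close> belongs to \<open>E\<close>
    by construction, so <T e, e> = <A v, e> = 0, and coercivity gives e = 0, against the injectivity
    of \<open>A\<close> on ker \<open>T\<close>.\<close>
  have ex: "\<exists>e\<in>E. inner (A v) e \<noteq> 0" if v: "T v = 0" "v \<noteq> 0" for v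
  proof (rule ccontr)
    assume "\<not> ?thesis"
    then have *: "inner (A v) e = 0" if "e \<in> E" for e using that by blast
    have "A v \<in> V" by (rule biorth) (simp add: * kerE)
    then obtain e where e: "e \<in> V" "T e = A v"
      using coercive_solvable[OF T(1) V TV \<open>0 < \<delta>\<close> coer] by blast
    then have "e \<in> E" using v by (auto simp: E_def)
    then have "inner (T e) e = 0" using * e by simp
    then have "e = 0" using coer[OF e(1)] \<open>0 < \<delta>\<close> by (simp add: mult_le_0_iff)
    then have "A v = 0" using e by (simp add: T.zero)
    then show False using inj v by blast
  qed
  let ?K = "{x. T x = 0} \<inter> sphere 0 1"
  have "closed {x. T x = 0}"
    by (intro closed_Collect_eq continuous_intros T.continuous_on)
  then have K: "compact ?K" using fin by (intro compact_sphere_span)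
  have "open {v. inner (A v) e \<noteq> 0}" for e
    by (intro open_Collect_neq continuous_on_inner continuous_on_const A.continuous_on continuous_on_id)
  moreover have "?K \<subseteq> (\<Union>e\<in>E. {v. inner (A v) e \<noteq> 0})" using ex by fastforce
  ultimately obtain F where F: "F \<subseteq> E" "finite F" "?K \<subseteq> (\<Union>e\<in>F. {v. inner (A v) e \<noteq> 0})"
    by (rule compactE_image[OF K])
  define p where "p u = (\<Sum>e\<in>F. (inner (A u) e)\<^sup>2)" for u
  have p0: "0 \<le> p u" for u by (simp add: p_def sum_nonneg)
  \<comment> \<open>\<open>\<mu>\<close> is the minimum of the quadratic form \<open>p\<close> on
    the unit sphere of ker \<open>T\<close>, extended by homogeneity; if the kernel is trivial, 1
    will do.\<close>
  obtain \<mu> where \<mu>: "0 < \<mu>" "\<And>v. T v = 0 \<Longrightarrow> \<mu> * (norm v)\<^sup>2 \<le> p v"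
  proof (cases "?K = {}")
    case True
    have "v = 0" if "T v = 0" for v
    proof (rule ccontr)
      assume "v \<noteq> 0"
      then have "v /\<^sub>R norm v \<in> ?K" using that by (simp add: T.scaleR)
      then show False using True by blast
    qed
    then have "1 * (norm v)\<^sup>2 \<le> p v" if "T v = 0" for v
      using that p0[of v] by (metis mult_zero_right norm_zero zero_power2)
    then show thesis by (intro that[of 1]) auto
  next
    case False
    have "continuous_on ?K p" unfolding p_def by (intro continuous_intros A.continuous_on)
    then obtain x where x: "x \<in> ?K" "\<And>y. y \<in> ?K \<Longrightarrow> p x \<le> p y"
      using continuous_attains_inf[OF K False] by blast
    obtain e where "e \<in> F" "inner (A x) e \<noteq> 0" using x(1) F(3) by blast
    then have "0 < p x" unfolding p_def using F(2) by (intro sum_pos2[of F e]) auto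
    moreover have "p x * (norm v)\<^sup>2 \<le> p v" if "T v = 0" for v
    proof (cases "v = 0")
      case False
      have "p x \<le> p (v /\<^sub>R norm v)" using False that by (intro x(2)) (simp add: T.scaleR)
      also have "\<dots> = p v / (norm v)\<^sup>2"
        by (simp add: p_def A.scaleR power_mult_distrib power_inverse sum_distrib_left divide_inverse mult.commute)
      finally show ?thesis using False by (simp add: field_simps)
    qed (simp add: p0)
    ultimately show thesis by (rule that)
  qed
  obtain M where M: "0 < M" "\<And>x. norm (A x) \<le> norm x * M" using A.pos_bounded by blast
  define L where "L = (\<Sum>e\<in>F. (M * norm e)\<^sup>2)"
  have L: "0 \<le> L" "p v \<le> L * (norm v)\<^sup>2" for v
  proof -
    show "0 \<le> L" by (simp add: L_def sum_nonneg)
    have "(inner (A v) e)\<^sup>2 \<le> (M * norm e)\<^sup>2 * (norm v)\<^sup>2" for e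
    proof -
      have "\<bar>inner (A v) e\<bar> \<le> norm (A v) * norm e" by (rule Cauchy_Schwarz_ineq2)
      also have "\<dots> \<le> M * norm e * norm v" using mult_right_mono[OF M(2)[of v] norm_ge_zero[of e]] by (simp add: mult_ac)
      finally have "\<bar>inner (A v) e\<bar>\<^sup>2 \<le> (M * norm e * norm v)\<^sup>2" by (intro power_mono) auto
      then show ?thesis by (simp add: power_mult_distrib)
    qed
    then show "p v \<le> L * (norm v)\<^sup>2" by (simp add: p_def L_def sum_distrib_right sum_mono)
  qed
  \<comment> \<open>From |u|^2 <= 2 |v1|^2 + 2 |v2|^2, \<mu> |v1|^2 <= p(v1) <= 2 p(u) + 2 L |v2|^2
    and \<delta> |v2|^2 <= q, the coefficients of \<open>p u\<close> and of \<open>q\<close> come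
    out as the two summands. Both quantities are nonnegative, so the sum of the coefficients serves
    for both.\<close>
  define \<kappa> where "\<kappa> = 4 / \<mu> + (4 * L / \<mu> + 2) / \<delta>"
  show thesis
  proof (rule that[OF F(2)])
    show "0 < \<kappa>" using \<mu> L \<open>0 < \<delta>\<close> by (simp add: \<kappa>_def add_pos_nonneg)
    show "\<exists>e'. T e' = 0 \<and> T e = A e'" if "e \<in> F" for e using that F(1) by (auto simp: E_def)
    fix u
    obtain v1 v2 where v: "T v1 = 0" "v2 \<in> V" "u = v1 + v2" using decomp by blast
    define q where "q = - inner (T u) u"
    have "inner (T u) u = inner (T v2) v2"
      using v T(2)[of v2 v1] by (simp add: T.add inner_simps)
    then have q: "\<delta> * (norm v2)\<^sup>2 \<le> q" using coer[OF v(2)] by (simp add: q_def)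
    have "(norm v2)\<^sup>2 \<le> q / \<delta>" using q \<open>0 < \<delta>\<close> by (simp add: field_simps)
    have "p v1 \<le> 2 * p u + 2 * p v2"
    proof -
      have "(inner (A v1) e)\<^sup>2 \<le> 2 * (inner (A u) e)\<^sup>2 + 2 * (inner (A v2) e)\<^sup>2" for e
      proof -
        have "inner (A v1) e = inner (A u) e - inner (A v2) e" using v by (simp add: A.add inner_simps)
        then show ?thesis using sum_squares_bound[of "inner (A u) e" "- inner (A v2) e"]
          by (simp add: power2_diff)
      qed
      then show ?thesis unfolding p_def by (simp add: sum_distrib_left sum.distrib[symmetric] sum_mono)
    qed
    also have "\<dots> \<le> 2 * p u + 2 * (L * (norm v2)\<^sup>2)" using L(2)[of v2] by simp
    finally have "(norm v1)\<^sup>2 \<le> (2 * p u + 2 * (L * (norm v2)\<^sup>2)) / \<mu>"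
      using \<mu>(2)[OF v(1)] \<mu>(1) by (simp add: field_simps)
    moreover have "(norm u)\<^sup>2 \<le> 2 * (norm v1)\<^sup>2 + 2 * (norm v2)\<^sup>2"
      unfolding v(3) by (rule norm_add_sq_le)
    moreover have "2 * ((2 * p u + 2 * (L * (norm v2)\<^sup>2)) / \<mu>) + 2 * (norm v2)\<^sup>2
        = 4 / \<mu> * p u + (4 * L / \<mu> + 2) * (norm v2)\<^sup>2"
      by (simp add: add_divide_distrib algebra_simps)
    ultimately have "(norm u)\<^sup>2 \<le> 4 / \<mu> * p u + (4 * L / \<mu> + 2) * (norm v2)\<^sup>2"
      by linarith
    also have "\<dots> \<le> 4 / \<mu> * p u + (4 * L / \<mu> + 2) * (q / \<delta>)"
      using \<open>(norm v2)\<^sup>2 \<le> q / \<delta>\<close> L(1) \<mu>(1) by (intro add_left_mono mult_left_mono) auto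
    also have "\<dots> \<le> \<kappa> * (q + p u)"
    proof -
      have "0 \<le> q" using q \<open>0 < \<delta>\<close>
        by (meson dual_order.trans less_imp_le mult_nonneg_nonneg zero_le_power2)
      then have "0 \<le> 4 / \<mu> * q" "0 \<le> (4 * L / \<mu> + 2) / \<delta> * p u"
        using \<mu>(1) L(1) \<open>0 < \<delta>\<close> p0 by auto
      then show ?thesis by (simp add: \<kappa>_def distrib_left distrib_right)
    qed
    finally show "(norm u)\<^sup>2 \<le> \<kappa> * (- inner (T u) u + (\<Sum>e\<in>F. (inner (A u) e)\<^sup>2))"
      by (simp add: q_def p_def)
  qed
qed


section \<open>Square integrable functions\<close>

text \<open>The limit may fail to exist on a null set; there the total function \<open>lim\<close>
  takes some value, and completeness of Lebesgue measure makes the difference irrelevant.\<close>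

lemma borel_measurable_AE_lim:
  fixes g :: "real \<Rightarrow> real"
  assumes "\<And>n. s n \<in> borel_measurable lebesgue"
    and "AE t in lebesgue. (\<lambda>n. s n t) \<longlonglongrightarrow> g t"
  shows "g \<in> borel_measurable lebesgue"
proof (rule borel_measurable_AE)
  show "(\<lambda>t. lim (\<lambda>n. s n t)) \<in> borel_measurable lebesgue"
    using assms(1) by measurable
  show "AE t in lebesgue. lim (\<lambda>n. s n t) = g t"
    using assms(2) by eventually_elim (rule limI)
qed

lemma AE_lebesgue_shift:
  assumes "AE t in lebesgue. P t"
  shows "AE t in lebesgue. P (t + a :: real)"
proof -
  have m: "(\<lambda>x. a + x) \<in> lebesgue \<rightarrow>\<^sub>M lebesgue"
    using lebesgue_affine_measurable[of "\<lambda>_. 1" a] by simp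
  have eq: "distr lebesgue lebesgue (\<lambda>x. a + x) = lebesgue"
    using lebesgue_real_affine[of 1 a] by (simp add: density_1)
  have "AE x in distr lebesgue lebesgue (\<lambda>x. a + x). P x" unfolding eq by (rule assms)
  then show ?thesis using AE_distrD[OF m] by (simp add: add.commute)
qed

text \<open>
  Pettis' theorem with distances in place of functionals. In a nonseparable space Borel
  measurability would not pass to sums; this criterion passes to limits.
\<close>

lemma strongly_measurable_iff:
  "strongly_measurable f \<longleftrightarrow> (\<exists>D. countable D \<and> (AE t in lebesgue. f t \<in> closure D) \<and>
     (\<forall>d. (\<lambda>t. norm (f t - d)) \<in> borel_measurable lebesgue))"
proof
  assume "strongly_measurable f"
  then obtain s where s: "\<And>n. simple_function lebesgue (s n)"
    "AE t in lebesgue. (\<lambda>n. s n t) \<longlonglongrightarrow> f t" by (auto simp: strongly_measurable_def)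
  have "countable (\<Union>n. range (s n))"
    using s(1) by (intro countable_UN uncountable_infinite) (auto simp: simple_function_def countable_finite)
  moreover have "AE t in lebesgue. f t \<in> closure (\<Union>n. range (s n))"
    using s(2) by eventually_elim (force simp: closure_sequential)
  moreover have "(\<lambda>t. norm (f t - d)) \<in> borel_measurable lebesgue" for d
  proof (rule borel_measurable_AE_lim)
    show "(\<lambda>t. norm (s n t - d)) \<in> borel_measurable lebesgue" for n
      by (intro borel_measurable_simple_function simple_function_compose1[OF s(1)])
    show "AE t in lebesgue. (\<lambda>n. norm (s n t - d)) \<longlonglongrightarrow> norm (f t - d)"
      using s(2) by eventually_elim (intro tendsto_intros)
  qed
  ultimately show "\<exists>D. countable D \<and> (AE t in lebesgue. f t \<in> closure D) \<and>
     (\<forall>d. (\<lambda>t. norm (f t - d)) \<in> borel_measurable lebesgue)" by blast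
next
  assume "\<exists>D. countable D \<and> (AE t in lebesgue. f t \<in> closure D) \<and>
     (\<forall>d. (\<lambda>t. norm (f t - d)) \<in> borel_measurable lebesgue)"
  then obtain D where D: "countable D" "AE t in lebesgue. f t \<in> closure D"
    and [measurable]: "\<And>d. (\<lambda>t. norm (f t - d)) \<in> borel_measurable lebesgue" by blast
  \<comment> \<open>Inserting 0 makes the set nonempty, as an enumeration by all natural numbers
    requires.\<close>
  define d where "d = from_nat_into (insert 0 D)"
  have range_d: "range d = insert 0 D"
    using D(1) by (simp add: d_def range_from_nat_into)
  \<comment> \<open>The n-th approximant is the first of \<open>d 0\<close>, ..., \<open>d n\<close>
    at least distance from \<open>f t\<close>. It has finitely many values, and its choice is
    measurable because it only compares the distances \<open>norm (f t - d i)\<close>.\<close>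
  define P where "P n t i \<longleftrightarrow> i \<le> n \<and> (\<forall>j\<in>{..n}. norm (f t - d i) \<le> norm (f t - d j))" for n t and i :: nat
  define k where "k n t = (LEAST i. P n t i)" for n t
  have exP: "\<exists>i. P n t i" for n t
  proof -
    obtain i where "i \<in> {..n}" "\<forall>j\<in>{..n}. norm (f t - d i) \<le> norm (f t - d j)"
      using ex_is_arg_min_if_finite[of "{..n}" "\<lambda>i. norm (f t - d i)"]
      by (auto simp: is_arg_min_linorder)
    then show ?thesis by (auto simp: P_def)
  qed
  have kP: "P n t (k n t)" for n t
    unfolding k_def using exP by (rule LeastI_ex)
  have [measurable]: "Measurable.pred lebesgue (\<lambda>t. P n t i)" for n i
    unfolding P_def by measurable
  have km: "k n \<in> lebesgue \<rightarrow>\<^sub>M count_space UNIV" for n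
    unfolding k_def by measurable
  have "simple_function lebesgue (k n)" for n
    unfolding simple_function_def
  proof
    have "k n ` space lebesgue \<subseteq> {..n}" using kP by (auto simp: P_def)
    then show "finite (k n ` space lebesgue)" using finite_subset by blast
    show "\<forall>x\<in>k n ` space lebesgue. k n -` {x} \<inter> space lebesgue \<in> sets lebesgue"
      using measurable_sets[OF km] by simp
  qed
  then have "simple_function lebesgue (\<lambda>t. d (k n t))" for n
    by (rule simple_function_compose1)
  moreover have "AE t in lebesgue. (\<lambda>n. d (k n t)) \<longlonglongrightarrow> f t"
    using D(2)
  proof eventually_elim
    case (elim t)
    show "(\<lambda>n. d (k n t)) \<longlonglongrightarrow> f t"
    proof (rule LIMSEQ_I)
      fix e :: real assume "0 < e"
      with elim obtain y where "y \<in> D" "dist y (f t) < e" by (auto simp: closure_approachable)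
      then obtain j where j: "norm (f t - d j) < e"
        using range_d by (metis dist_commute dist_norm insertI2 rangeE)
      have "norm (d (k n t) - f t) < e" if "n \<ge> j" for n
        using kP[of n t] that j by (force simp: P_def norm_minus_commute)
      then show "\<exists>no. \<forall>n\<ge>no. norm (d (k n t) - f t) < e" by blast
    qed
  qed
  ultimately show "strongly_measurable f"
    unfolding strongly_measurable_def by (intro exI[of _ "\<lambda>n t. d (k n t)"]) auto
qed

lemma strongly_measurable_cong_AE:
  assumes "strongly_measurable f" "AE t in lebesgue. f t = g t"
  shows "strongly_measurable g"
proof -
  obtain s where "\<And>n. simple_function lebesgue (s n)"
    "AE t in lebesgue. (\<lambda>n. s n t) \<longlonglongrightarrow> f t" using assms(1) by (auto simp: strongly_measurable_def)
  moreover from this(2) assms(2) have "AE t in lebesgue. (\<lambda>n. s n t) \<longlonglongrightarrow> g t"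
    by eventually_elim simp
  ultimately show ?thesis by (auto simp: strongly_measurable_def)
qed

lemma strongly_measurable_const: "strongly_measurable (\<lambda>_. h)"
  unfolding strongly_measurable_def by (intro exI[of _ "\<lambda>_ _. h"]) auto

lemma strongly_measurable_add:
  assumes "strongly_measurable f" "strongly_measurable g"
  shows "strongly_measurable (\<lambda>t. f t + g t)"
proof -
  obtain s s' where "\<And>n. simple_function lebesgue (s n)" "AE t in lebesgue. (\<lambda>n. s n t) \<longlonglongrightarrow> f t"
    and "\<And>n. simple_function lebesgue (s' n)" "AE t in lebesgue. (\<lambda>n. s' n t) \<longlonglongrightarrow> g t"
    using assms by (auto simp: strongly_measurable_def)
  moreover from this(2,4) have "AE t in lebesgue. (\<lambda>n. s n t + s' n t) \<longlonglongrightarrow> f t + g t"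
    by eventually_elim (rule tendsto_add)
  ultimately show ?thesis unfolding strongly_measurable_def
    by (intro exI[of _ "\<lambda>n t. s n t + s' n t"]) (auto intro: simple_function_compose2)
qed

lemma strongly_measurable_bounded_linear:
  assumes "strongly_measurable f" "bounded_linear L"
  shows "strongly_measurable (\<lambda>t. L (f t))"
proof -
  obtain s where "\<And>n. simple_function lebesgue (s n)" "AE t in lebesgue. (\<lambda>n. s n t) \<longlonglongrightarrow> f t"
    using assms by (auto simp: strongly_measurable_def)
  moreover from this(2) have "AE t in lebesgue. (\<lambda>n. L (s n t)) \<longlonglongrightarrow> L (f t)"
    by eventually_elim (rule bounded_linear.tendsto[OF assms(2)])
  ultimately show ?thesis unfolding strongly_measurable_def
    by (intro exI[of _ "\<lambda>n t. L (s n t)"]) (auto intro: simple_function_compose1)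
qed

lemma strongly_measurable_scaleR:
  fixes \<phi> :: "real \<Rightarrow> real"
  assumes "\<phi> \<in> borel_measurable lebesgue" "strongly_measurable f"
  shows "strongly_measurable (\<lambda>t. \<phi> t *\<^sub>R f t)"
proof -
  obtain s where "\<And>n. simple_function lebesgue (s n)" "AE t in lebesgue. (\<lambda>n. s n t) \<longlonglongrightarrow> f t"
    using assms by (auto simp: strongly_measurable_def)
  moreover obtain p where "\<And>n. simple_function lebesgue (p n)" "\<And>t. (\<lambda>n. p n t) \<longlonglongrightarrow> \<phi> t"
    using borel_measurable_implies_sequence_metric[OF assms(1), of 0] by auto
  moreover from calculation have "AE t in lebesgue. (\<lambda>n. p n t *\<^sub>R s n t) \<longlonglongrightarrow> \<phi> t *\<^sub>R f t"
    by (elim AE_mp) (auto intro!: AE_I2 tendsto_scaleR)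
  ultimately show ?thesis unfolding strongly_measurable_def
    by (intro exI[of _ "\<lambda>n t. p n t *\<^sub>R s n t"]) (auto intro: simple_function_compose2)
qed

lemma strongly_measurable_shift:
  assumes "strongly_measurable f"
  shows "strongly_measurable (\<lambda>t. f (t + a))"
proof -
  have m: "(\<lambda>x. x + a) \<in> lebesgue \<rightarrow>\<^sub>M lebesgue"
    using lebesgue_affine_measurable[of "\<lambda>_. 1" a] by (simp add: add.commute)
  obtain s where "\<And>n. simple_function lebesgue (s n)" "AE t in lebesgue. (\<lambda>n. s n t) \<longlonglongrightarrow> f t"
    using assms by (auto simp: strongly_measurable_def)
  then show ?thesis unfolding strongly_measurable_def
    using AE_lebesgue_shift[of "\<lambda>t. (\<lambda>n. s n t) \<longlonglongrightarrow> f t" a] simple_function_comp[OF m]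
    by (intro exI[of _ "\<lambda>n t. s n (t + a)"]) auto
qed

text \<open>Working with simple functions would call for a diagonal sequence. Separability of the
  range and measurability of the distances survive the limit directly.\<close>

lemma strongly_measurable_lim:
  assumes "\<And>n. strongly_measurable (f n)" "AE t in lebesgue. (\<lambda>n. f n t) \<longlonglongrightarrow> g t"
  shows "strongly_measurable g"
proof -
  obtain D where D: "\<And>n. countable (D n)" "\<And>n. AE t in lebesgue. f n t \<in> closure (D n)"
    and [measurable]: "\<And>n d. (\<lambda>t. norm (f n t - d)) \<in> borel_measurable lebesgue"
    using assms(1) unfolding strongly_measurable_iff by metis
  have "AE t in lebesgue. \<forall>n. f n t \<in> closure (D n)" using D(2) by (simp add: AE_all_countable)
  with assms(2) have "AE t in lebesgue. g t \<in> closure (\<Union>n. D n)"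
  proof eventually_elim
    case (elim t)
    have "f n t \<in> closure (\<Union>n. D n)" for n
      using elim(2) closure_mono[of "D n" "\<Union>n. D n"] by blast
    then show ?case by (rule closed_sequentially[OF closed_closure _ elim(1)])
  qed
  moreover have "(\<lambda>t. norm (g t - d)) \<in> borel_measurable lebesgue" for d
  proof (rule borel_measurable_AE_lim)
    show "AE t in lebesgue. (\<lambda>n. norm (f n t - d)) \<longlonglongrightarrow> norm (g t - d)"
      using assms(2) by eventually_elim (intro tendsto_intros)
  qed measurable
  ultimately show ?thesis unfolding strongly_measurable_iff using D(1)
    by (intro exI[of _ "\<Union>n. D n"]) auto
qed

lemma borel_measurable_inner_strongly:
  assumes "strongly_measurable f" "strongly_measurable g"
  shows "(\<lambda>t. inner (f t) (g t)) \<in> borel_measurable lebesgue"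
proof -
  obtain s s' where s: "\<And>n. simple_function lebesgue (s n)" "AE t in lebesgue. (\<lambda>n. s n t) \<longlonglongrightarrow> f t"
    and s': "\<And>n. simple_function lebesgue (s' n)" "AE t in lebesgue. (\<lambda>n. s' n t) \<longlonglongrightarrow> g t"
    using assms by (auto simp: strongly_measurable_def)
  show ?thesis
  proof (rule borel_measurable_AE_lim)
    show "(\<lambda>t. inner (s n t) (s' n t)) \<in> borel_measurable lebesgue" for n
      by (intro borel_measurable_simple_function simple_function_compose2[OF s(1) s'(1)])
    show "AE t in lebesgue. (\<lambda>n. inner (s n t) (s' n t)) \<longlonglongrightarrow> inner (f t) (g t)"
      using s(2) s'(2) by eventually_elim (rule tendsto_inner)
  qed
qed

lemma borel_measurable_norm_strongly:
  assumes "strongly_measurable f"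
  shows "(\<lambda>t. norm (f t)) \<in> borel_measurable lebesgue"
  using borel_measurable_inner_strongly[OF assms assms] unfolding norm_eq_sqrt_inner by measurable

section \<open>Inner product and norm of square integrable functions\<close>

definition L2_inner :: "(real \<Rightarrow> 'h::complex_hilbert) \<Rightarrow> (real \<Rightarrow> 'h) \<Rightarrow> real"
  where "L2_inner f g = (LINT t|lebesgue. inner (f t) (g t))"

lemma L2D:
  assumes "f \<in> L2"
  shows "strongly_measurable f" "integrable lebesgue (\<lambda>t. (norm (f t))\<^sup>2)"
  using assms by (auto simp: L2_def)

lemma L2_bound:
  assumes "strongly_measurable f" "integrable lebesgue p"
    and "\<And>t. (norm (f t))\<^sup>2 \<le> p t"
  shows "f \<in> L2"
  unfolding L2_def
proof (intro CollectI conjI assms(1) Bochner_Integration.integrable_bound[OF assms(2)])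
  show "(\<lambda>t. (norm (f t))\<^sup>2) \<in> borel_measurable lebesgue"
    using borel_measurable_norm_strongly[OF assms(1)] by measurable
  show "AE t in lebesgue. norm ((norm (f t))\<^sup>2) \<le> norm (p t)"
    using order_trans[OF assms(3) abs_ge_self] by (auto intro!: AE_I2)
qed

lemma L2_cong_AE:
  assumes "f \<in> L2" "AE t in lebesgue. f t = g t"
  shows "g \<in> L2"
proof -
  have g: "strongly_measurable g" using strongly_measurable_cong_AE[OF L2D(1)] assms by blast
  have "integrable lebesgue (\<lambda>t. (norm (g t))\<^sup>2)"
    using assms(2) borel_measurable_norm_strongly[OF L2D(1)[OF assms(1)]] borel_measurable_norm_strongly[OF g]
    by (intro integrable_cong_AE_imp[OF L2D(2)[OF assms(1)]]) (auto elim!: AE_mp)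
  with g show ?thesis by (simp add: L2_def)
qed

lemma L2_add:
  assumes "f \<in> L2" "g \<in> L2"
  shows "(\<lambda>t. f t + g t) \<in> L2"
  using L2D[OF assms(1)] L2D[OF assms(2)]
  by (intro L2_bound[where p = "\<lambda>t. 2 * (norm (f t))\<^sup>2 + 2 * (norm (g t))\<^sup>2"] strongly_measurable_add)
    (auto intro: norm_add_sq_le)

lemma L2_bounded_linear:
  assumes "f \<in> L2" "bounded_linear L"
  shows "(\<lambda>t. L (f t)) \<in> L2"
proof -
  obtain K where K: "\<And>x. norm (L x) \<le> norm x * K" using assms(2) bounded_linear.bounded by blast
  show ?thesis
  proof (rule L2_bound)
    show "integrable lebesgue (\<lambda>t. K\<^sup>2 * (norm (f t))\<^sup>2)" using L2D[OF assms(1)] by simp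
    show "(norm (L (f t)))\<^sup>2 \<le> K\<^sup>2 * (norm (f t))\<^sup>2" for t
      using power_mono[OF K[of "f t"], of 2] by (simp add: power_mult_distrib mult.commute)
  qed (rule strongly_measurable_bounded_linear[OF L2D(1)[OF assms(1)] assms(2)])
qed

lemma L2_scaleR: "f \<in> L2 \<Longrightarrow> (\<lambda>t. c *\<^sub>R f t) \<in> L2"
  by (rule L2_bounded_linear[OF _ bounded_linear_scaleR_right])

lemma L2_uminus: "f \<in> L2 \<Longrightarrow> (\<lambda>t. - f t) \<in> L2"
  by (rule L2_bounded_linear[OF _ bounded_linear_minus[OF bounded_linear_ident]])

lemma L2_diff: "f \<in> L2 \<Longrightarrow> g \<in> L2 \<Longrightarrow> (\<lambda>t. f t - g t) \<in> L2"
  using L2_add[OF _ L2_uminus] by force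

lemma integrable_shift:
  fixes f :: "real \<Rightarrow> real"
  assumes "integrable lebesgue f"
  shows "integrable lebesgue (\<lambda>t. f (t + a))"
  using has_bochner_integral_lebesgue_real_affine_iff[of 1 f "integral\<^sup>L lebesgue f" a] assms
  by (auto simp: has_bochner_integral_iff add.commute)

lemma integral_shift:
  fixes f :: "real \<Rightarrow> real"
  shows "(LINT t|lebesgue. f (t + a)) = (LINT t|lebesgue. f t)"
  using lebesgue_integral_real_affine[of 1 f a] by (simp add: add.commute)

lemma L2_shift:
  assumes "f \<in> L2"
  shows "(\<lambda>t. f (t + a)) \<in> L2"
  using L2D[OF assms] integrable_shift[of "\<lambda>t. (norm (f t))\<^sup>2"]
  by (simp add: L2_def strongly_measurable_shift)

lemma integrable_L2_inner:
  assumes "f \<in> L2" "g \<in> L2"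
  shows "integrable lebesgue (\<lambda>t. inner (f t) (g t))"
proof (rule Bochner_Integration.integrable_bound)
  show "integrable lebesgue (\<lambda>t. (norm (f t))\<^sup>2 + (norm (g t))\<^sup>2)"
    using L2D(2)[OF assms(1)] L2D(2)[OF assms(2)] by simp
  show "(\<lambda>t. inner (f t) (g t)) \<in> borel_measurable lebesgue"
    using borel_measurable_inner_strongly L2D assms by blast
  have "norm (inner (f t) (g t)) \<le> norm ((norm (f t))\<^sup>2 + (norm (g t))\<^sup>2)" for t
    using Cauchy_Schwarz_ineq2[of "f t" "g t"] sum_squares_bound[of "norm (f t)" "norm (g t)"]
      mult_nonneg_nonneg[OF norm_ge_zero norm_ge_zero, of "f t" "g t"]
    unfolding real_norm_def by linarith
  then show "AE t in lebesgue. norm (inner (f t) (g t)) \<le> norm ((norm (f t))\<^sup>2 + (norm (g t))\<^sup>2)" by simp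
qed

lemma L2_inner_commute: "L2_inner f g = L2_inner g f"
  by (simp add: L2_inner_def inner_commute)

lemma L2_inner_add_left:
  assumes "f \<in> L2" "g \<in> L2" "h \<in> L2"
  shows "L2_inner (\<lambda>t. f t + g t) h = L2_inner f h + L2_inner g h"
  unfolding L2_inner_def inner_add_left
  by (intro Bochner_Integration.integral_add integrable_L2_inner assms)

lemma L2_inner_add_right:
  "f \<in> L2 \<Longrightarrow> g \<in> L2 \<Longrightarrow> h \<in> L2 \<Longrightarrow> L2_inner h (\<lambda>t. f t + g t) = L2_inner h f + L2_inner h g"
  by (simp add: L2_inner_commute[of h] L2_inner_add_left)

lemma L2_inner_diff_left:
  assumes "f \<in> L2" "g \<in> L2" "h \<in> L2"
  shows "L2_inner (\<lambda>t. f t - g t) h = L2_inner f h - L2_inner g h"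
  unfolding L2_inner_def inner_diff_left
  by (intro Bochner_Integration.integral_diff integrable_L2_inner assms)

lemma L2_inner_diff_right:
  "f \<in> L2 \<Longrightarrow> g \<in> L2 \<Longrightarrow> h \<in> L2 \<Longrightarrow> L2_inner h (\<lambda>t. f t - g t) = L2_inner h f - L2_inner h g"
  by (simp add: L2_inner_commute[of h] L2_inner_diff_left)

lemma L2_inner_scaleR_left: "L2_inner (\<lambda>t. c *\<^sub>R f t) g = c * L2_inner f g"
  by (simp add: L2_inner_def)

lemma L2_inner_scaleR_right: "L2_inner f (\<lambda>t. c *\<^sub>R g t) = c * L2_inner f g"
  by (simp add: L2_inner_def)

lemma L2_inner_shift: "L2_inner (\<lambda>t. f (t + a)) (\<lambda>t. g (t + a)) = L2_inner f g"
  unfolding L2_inner_def by (rule integral_shift)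

lemma L2_norm_power2: "(L2_norm f)\<^sup>2 = L2_inner f f"
  by (simp add: L2_norm_def L2_inner_def power2_norm_eq_inner)

lemma L2_norm_power2_integral: "(L2_norm f)\<^sup>2 = (LINT t|lebesgue. (norm (f t))\<^sup>2)"
  by (simp add: L2_norm_power2 L2_inner_def power2_norm_eq_inner)

lemma L2_norm_nonneg: "0 \<le> L2_norm f"
  by (simp add: L2_norm_def)

lemma L2_norm_shift: "L2_norm (\<lambda>t. f (t + a)) = L2_norm f"
  unfolding L2_norm_def by (simp add: integral_shift[of "\<lambda>t. (norm (f t))\<^sup>2"])

lemma L2_norm_minus_commute: "L2_norm (\<lambda>t. f t - g t) = L2_norm (\<lambda>t. g t - f t)"
  by (simp add: L2_norm_def norm_minus_commute)

text \<open>The discriminant inequality, from evaluation at the minimizer s = - b / c. It yields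
  Cauchy-Schwarz for \<open>L2_inner\<close>, a form that is only semidefinite on
  representatives.\<close>

lemma nonneg_quadratic:
  fixes a b c :: real
  assumes q: "\<And>s. 0 \<le> a + 2 * s * b + s\<^sup>2 * c" and "0 \<le> c"
  shows "b\<^sup>2 \<le> a * c"
proof (cases "c = 0")
  case True
  have "b = 0"
  proof (rule ccontr)
    assume "b \<noteq> 0"
    \<comment> \<open>With c = 0 this value of \<open>s\<close> makes the expression - 1.\<close>
    then show False using q[of "- (a + 1) / (2 * b)"] True by (simp add: field_simps)
  qed
  then show ?thesis using True by simp
next
  case False
  have "(- b / c)\<^sup>2 * c = b\<^sup>2 / c" using False by (simp add: power2_eq_square)
  then have "0 \<le> a - b\<^sup>2 / c" using q[of "- b / c"] by (simp add: power2_eq_square)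
  then show ?thesis using False \<open>0 \<le> c\<close> by (simp add: field_simps)
qed

lemma L2_norm_power2_add_scaleR:
  assumes "f \<in> L2" "g \<in> L2"
  shows "(L2_norm (\<lambda>t. f t + s *\<^sub>R g t))\<^sup>2 = (L2_norm f)\<^sup>2 + 2 * s * L2_inner f g + s\<^sup>2 * L2_inner g g"
proof -
  have sg: "(\<lambda>t. s *\<^sub>R g t) \<in> L2" by (intro L2_scaleR assms)
  show ?thesis
    unfolding L2_norm_power2
    by (simp add: L2_inner_add_left L2_inner_add_right assms sg L2_add
        L2_inner_scaleR_left L2_inner_scaleR_right L2_inner_commute[of g f] power2_eq_square algebra_simps)
qed

lemma L2_Cauchy_Schwarz:
  assumes "f \<in> L2" "g \<in> L2"
  shows "\<bar>L2_inner f g\<bar> \<le> L2_norm f * L2_norm g"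
proof -
  have "(L2_inner f g)\<^sup>2 \<le> (L2_norm f)\<^sup>2 * (L2_norm g)\<^sup>2"
    unfolding L2_norm_power2
  proof (rule nonneg_quadratic)
    fix s
    have "0 \<le> (L2_norm (\<lambda>t. f t + s *\<^sub>R g t))\<^sup>2" by simp
    also have "\<dots> = L2_inner f f + 2 * s * L2_inner f g + s\<^sup>2 * L2_inner g g"
      unfolding L2_norm_power2_add_scaleR[OF assms] L2_norm_power2 ..
    finally show "0 \<le> L2_inner f f + 2 * s * L2_inner f g + s\<^sup>2 * L2_inner g g" .
    show "0 \<le> L2_inner g g" using L2_norm_power2[of g] by (metis zero_le_power2)
  qed
  then show ?thesis
    by (simp add: L2_norm_nonneg abs_le_square_iff[symmetric] power_mult_distrib[symmetric] abs_mult)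
qed

lemma L2_norm_triangle:
  assumes "f \<in> L2" "g \<in> L2"
  shows "L2_norm (\<lambda>t. f t + g t) \<le> L2_norm f + L2_norm g"
proof (rule power2_le_imp_le)
  have "(L2_norm (\<lambda>t. f t + g t))\<^sup>2 = (L2_norm f)\<^sup>2 + 2 * L2_inner f g + (L2_norm g)\<^sup>2"
    by (simp add: L2_norm_power2 L2_inner_add_left L2_inner_add_right assms L2_add L2_inner_commute[of g f])
  then show "(L2_norm (\<lambda>t. f t + g t))\<^sup>2 \<le> (L2_norm f + L2_norm g)\<^sup>2"
    using L2_Cauchy_Schwarz[OF assms] by (simp add: power2_sum)
qed (simp add: L2_norm_nonneg)

lemma L2_norm_diff_triangle:
  assumes "f \<in> L2" "g \<in> L2" "h \<in> L2"
  shows "L2_norm (\<lambda>t. f t - h t) \<le> L2_norm (\<lambda>t. f t - g t) + L2_norm (\<lambda>t. g t - h t)"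
  using L2_norm_triangle[OF L2_diff[OF assms(1,2)] L2_diff[OF assms(2,3)]] by simp

lemma L2_norm_eq_0:
  assumes "f \<in> L2" "L2_norm f = 0"
  shows "AE t in lebesgue. f t = 0"
proof -
  have "(LINT t|lebesgue. (norm (f t))\<^sup>2) = 0" using assms(2) by (simp add: L2_norm_def)
  then have "AE t in lebesgue. (norm (f t))\<^sup>2 = 0"
    using integral_nonneg_eq_0_iff_AE[OF L2D(2)[OF assms(1)]] by simp
  then show ?thesis by simp
qed

lemma L2_norm_cong_AE:
  assumes "f \<in> L2" "AE t in lebesgue. f t = g t"
  shows "L2_norm f = L2_norm g"
proof -
  have "AE t in lebesgue. (norm (f t))\<^sup>2 = (norm (g t))\<^sup>2" using assms(2) by eventually_elim simp
  then have "(LINT t|lebesgue. (norm (f t))\<^sup>2) = (LINT t|lebesgue. (norm (g t))\<^sup>2)"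
    using L2D(2)[OF assms(1)] L2D(2)[OF L2_cong_AE[OF assms]] by (intro integral_cong_AE) auto
  then show ?thesis by (simp add: L2_norm_def)
qed


section \<open>Completeness and density\<close>

lemma L2_nn_integral:
  assumes "f \<in> L2"
  shows "(\<integral>\<^sup>+t. ennreal ((norm (f t))\<^sup>2) \<partial>lebesgue) = ennreal ((L2_norm f)\<^sup>2)"
  using nn_integral_eq_integral[OF L2D(2)[OF assms]] by (simp add: L2_norm_def)

lemma L2_of_nn_integral:
  assumes f: "strongly_measurable f" and "0 \<le> e"
    and le: "(\<integral>\<^sup>+t. ennreal ((norm (f t))\<^sup>2) \<partial>lebesgue) \<le> ennreal (e\<^sup>2)"
  shows "f \<in> L2" "L2_norm f \<le> e"
proof -
  have "integrable lebesgue (\<lambda>t. (norm (f t))\<^sup>2)"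
  proof (rule integrableI_bounded)
    show "(\<lambda>t. (norm (f t))\<^sup>2) \<in> borel_measurable lebesgue"
      using borel_measurable_norm_strongly[OF f] by measurable
    show "(\<integral>\<^sup>+t. ennreal (norm ((norm (f t))\<^sup>2)) \<partial>lebesgue) < \<infinity>"
      using le_less_trans[OF le] by simp
  qed
  then show L: "f \<in> L2" using f by (simp add: L2_def)
  have "(L2_norm f)\<^sup>2 \<le> e\<^sup>2" using le by (simp add: L2_nn_integral[OF L] ennreal_le_iff)
  then show "L2_norm f \<le> e" using \<open>0 \<le> e\<close> by (rule power2_le_imp_le)
qed

text \<open>Weights 2^k replace Minkowski's inequality for infinite sums: the integral of the sum of
  2^k |d_k|^2 is at most the sum of 2^-k, so this sum is finite almost everywhere, and |d_k| is
  bounded by 2^k |d_k|^2 + 2^-k.\<close>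

lemma AE_summable_of_summable_L2_norms:
  assumes d: "\<And>k. d k \<in> L2" and le: "\<And>k. L2_norm (d k) \<le> (1/2) ^ k"
  shows "AE t in lebesgue. summable (\<lambda>k. norm (d k t))"
proof -
  let ?w = "\<lambda>k t. 2 ^ k * (norm (d k t))\<^sup>2"
  have [measurable]: "(\<lambda>t. norm (d k t)) \<in> borel_measurable lebesgue" for k
    using borel_measurable_norm_strongly L2D(1) d by blast
  have int: "(\<integral>\<^sup>+t. ennreal (?w k t) \<partial>lebesgue) \<le> ennreal ((1/2) ^ k)" for k
  proof -
    have "(\<integral>\<^sup>+t. ennreal (?w k t) \<partial>lebesgue) = ennreal (2 ^ k) * (\<integral>\<^sup>+t. ennreal ((norm (d k t))\<^sup>2) \<partial>lebesgue)"
      by (simp add: ennreal_mult nn_integral_cmult)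
    also have "\<dots> = ennreal (2 ^ k * (L2_norm (d k))\<^sup>2)"
      by (simp add: L2_nn_integral[OF d] ennreal_mult)
    also have "\<dots> \<le> ennreal (2 ^ k * ((1/2) ^ k)\<^sup>2)"
      using le[of k] by (intro ennreal_leI mult_left_mono power_mono L2_norm_nonneg) auto
    also have "2 ^ k * ((1/2) ^ k)\<^sup>2 = ((1/2) ^ k :: real)"
      by (simp add: power2_eq_square power_one_over)
    finally show ?thesis .
  qed
  have "(\<integral>\<^sup>+t. (\<Sum>k. ennreal (?w k t)) \<partial>lebesgue) = (\<Sum>k. \<integral>\<^sup>+t. ennreal (?w k t) \<partial>lebesgue)"
    by (rule nn_integral_suminf) measurable
  also have "\<dots> \<le> (\<Sum>k. ennreal ((1/2) ^ k))"
    by (intro suminf_le int summableI)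
  also have "\<dots> = ennreal (\<Sum>k. (1/2) ^ k)"
    by (intro suminf_ennreal2) (auto intro: summable_geometric)
  finally have "(\<integral>\<^sup>+t. (\<Sum>k. ennreal (?w k t)) \<partial>lebesgue) \<noteq> \<infinity>"
    by (auto simp: top_unique)
  then have "AE t in lebesgue. (\<Sum>k. ennreal (?w k t)) \<noteq> \<infinity>"
    by (intro nn_integral_PInf_AE) measurable
  then show ?thesis
  proof eventually_elim
    case (elim t)
    then have "summable (\<lambda>k. ?w k t)"
      by (intro summable_suminf_not_top) auto
    then have sum: "summable (\<lambda>k. ?w k t + (1/2) ^ k)"
      by (intro summable_add summable_geometric) auto
    have "norm (norm (d k t)) \<le> ?w k t + (1/2) ^ k" for k
    proof -
      define x n where "x = (2::real) ^ k" and "n = norm (d k t)"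
      have "x > 0" by (simp add: x_def)
      have "0 \<le> (x * n - 1)\<^sup>2 / x" using \<open>x > 0\<close> by simp
      also have "\<dots> = x * n\<^sup>2 + 1 / x - 2 * n"
        using \<open>x > 0\<close> by (simp add: power2_eq_square field_simps)
      also have "\<dots> = ?w k t + (1/2) ^ k - 2 * norm (d k t)"
        by (simp add: x_def n_def power_one_over)
      finally show ?thesis using norm_ge_zero[of "d k t"] unfolding real_norm_def by linarith
    qed
    then show ?case by (intro summable_comparison_test'[OF sum, of 0]) simp
  qed
qed

text \<open>Riesz-Fischer for representatives: a fast subsequence converges almost everywhere, and
  Fatou's lemma carries the Cauchy estimate of the whole sequence over to the limit.\<close>

lemma L2_complete:
  fixes f :: "nat \<Rightarrow> real \<Rightarrow> 'h::complex_hilbert"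
  assumes f: "\<And>n. f n \<in> L2"
    and cauchy: "\<And>e. 0 < e \<Longrightarrow> \<exists>N. \<forall>m\<ge>N. \<forall>n\<ge>N. L2_norm (\<lambda>t. f m t - f n t) < e"
  shows "\<exists>g\<in>L2. (\<lambda>n. L2_norm (\<lambda>t. f n t - g t)) \<longlonglongrightarrow> 0"
proof -
  have "\<exists>N. \<forall>m\<ge>N. \<forall>n\<ge>N. L2_norm (\<lambda>t. f m t - f n t) < (1/2) ^ k" for k
    by (rule cauchy) simp
  then obtain N where N: "\<And>k m n. m \<ge> N k \<Longrightarrow> n \<ge> N k \<Longrightarrow> L2_norm (\<lambda>t. f m t - f n t) < (1/2) ^ k"
    by metis
  \<comment> \<open>Summing all thresholds up to \<open>k\<close> makes \<open>r\<close> monotone as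
    well as at least \<open>N k\<close>; the extra \<open>k\<close> forces it to infinity.\<close>
  define r where "r k = (\<Sum>i\<le>k. N i) + k" for k
  have rN: "N k \<le> r k" "k \<le> r k" "r k \<le> r (Suc k)" for k
    using member_le_sum[of k "{..k}" N] by (auto simp: r_def)
  have "AE t in lebesgue. summable (\<lambda>k. norm (f (r (Suc k)) t - f (r k) t))"
  proof (rule AE_summable_of_summable_L2_norms)
    show "(\<lambda>t. f (r (Suc k)) t - f (r k) t) \<in> L2" for k by (intro L2_diff f)
    show "L2_norm (\<lambda>t. f (r (Suc k)) t - f (r k) t) \<le> (1/2) ^ k" for k
      using N[of k "r (Suc k)" "r k"] rN[of k] by simp
  qed
  then have conv: "AE t in lebesgue. (\<lambda>k. f (r k) t) \<longlonglongrightarrow> lim (\<lambda>k. f (r k) t)"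
  proof eventually_elim
    case (elim t)
    have "(\<lambda>n. \<Sum>k<n. f (r (Suc k)) t - f (r k) t) \<longlonglongrightarrow> (\<Sum>k. f (r (Suc k)) t - f (r k) t)"
      by (rule summable_LIMSEQ[OF summable_norm_cancel[OF elim]])
    then have "(\<lambda>n. (f (r n) t - f (r 0) t) + f (r 0) t) \<longlonglongrightarrow> (\<Sum>k. f (r (Suc k)) t - f (r k) t) + f (r 0) t"
      unfolding sum_lessThan_telescope[of "\<lambda>k. f (r k) t"] by (intro tendsto_add tendsto_const)
    then have "convergent (\<lambda>k. f (r k) t)" by (auto simp: convergent_def)
    then show ?case by (simp add: convergent_LIMSEQ_iff)
  qed
  define g where "g t = lim (\<lambda>k. f (r k) t)" for t
  have gm: "strongly_measurable g"
    unfolding g_def using conv by (rule strongly_measurable_lim[rotated]) (rule L2D(1)[OF f])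
  have est: "(\<lambda>t. f n t - g t) \<in> L2 \<and> L2_norm (\<lambda>t. f n t - g t) \<le> e"
    if "0 < e" and M: "\<And>m n. m \<ge> M \<Longrightarrow> n \<ge> M \<Longrightarrow> L2_norm (\<lambda>t. f m t - f n t) < e" and "n \<ge> M" for e M n
  proof -
    \<comment> \<open>The offset \<open>M\<close> puts every index \<open>r (k + M)\<close> beyond
      \<open>M\<close>, so that the Cauchy bound holds for all \<open>k\<close> and not merely
      eventually.\<close>
    let ?u = "\<lambda>k t. ennreal ((norm (f n t - f (r (k + M)) t))\<^sup>2)"
    have [measurable]: "(\<lambda>t. norm (f n t - f k t)) \<in> borel_measurable lebesgue" for k
      by (intro borel_measurable_norm_strongly L2D(1) L2_diff f)
    have "AE t in lebesgue. ennreal ((norm (f n t - g t))\<^sup>2) = liminf (\<lambda>k. ?u k t)"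
      using conv
    proof eventually_elim
      case (elim t)
      then have "(\<lambda>k. f (r (k + M)) t) \<longlonglongrightarrow> g t"
        unfolding g_def by (rule LIMSEQ_ignore_initial_segment)
      then have "(\<lambda>k. ?u k t) \<longlonglongrightarrow> ennreal ((norm (f n t - g t))\<^sup>2)"
        by (intro tendsto_intros)
      then show ?case using lim_imp_Liminf[OF sequentially_bot] by metis
    qed
    then have "(\<integral>\<^sup>+t. ennreal ((norm (f n t - g t))\<^sup>2) \<partial>lebesgue) = (\<integral>\<^sup>+t. liminf (\<lambda>k. ?u k t) \<partial>lebesgue)"
      by (rule nn_integral_cong_AE)
    also have "\<dots> \<le> liminf (\<lambda>k. \<integral>\<^sup>+t. ?u k t \<partial>lebesgue)"
      by (rule nn_integral_liminf) measurable
    also have "\<dots> \<le> limsup (\<lambda>k. \<integral>\<^sup>+t. ?u k t \<partial>lebesgue)"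
      by (rule Liminf_le_Limsup) simp
    also have "\<dots> \<le> ennreal (e\<^sup>2)"
    proof (intro Limsup_bounded eventuallyI)
      fix k
      have "M \<le> r (k + M)" using rN(2)[of "k + M"] by simp
      then have "L2_norm (\<lambda>t. f n t - f (r (k + M)) t) \<le> e" using M \<open>n \<ge> M\<close> by (simp add: less_imp_le)
      then show "(\<integral>\<^sup>+t. ?u k t \<partial>lebesgue) \<le> ennreal (e\<^sup>2)"
        by (simp add: L2_nn_integral L2_diff f L2_norm_nonneg power_mono ennreal_leI)
    qed
    finally show ?thesis
      using L2_of_nn_integral[of "\<lambda>t. f n t - g t" e] \<open>0 < e\<close>
        strongly_measurable_add[OF L2D(1)[OF f] strongly_measurable_bounded_linear[OF gm bounded_linear_minus[OF bounded_linear_ident]]]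
      by simp
  qed
  \<comment> \<open>One estimate with error 1 places \<open>g\<close> in \<open>L2\<close>, as the
    difference of \<open>f M\<close> and \<open>f M - g\<close>.\<close>
  obtain M where M: "\<forall>m\<ge>M. \<forall>n\<ge>M. L2_norm (\<lambda>t. f m t - f n t) < 1" using cauchy[of 1] by auto
  then have "(\<lambda>t. f M t - g t) \<in> L2" using est[of 1 M M] by simp
  from L2_diff[OF f[of M] this] have "g \<in> L2" by simp
  moreover have "(\<lambda>n. L2_norm (\<lambda>t. f n t - g t)) \<longlonglongrightarrow> 0"
  proof (rule LIMSEQ_I)
    fix e :: real assume "0 < e"
    then obtain M where M: "\<forall>m\<ge>M. \<forall>n\<ge>M. L2_norm (\<lambda>t. f m t - f n t) < e / 2" using cauchy[of "e / 2"] by auto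
    have "norm (L2_norm (\<lambda>t. f n t - g t) - 0) < e" if "n \<ge> M" for n
      using est[of "e / 2" M n] M that \<open>0 < e\<close> by (auto simp: L2_norm_nonneg)
    then show "\<exists>no. \<forall>n\<ge>no. norm (L2_norm (\<lambda>t. f n t - g t) - 0) < e" by blast
  qed
  ultimately show ?thesis by blast
qed

lemma tendsto_L2_norm:
  assumes "\<And>n. f n \<in> L2" "g \<in> L2" "(\<lambda>n. L2_norm (\<lambda>t. f n t - g t)) \<longlonglongrightarrow> 0"
  shows "(\<lambda>n. L2_norm (f n)) \<longlonglongrightarrow> L2_norm g"
proof -
  have "\<bar>L2_norm (f n) - L2_norm g\<bar> \<le> L2_norm (\<lambda>t. f n t - g t)" for n
    using L2_norm_triangle[OF L2_diff[OF assms(1)[of n] assms(2)] assms(2)]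
      L2_norm_triangle[OF L2_diff[OF assms(2) assms(1)[of n]] assms(1)[of n]]
      L2_norm_minus_commute[of g "f n"] by simp
  then have "(\<lambda>n. L2_norm (f n) - L2_norm g) \<longlonglongrightarrow> 0"
    using Lim_null_comparison[OF _ assms(3), of "\<lambda>n. L2_norm (f n) - L2_norm g"] by simp
  then show ?thesis by (simp add: LIM_zero_iff)
qed

lemma tendsto_L2_inner:
  assumes f: "\<And>n. f n \<in> L2" "g \<in> L2" "(\<lambda>n. L2_norm (\<lambda>t. f n t - g t)) \<longlonglongrightarrow> 0" and h: "h \<in> L2"
  shows "(\<lambda>n. L2_inner (f n) h) \<longlonglongrightarrow> L2_inner g h"
proof -
  have "\<bar>L2_inner (f n) h - L2_inner g h\<bar> \<le> L2_norm (\<lambda>t. f n t - g t) * L2_norm h" for n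
    using L2_Cauchy_Schwarz[OF L2_diff[OF f(1,2)] h] by (simp add: L2_inner_diff_left f h)
  moreover have "(\<lambda>n. L2_norm (\<lambda>t. f n t - g t) * L2_norm h) \<longlonglongrightarrow> 0"
    using tendsto_mult_left_zero[OF f(3)] by simp
  ultimately have "(\<lambda>n. L2_inner (f n) h - L2_inner g h) \<longlonglongrightarrow> 0"
    using Lim_null_comparison[where f = "\<lambda>n. L2_inner (f n) h - L2_inner g h"
      and g = "\<lambda>n. L2_norm (\<lambda>t. f n t - g t) * L2_norm h"] by simp
  then show ?thesis by (simp add: LIM_zero_iff)
qed

text \<open>The point of the closure of \<open>S\<close> closest to \<open>f\<close> leaves a
  residual orthogonal to \<open>S\<close>, which vanishes by \<open>perp\<close>. This serves twice:
  for the sums of test functions and for the range of the operator.\<close>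

lemma L2_dense:
  fixes S :: "(real \<Rightarrow> 'h::complex_hilbert) set"
  assumes S: "S \<subseteq> L2" "S \<noteq> {}"
    and add: "\<And>f g. f \<in> S \<Longrightarrow> g \<in> S \<Longrightarrow> (\<lambda>t. f t + g t) \<in> S"
    and scale: "\<And>f c. f \<in> S \<Longrightarrow> (\<lambda>t. c *\<^sub>R f t) \<in> S"
    and perp: "\<And>r. r \<in> L2 \<Longrightarrow> (\<And>s. s \<in> S \<Longrightarrow> L2_inner r s = 0) \<Longrightarrow> AE t in lebesgue. r t = 0"
    and f: "f \<in> L2"
  shows "\<exists>s. (\<forall>n::nat. s n \<in> S) \<and> (\<lambda>n. L2_norm (\<lambda>t. s n t - f t)) \<longlonglongrightarrow> 0"
proof -
  have par: "(L2_norm (\<lambda>t. i t - j t))\<^sup>2 \<le> 2 * (L2_norm (\<lambda>t. i t - f t))\<^sup>2 + 2 * (L2_norm (\<lambda>t. j t - f t))\<^sup>2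
      - 4 * (L2_norm (\<lambda>t. (1/2) *\<^sub>R (i t + j t) - f t))\<^sup>2" if "i \<in> L2" "j \<in> L2" for i j
  proof -
    have "(norm (i t - j t))\<^sup>2 = 2 * (norm (i t - f t))\<^sup>2 + 2 * (norm (j t - f t))\<^sup>2
      - 4 * (norm ((1/2) *\<^sub>R (i t + j t) - f t))\<^sup>2" for t
      by (simp add: power2_norm_eq_inner inner_simps inner_commute algebra_simps)
    moreover have m: "(\<lambda>t. (1/2) *\<^sub>R (i t + j t) - f t) \<in> L2"
      by (intro L2_diff L2_scaleR L2_add that f)
    ultimately show ?thesis
      using L2D(2)[OF L2_diff[OF that]] L2D(2)[OF L2_diff[OF that(1) f]] L2D(2)[OF L2_diff[OF that(2) f]] L2D(2)[OF m]
      unfolding L2_norm_power2_integral by simp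
  qed
  obtain s where s: "\<And>n. s n \<in> S"
      "\<And>n i. i \<in> S \<Longrightarrow> (L2_norm (\<lambda>t. s n t - f t))\<^sup>2 \<le> (L2_norm (\<lambda>t. i t - f t))\<^sup>2 + 1 / Suc n"
      "\<And>m n. (L2_norm (\<lambda>t. s m t - s n t))\<^sup>2 \<le> 2 / Suc m + 2 / Suc n"
  proof (rule minimizing_sequence[of S "\<lambda>i. (L2_norm (\<lambda>t. i t - f t))\<^sup>2" "\<lambda>i j. (L2_norm (\<lambda>t. i t - j t))\<^sup>2"])
    show "\<exists>m\<in>S. (L2_norm (\<lambda>t. i t - j t))\<^sup>2 \<le> 2 * (L2_norm (\<lambda>t. i t - f t))\<^sup>2
        + 2 * (L2_norm (\<lambda>t. j t - f t))\<^sup>2 - 4 * (L2_norm (\<lambda>t. m t - f t))\<^sup>2"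
      if "i \<in> S" "j \<in> S" for i j
      using par[of i j] that S by (intro bexI[of _ "\<lambda>t. (1/2) *\<^sub>R (i t + j t)"] scale add) auto
  qed (use S in auto)
  have sL: "s n \<in> L2" for n using s(1) S by blast
  have "\<exists>g\<in>L2. (\<lambda>n. L2_norm (\<lambda>t. s n t - g t)) \<longlonglongrightarrow> 0"
  proof (rule L2_complete[OF sL])
    fix e :: real assume "0 < e"
    then obtain N where N: "\<forall>m\<ge>N. \<forall>n\<ge>N. (L2_norm (\<lambda>t. s m t - s n t))\<^sup>2 < e\<^sup>2"
      using Cauchy_of_inverse_bound[OF s(3), of "e\<^sup>2"] by auto
    then show "\<exists>N. \<forall>m\<ge>N. \<forall>n\<ge>N. L2_norm (\<lambda>t. s m t - s n t) < e"
      using \<open>0 < e\<close> by (auto intro!: exI[of _ N] intro: power2_less_imp_less)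
  qed
  then obtain g where g: "g \<in> L2" "(\<lambda>n. L2_norm (\<lambda>t. s n t - g t)) \<longlonglongrightarrow> 0" by blast
  have gf: "(\<lambda>t. g t - f t) \<in> L2" by (intro L2_diff g f)
  \<comment> \<open>The limit \<open>g\<close> need not belong to \<open>S\<close>, so the variation
    by \<open>c *\<^sub>R i t\<close> is made on the members \<open>s n\<close> and passed to the
    limit.\<close>
  have min: "(L2_norm (\<lambda>t. g t - f t))\<^sup>2 \<le> (L2_norm (\<lambda>t. g t - f t + c *\<^sub>R i t))\<^sup>2" if i: "i \<in> S" for i c
  proof (rule LIMSEQ_le)
    have ci: "(\<lambda>t. c *\<^sub>R i t) \<in> L2" using i S by (intro L2_scaleR) auto
    show "(\<lambda>n. (L2_norm (\<lambda>t. s n t - f t))\<^sup>2) \<longlonglongrightarrow> (L2_norm (\<lambda>t. g t - f t))\<^sup>2"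
      using g(2) by (intro tendsto_power tendsto_L2_norm gf L2_diff sL f) simp
    have "(\<lambda>n. (L2_norm (\<lambda>t. s n t - f t + c *\<^sub>R i t))\<^sup>2) \<longlonglongrightarrow> (L2_norm (\<lambda>t. g t - f t + c *\<^sub>R i t))\<^sup>2"
      using g(2) by (intro tendsto_power tendsto_L2_norm gf L2_add L2_diff sL f ci) simp
    moreover have "(\<lambda>n. 1 / real (Suc n)) \<longlonglongrightarrow> 0"
      using lim_inverse_n'[THEN LIMSEQ_Suc] .
    ultimately have "(\<lambda>n. (L2_norm (\<lambda>t. s n t - f t + c *\<^sub>R i t))\<^sup>2 + 1 / Suc n) \<longlonglongrightarrow> (L2_norm (\<lambda>t. g t - f t + c *\<^sub>R i t))\<^sup>2 + 0"
      by (rule tendsto_add)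
    then show "(\<lambda>n. (L2_norm (\<lambda>t. s n t - f t + c *\<^sub>R i t))\<^sup>2 + 1 / Suc n) \<longlonglongrightarrow> (L2_norm (\<lambda>t. g t - f t + c *\<^sub>R i t))\<^sup>2"
      by simp
    have "(\<lambda>t. s n t + c *\<^sub>R i t) \<in> S" for n by (intro add scale s i)
    from s(2)[OF this] have "(L2_norm (\<lambda>t. s n t - f t))\<^sup>2 \<le> (L2_norm (\<lambda>t. s n t - f t + c *\<^sub>R i t))\<^sup>2 + 1 / Suc n" for n
      by (simp add: algebra_simps)
    then show "\<exists>N. \<forall>n\<ge>N. (L2_norm (\<lambda>t. s n t - f t))\<^sup>2 \<le> (L2_norm (\<lambda>t. s n t - f t + c *\<^sub>R i t))\<^sup>2 + 1 / Suc n" by blast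
  qed
  have "AE t in lebesgue. g t - f t = 0"
  proof (rule perp[OF gf])
    fix i assume i: "i \<in> S"
    then have iL: "i \<in> L2" using S by blast
    show "L2_inner (\<lambda>t. g t - f t) i = 0"
    proof (rule linear_coeff_eq_zero[where b = "L2_inner i i"])
      fix c
      have "(L2_norm (\<lambda>t. g t - f t + c *\<^sub>R i t))\<^sup>2
          = (L2_norm (\<lambda>t. g t - f t))\<^sup>2 + 2 * c * L2_inner (\<lambda>t. g t - f t) i + c\<^sup>2 * L2_inner i i"
        by (rule L2_norm_power2_add_scaleR[OF gf iL])
      then show "0 \<le> 2 * c * L2_inner (\<lambda>t. g t - f t) i + c\<^sup>2 * L2_inner i i"
        using min[OF i, of c] by simp
    qed
  qed
  then have "AE t in lebesgue. s n t - g t = s n t - f t" for n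
    by eventually_elim simp
  then have "L2_norm (\<lambda>t. s n t - g t) = L2_norm (\<lambda>t. s n t - f t)" for n
    by (rule L2_norm_cong_AE[OF L2_diff[OF sL g(1)]])
  then show ?thesis using g(2) s(1) by (intro exI[of _ s]) simp
qed


section \<open>Test functions\<close>

text \<open>The classical smooth function exp(-1/x) extended by 0. The polynomial factor in 1/x is
  carried along because it makes the family closed under differentiation.\<close>

definition flat :: "real poly \<Rightarrow> real \<Rightarrow> real"
  where "flat p x = (if 0 < x then poly p (1 / x) * exp (- 1 / x) else 0)"

lemma poly_exp_decay: "((\<lambda>y. poly p y * exp (- y)) \<longlongrightarrow> (0::real)) at_top"
proof -
  have "((\<lambda>y. \<Sum>i\<le>degree p. coeff p i * (y ^ i / exp y)) \<longlongrightarrow> (\<Sum>i\<le>degree p. coeff p i * 0)) at_top"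
    by (intro tendsto_intros tendsto_power_div_exp_0)
  then show ?thesis by (simp add: poly_altdef sum_distrib_right exp_minus divide_inverse mult.assoc)
qed

text \<open>For x > 0 the derivative of p(1/x) exp(-1/x) is x^-2 (p - p')(1/x) exp(-1/x), whence the
  factor \<open>[:0, 0, 1:]\<close>. At 0 the right difference quotient belongs to the polynomial X
  p, which the exponential decay beats.\<close>

lemma flat_has_derivative:
  "(flat p has_real_derivative flat ([:0, 0, 1:] * (p - pderiv p)) x) (at x)"
proof -
  consider "x > 0" | "x < 0" | "x = 0" by linarith
  then show ?thesis
  proof cases
    case 1
    have "((\<lambda>x. poly p (1 / x) * exp (- 1 / x)) has_real_derivative
        flat ([:0, 0, 1:] * (p - pderiv p)) x) (at x)"
      using 1 by (auto intro!: derivative_eq_intros DERIV_chain2[OF poly_DERIV]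
        simp: flat_def power2_eq_square field_simps)
    then show ?thesis
      by (rule has_field_derivative_transform_within_open[where S = "{0<..}"]) (use 1 in \<open>auto simp: flat_def\<close>)
  next
    case 2
    have "((\<lambda>x. 0) has_real_derivative flat ([:0, 0, 1:] * (p - pderiv p)) x) (at x)"
      using 2 by (auto simp: flat_def)
    then show ?thesis
      by (rule has_field_derivative_transform_within_open[where S = "{..<0}"]) (use 2 in \<open>auto simp: flat_def\<close>)
  next
    case 3
    have "((\<lambda>h. flat p h / h) \<longlongrightarrow> 0) (at 0)"
    proof (rule filterlim_split_at)
      have "\<forall>\<^sub>F h in at_left 0. flat p h / h = 0"
        unfolding eventually_at_filter by (intro always_eventually) (auto simp: flat_def)
      then show "((\<lambda>h. flat p h / h) \<longlongrightarrow> 0) (at_left 0)" by (rule tendsto_eventually)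
      have "((\<lambda>h. poly ([:0, 1:] * p) (inverse h) * exp (- inverse h)) \<longlongrightarrow> 0) (at_right 0)"
        by (rule filterlim_compose[OF poly_exp_decay filterlim_inverse_at_top_right])
      moreover have "\<forall>\<^sub>F h in at_right 0. poly ([:0, 1:] * p) (inverse h) * exp (- inverse h) = flat p h / h"
        unfolding eventually_at_filter
        by (intro always_eventually) (auto simp: flat_def divide_inverse)
      ultimately show "((\<lambda>h. flat p h / h) \<longlongrightarrow> 0) (at_right 0)" by (rule Lim_transform_eventually)
    qed
    then show ?thesis using 3 by (simp add: has_field_derivative_iff flat_def)
  qed
qed

text \<open>A class stable under differentiation turns the infinitely many conditions of
  \<open>test_function\<close> into one induction. Sums are included because the product rule
  creates them.\<close>

inductive smooth_flat :: "(real \<Rightarrow> real) \<Rightarrow> bool" where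
  flat: "smooth_flat (\<lambda>t. flat p (a + b * t))"
| add: "smooth_flat f \<Longrightarrow> smooth_flat g \<Longrightarrow> smooth_flat (\<lambda>t. f t + g t)"
| mult: "smooth_flat f \<Longrightarrow> smooth_flat g \<Longrightarrow> smooth_flat (\<lambda>t. f t * g t)"

lemma smooth_flat_derivative:
  assumes "smooth_flat f"
  shows "\<exists>f'. smooth_flat f' \<and> (\<forall>t. (f has_real_derivative f' t) (at t))"
  using assms
proof induction
  case (flat p a b)
  let ?q = "[:0, 0, 1:] * (p - pderiv p)"
  have "((\<lambda>t. flat p (a + b * t)) has_real_derivative flat (smult b ?q) (a + b * t)) (at t)" for t
  proof -
    have "((\<lambda>t. flat p (a + b * t)) has_real_derivative flat ?q (a + b * t) * b) (at t)"
      by (rule DERIV_chain2[OF flat_has_derivative]) (auto intro!: derivative_eq_intros)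
    moreover have "flat ?q (a + b * t) * b = flat (smult b ?q) (a + b * t)" by (simp add: flat_def)
    ultimately show ?thesis by (simp only:)
  qed
  then show ?case using smooth_flat.flat by blast
next
  case (add f g)
  then obtain f' g' where "smooth_flat f'" "smooth_flat g'"
    "\<forall>t. (f has_real_derivative f' t) (at t)" "\<forall>t. (g has_real_derivative g' t) (at t)" by blast
  then show ?case
    by (intro exI[of _ "\<lambda>t. f' t + g' t"]) (auto intro: smooth_flat.intros derivative_intros)
next
  case (mult f g)
  then obtain f' g' where d: "smooth_flat f'" "smooth_flat g'"
    "\<forall>t. (f has_real_derivative f' t) (at t)" "\<forall>t. (g has_real_derivative g' t) (at t)" by blast
  have "((\<lambda>t. f t * g t) has_real_derivative f' t * g t + g' t * f t) (at t)" for t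
    using d(3,4) by (intro DERIV_mult) auto
  moreover have "smooth_flat (\<lambda>t. f' t * g t + g' t * f t)"
    using d(1,2) mult.hyps by (intro smooth_flat.intros)
  ultimately show ?case by (intro exI[of _ "\<lambda>t. f' t * g t + g' t * f t"]) simp
qed

lemma smooth_flat_deriv_iter:
  assumes "smooth_flat f"
  shows "smooth_flat ((deriv ^^ k) f)"
proof (induction k)
  case (Suc k)
  then obtain f' where f': "smooth_flat f'" "\<forall>t. ((deriv ^^ k) f has_real_derivative f' t) (at t)"
    using smooth_flat_derivative by blast
  have "deriv ((deriv ^^ k) f) = f'" using f'(2) by (auto intro!: DERIV_imp_deriv)
  then show ?case using f'(1) by simp
qed (simp add: assms)

text \<open>The two factors cut off to the left of \<open>a\<close> and to the right of
  \<open>b\<close>. Dilation by \<open>Suc m\<close> steepens them towards the indicator of the open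
  interval, since exp(-1/y) tends to 1 for large y.\<close>

definition bump :: "real \<Rightarrow> real \<Rightarrow> nat \<Rightarrow> real \<Rightarrow> real"
  where "bump a b m t = flat 1 (real (Suc m) * (t - a)) * flat 1 (real (Suc m) * (b - t))"

lemma bump_bounds: "0 \<le> bump a b m t" "bump a b m t \<le> 1"
proof -
  have "0 \<le> flat 1 x" "flat 1 x \<le> 1" for x by (auto simp: flat_def)
  then show "0 \<le> bump a b m t" "bump a b m t \<le> 1"
    unfolding bump_def by (auto intro: mult_nonneg_nonneg mult_le_one)
qed

lemma bump_outside: "t \<notin> {a<..<b} \<Longrightarrow> bump a b m t = 0"
  by (auto simp: bump_def flat_def zero_less_mult_iff)

lemma test_function_bump: "test_function (bump a b m)"
  unfolding test_function_def
proof
  have "smooth_flat (\<lambda>t. flat 1 (- (real (Suc m) * a) + real (Suc m) * t) * flat 1 (real (Suc m) * b + - real (Suc m) * t))"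
    by (intro smooth_flat.intros)
  moreover have "(\<lambda>t. flat 1 (- (real (Suc m) * a) + real (Suc m) * t) * flat 1 (real (Suc m) * b + - real (Suc m) * t)) = bump a b m"
    by (rule ext) (simp only: bump_def, simp add: algebra_simps)
  ultimately have "smooth_flat (bump a b m)" by simp
  then show "\<forall>k t. (deriv ^^ k) (bump a b m) differentiable (at t)"
    using smooth_flat_derivative[OF smooth_flat_deriv_iter]
    by (metis real_differentiable_def)
  have "{t. bump a b m t \<noteq> 0} \<subseteq> {a..b}"
  proof
    fix t assume "t \<in> {t. bump a b m t \<noteq> 0}"
    then have "t \<in> {a<..<b}" using bump_outside[of t a b m] by blast
    then show "t \<in> {a..b}" by simp
  qed
  then show "compact (closure {t. bump a b m t \<noteq> 0})"
    by (meson bounded_closed_interval bounded_subset compact_closure)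
qed

lemma bump_tendsto: "(\<lambda>m. bump a b m t) \<longlonglongrightarrow> indicator {a<..<b} t"
proof (cases "t \<in> {a<..<b}")
  case True
  have "(\<lambda>m. exp (- (1 / x) * (1 / real (Suc m)))) \<longlonglongrightarrow> exp (- (1 / x) * 0)" for x :: real
    by (intro tendsto_intros lim_inverse_n'[THEN LIMSEQ_Suc])
  from tendsto_mult[OF this[of "t - a"] this[of "b - t"]]
  show ?thesis using True by (simp add: bump_def flat_def zero_less_mult_iff mult.commute)
next
  case False
  then show ?thesis by (simp add: bump_outside)
qed

lemma test_function_has_derivative:
  assumes "test_function \<phi>"
  shows "(\<phi> has_real_derivative deriv \<phi> t) (at t)"
  using assms unfolding test_function_def
  by (metis DERIV_deriv_iff_real_differentiable funpow_0)

lemma test_function_deriv: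
  assumes "test_function \<phi>"
  shows "test_function (deriv \<phi>)"
  unfolding test_function_def
proof
  show "\<forall>k t. (deriv ^^ k) (deriv \<phi>) differentiable at t"
    using assms unfolding test_function_def by (metis comp_apply funpow_Suc_right)
  have "deriv \<phi> t = 0" if t: "t \<notin> closure {t. \<phi> t \<noteq> 0}" for t
  proof -
    have "((\<lambda>_. 0) has_real_derivative 0) (at t)" by simp
    then have "(\<phi> has_real_derivative 0) (at t)"
      by (rule has_field_derivative_transform_within_open[where S = "- closure {t. \<phi> t \<noteq> 0}"])
        (use t closure_subset[of "{t. \<phi> t \<noteq> 0}"] in auto)
    then show ?thesis by (rule DERIV_imp_deriv)
  qed
  then have "{t. deriv \<phi> t \<noteq> 0} \<subseteq> closure {t. \<phi> t \<noteq> 0}" by blast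
  then show "compact (closure {t. deriv \<phi> t \<noteq> 0})"
    using assms compact_imp_bounded bounded_subset unfolding test_function_def compact_closure by blast
qed

lemma test_function_bounded:
  assumes "test_function \<phi>"
  obtains R M where "0 < R" "0 < M" "\<And>t. \<bar>t\<bar> > R \<Longrightarrow> \<phi> t = 0" "\<And>t. \<bar>\<phi> t\<bar> \<le> M"
proof -
  have K: "compact (closure {t. \<phi> t \<noteq> 0})" using assms by (simp add: test_function_def)
  obtain R where R: "0 < R" "\<And>t. t \<in> closure {t. \<phi> t \<noteq> 0} \<Longrightarrow> norm t \<le> R"
    using compact_imp_bounded[OF K] by (auto simp: bounded_pos)
  have R': "\<phi> t = 0" if "\<bar>t\<bar> > R" for t
    using R(2)[of t] that closure_subset[of "{t. \<phi> t \<noteq> 0}"] by force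
  have "continuous_on {-R..R} \<phi>"
    using test_function_has_derivative[OF assms] by (meson DERIV_isCont continuous_at_imp_continuous_on)
  then have "compact (\<phi> ` {-R..R})"
    by (intro compact_continuous_image compact_Icc)
  then have "bounded (\<phi> ` {-R..R})" by (rule compact_imp_bounded)
  then obtain M where M: "0 < M" "\<And>t. t \<in> {-R..R} \<Longrightarrow> norm (\<phi> t) \<le> M"
    unfolding bounded_pos by blast
  have "\<bar>\<phi> t\<bar> \<le> M" for t
    using M(1) M(2)[of t] R'[of t] by (cases "\<bar>t\<bar> > R") (auto simp: abs_le_iff not_less)
  then show thesis using that R(1) M(1) R' by blast
qed

lemma test_function_measurable:
  assumes "test_function \<phi>"
  shows "\<phi> \<in> borel_measurable borel" "\<phi> \<in> borel_measurable lebesgue"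
proof -
  have "continuous_on UNIV \<phi>"
    using test_function_has_derivative[OF assms] by (meson DERIV_isCont continuous_at_imp_continuous_on)
  then show "\<phi> \<in> borel_measurable borel" by (rule borel_measurable_continuous_onI)
  then show "\<phi> \<in> borel_measurable lebesgue" by (simp add: measurable_completion)
qed

lemma test_function_shift:
  assumes "test_function \<phi>"
  shows "test_function (\<lambda>t. \<phi> (t + a))"
  unfolding test_function_def
proof
  have D: "(deriv ^^ k) \<phi> differentiable (at t)" for k t
    using assms by (auto simp: test_function_def)
  have eq: "(deriv ^^ k) (\<lambda>t. \<phi> (t + a)) = (\<lambda>t. (deriv ^^ k) \<phi> (t + a))" for k
  proof (induction k)
    case (Suc k)
    have "((\<lambda>t. (deriv ^^ k) \<phi> (t + a)) has_real_derivative deriv ((deriv ^^ k) \<phi>) (t + a)) (at t)" for t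
      using D[of k "t + a"] by (simp only: DERIV_shift[symmetric] DERIV_deriv_iff_real_differentiable)
    then show ?case by (auto simp: Suc intro!: DERIV_imp_deriv)
  qed simp
  have "((\<lambda>t. (deriv ^^ k) \<phi> (t + a)) has_real_derivative deriv ((deriv ^^ k) \<phi>) (t + a)) (at t)" for k t
      using D[of k "t + a"] by (simp only: DERIV_shift[symmetric] DERIV_deriv_iff_real_differentiable)
  then show "\<forall>k t. (deriv ^^ k) (\<lambda>t. \<phi> (t + a)) differentiable (at t)"
    unfolding eq using real_differentiable_def by blast
  obtain R where R: "\<And>t. \<bar>t\<bar> > R \<Longrightarrow> \<phi> t = 0" using test_function_bounded[OF assms] by metis
  have "{t. \<phi> (t + a) \<noteq> 0} \<subseteq> {- R - a..R - a}" using R by (force simp: abs_le_iff)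
  then show "compact (closure {t. \<phi> (t + a) \<noteq> 0})"
    by (meson bounded_closed_interval bounded_subset compact_closure)
qed

lemma test_function_deriv_shift:
  assumes "test_function \<phi>"
  shows "deriv (\<lambda>t. \<phi> (t + a)) t = deriv \<phi> (t + a)"
  using test_function_has_derivative[OF assms, of "t + a"]
  by (intro DERIV_imp_deriv) (simp add: DERIV_shift)

lemma L2_test_function:
  assumes "test_function \<phi>"
  shows "(\<lambda>t. \<phi> t *\<^sub>R h) \<in> L2"
proof -
  obtain R M where RM: "0 < R" "0 < M" "\<And>t. \<bar>t\<bar> > R \<Longrightarrow> \<phi> t = 0" "\<And>t. \<bar>\<phi> t\<bar> \<le> M"
    using test_function_bounded[OF assms] by metis
  show ?thesis
  proof (rule L2_bound)
    show "strongly_measurable (\<lambda>t. \<phi> t *\<^sub>R h)"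
      by (intro strongly_measurable_scaleR test_function_measurable assms strongly_measurable_const)
    show "integrable lebesgue (\<lambda>t. M\<^sup>2 * (norm h)\<^sup>2 * indicator {-R..R} t :: real)"
      using RM(1) by (intro integrable_mult_right integrable_real_indicator) (auto simp: emeasure_lborel_Icc_eq)
    show "(norm (\<phi> t *\<^sub>R h))\<^sup>2 \<le> M\<^sup>2 * (norm h)\<^sup>2 * indicator {-R..R} t" for t
      using RM(3)[of t] power_mono[OF RM(4)[of t], of 2]
      by (cases "\<bar>t\<bar> > R") (auto simp: power_mult_distrib mult_right_mono indicator_def abs_le_iff)
  qed
qed

lemma test_function_by_parts:
  assumes "test_function \<phi>" "test_function \<psi>"
  shows "(LINT t|lebesgue. deriv \<psi> t * \<phi> t) = - (LINT t|lebesgue. \<psi> t * deriv \<phi> t)"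
proof -
  have int: "integrable lebesgue (\<lambda>t. f t * g t)" if tf: "test_function f" and tg: "test_function g" for f g
  proof -
    obtain R M where f: "0 < R" "0 < M" "\<And>t. \<bar>t\<bar> > R \<Longrightarrow> f t = 0" "\<And>t. \<bar>f t\<bar> \<le> M"
      using test_function_bounded[OF tf] by metis
    obtain R' M' where g: "0 < R'" "0 < M'" "\<And>t. \<bar>t\<bar> > R' \<Longrightarrow> g t = 0" "\<And>t. \<bar>g t\<bar> \<le> M'"
      using test_function_bounded[OF tg] by metis
    have [measurable]: "f \<in> borel_measurable lebesgue" "g \<in> borel_measurable lebesgue"
      using test_function_measurable tf tg by auto
    show ?thesis
    proof (rule Bochner_Integration.integrable_bound)
      show "integrable lebesgue (\<lambda>t. (M * M') * indicator {-R..R} t :: real)"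
        using f(1) by (intro integrable_mult_right integrable_real_indicator) (auto simp: emeasure_lborel_Icc_eq)
      show "AE t in lebesgue. norm (f t * g t) \<le> norm (M * M' * indicator {-R..R} t)"
      proof (intro AE_I2)
        fix t show "norm (f t * g t) \<le> norm (M * M' * indicator {-R..R} t)"
          using f(3)[of t] mult_mono[OF f(4)[of t] g(4)[of t]] f(2) g(2)
          by (cases "\<bar>t\<bar> > R") (auto simp: abs_mult indicator_def abs_le_iff)
      qed
    qed measurable
  qed
  obtain R where R: "0 < R" "\<And>t. \<bar>t\<bar> > R \<Longrightarrow> \<phi> t = 0" using test_function_bounded[OF assms(1)] by metis
  have R': "deriv \<phi> t = 0" if "\<bar>t\<bar> > R" for t
  proof -
    have "((\<lambda>_. 0) has_real_derivative 0) (at t)" by simp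
    then have "(\<phi> has_real_derivative 0) (at t)"
    proof (rule has_field_derivative_transform_within_open[where S = "{t. R < \<bar>t\<bar>}"])
      show "open {t. R < \<bar>t\<bar>}" by (intro open_Collect_less continuous_intros)
    qed (use that R in auto)
    then show ?thesis by (rule DERIV_imp_deriv)
  qed
  let ?g = "\<lambda>t. deriv \<psi> t * \<phi> t + \<psi> t * deriv \<phi> t"
  note tests = assms assms[THEN test_function_deriv]
  have [measurable]: "?g \<in> borel_measurable borel"
    using tests[THEN test_function_measurable(1)] by measurable
  have "(LINT t|lebesgue. ?g t) = (LINT t|lborel. ?g t)"
    by (intro integral_completion) simp
  \<comment> \<open>The function \<open>\<phi>\<close> is known to vanish only strictly beyond
    \<open>R\<close>, so the interval extends to \<open>R + 1\<close>, where the boundary terms are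
    0.\<close>
  also have "\<dots> = (LINT t|lborel. ?g t * indicator {-(R+1)..R+1} t)"
  proof (rule Bochner_Integration.integral_cong)
    fix t show "?g t = ?g t * indicator {-(R+1)..R+1} t"
      using R(2)[of t] R'[of t] by (cases "\<bar>t\<bar> > R") (auto simp: indicator_def abs_le_iff)
  qed simp
  also have "\<dots> = \<psi> (R+1) * \<phi> (R+1) - \<psi> (-(R+1)) * \<phi> (-(R+1))"
  proof (rule integral_FTC_Icc_real)
    show "((\<lambda>t. \<psi> t * \<phi> t) has_real_derivative ?g t) (at t)" for t
      using tests[THEN test_function_has_derivative] by (auto intro!: derivative_eq_intros)
    show "isCont ?g t" for t
      using tests[THEN test_function_has_derivative, THEN DERIV_isCont] by (intro continuous_intros) auto
  qed (use R(1) in auto)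
  also have "\<dots> = 0" using R by simp
  finally show ?thesis
    using int tests by simp
qed


section \<open>The fundamental lemma of the calculus of variations\<close>

lemma integral_interval_zero:
  fixes y :: "real \<Rightarrow> real"
  assumes loc: "\<And>a b. integrable lebesgue (\<lambda>t. indicator {a<..<b} t * y t)"
    and test: "\<And>\<phi>. test_function \<phi> \<Longrightarrow> (LINT t|lebesgue. \<phi> t * y t) = 0"
    and [measurable]: "y \<in> borel_measurable lebesgue"
  shows "(LINT t|lebesgue. indicator {a<..<b} t * y t) = 0"
proof -
  have [measurable]: "bump a b m \<in> borel_measurable lebesgue" for m
    by (rule test_function_measurable[OF test_function_bump])
  have "(\<lambda>m. LINT t|lebesgue. bump a b m t * y t) \<longlonglongrightarrow> (LINT t|lebesgue. indicator {a<..<b} t * y t)"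
  proof (rule integral_dominated_convergence)
    show "integrable lebesgue (\<lambda>t. \<bar>indicator {a<..<b} t * y t\<bar>)"
      using loc by (rule integrable_abs)
    show "(\<lambda>t. indicator {a<..<b} t * y t) \<in> borel_measurable lebesgue"
      using borel_measurable_integrable[OF loc] .
    show "AE t in lebesgue. (\<lambda>m. bump a b m t * y t) \<longlonglongrightarrow> indicator {a<..<b} t * y t"
      by (intro AE_I2 tendsto_mult_right bump_tendsto)
    show "AE t in lebesgue. norm (bump a b m t * y t) \<le> \<bar>indicator {a<..<b} t * y t\<bar>" for m
    proof (intro AE_I2)
      fix t show "norm (bump a b m t * y t) \<le> \<bar>indicator {a<..<b} t * y t\<bar>"
        using bump_outside[of t a b m] mult_right_mono[OF bump_bounds(2)[of a b m t] abs_ge_zero[of "y t"]] bump_bounds(1)[of a b m t]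
        by (cases "t \<in> {a<..<b}") (simp_all add: abs_mult)
    qed
  qed measurable
  then show ?thesis by (simp add: test test_function_bump LIMSEQ_const_iff)
qed

text \<open>Open intervals form an intersection-stable generator of the Borel sets, and the sets
  over which \<open>Y\<close> integrates to 0 form a Dynkin system; \<open>tot\<close> takes care of
  complements.\<close>

lemma AE_zero_of_intervals:
  fixes Y :: "real \<Rightarrow> real"
  assumes Y: "integrable lebesgue Y"
    and int: "\<And>a b. (LINT t|lebesgue. indicator {a<..<b} t * Y t) = 0" and tot: "(LINT t|lebesgue. Y t) = 0"
  shows "AE t in lebesgue. Y t = 0"
proof -
  have iA: "integrable lebesgue (\<lambda>t. indicator A t * Y t)" if "A \<in> sets lebesgue" for A
    using integrable_mult_indicator[OF that Y] by simp
  have sets_borel_Ioo: "sets borel = sigma_sets UNIV (range (\<lambda>(a, b). {a<..<b :: real}))"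
    by (simp add: borel_eq_box box_real)
  have borel: "(LINT t|lebesgue. indicator A t * Y t) = 0" if A: "A \<in> sets borel" for A
  proof -
    have sig: "A \<in> sigma_sets UNIV (range (\<lambda>(a, b). {a<..<b :: real}))"
      using A by (simp add: sets_borel_Ioo)
    have int_stable: "Int_stable (range (\<lambda>(a, b). {a<..<b :: real}))"
    proof -
      have "{a<..<b} \<inter> {c<..<d} = (\<lambda>(a, b). {a<..<b}) (max a c, min b d)" for a b c d :: real
        by auto
      then have "{a<..<b} \<inter> {c<..<d} \<in> range (\<lambda>(a, b). {a<..<b :: real})" for a b c d :: real
        by (simp only: rangeI)
      then show ?thesis by (intro Int_stableI) (auto split: prod.splits)
    qed
    have "range (\<lambda>(a, b). {a<..<b :: real}) \<subseteq> Pow UNIV" by simp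
    from int_stable this sig show ?thesis
    proof (induction rule: sigma_sets_induct_disjoint)
      case (basic A)
      then show ?case using int by auto
    next
      case empty
      then show ?case by simp
    next
      case (compl A)
      then have "A \<in> sets lebesgue" by (simp add: sets_borel_Ioo[symmetric] sets_completionI_sets)
      then have "(LINT t|lebesgue. Y t - indicator A t * Y t) = 0"
        using compl tot Y iA by simp
      moreover have "Y t - indicator A t * Y t = indicator (UNIV - A) t * Y t" for t
        by (simp add: indicator_def)
      ultimately show ?case by simp
    next
      case (union A)
      then have A: "A i \<in> sets lebesgue" for i
        by (auto simp: sets_borel_Ioo[symmetric] intro!: sets_completionI_sets)
      have "(LINT t:(\<Union>i. A i)|lebesgue. Y t) = (\<Sum>i. (LINT t:(A i)|lebesgue. Y t))"
      proof (rule lebesgue_integral_countable_add)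
        show "\<And>i j. i \<noteq> j \<Longrightarrow> A i \<inter> A j = {}" using union(1) by (auto simp: disjoint_family_on_def)
        show "set_integrable lebesgue (\<Union>i. A i) Y"
          unfolding set_integrable_def by (intro integrable_mult_indicator sets.countable_UN Y) (use A in auto)
      qed (rule A)
      then show ?case using union(3) by (simp add: set_lebesgue_integral_def)
    qed
  qed
  show ?thesis
  proof (rule density_unique_real[OF Y])
    fix A assume A: "A \<in> sets (lebesgue :: real measure)"
    \<comment> \<open>A Lebesgue set differs from its Borel main part by a null set, so the Borel
      sets decide.\<close>
    have "AE t in lborel. t \<in> main_part lborel A \<longleftrightarrow> t \<in> A" by (rule AE_in_main_part[OF A])
    then have "AE t in lebesgue. t \<in> main_part lborel A \<longleftrightarrow> t \<in> A" by (rule AE_completion)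
    then have "AE t in lebesgue. indicator A t * Y t = indicator (main_part lborel A) t * Y t"
      by eventually_elim (simp add: indicator_def)
    moreover have B: "main_part lborel A \<in> sets borel" using main_part_sets[OF A] by simp
    ultimately have "(LINT t|lebesgue. indicator A t * Y t) = (LINT t|lebesgue. indicator (main_part lborel A) t * Y t)"
      using iA[OF A] iA[of "main_part lborel A"] by (intro integral_cong_AE) (auto intro: sets_completionI_sets)
    then show "(LINT t:A|lebesgue. Y t) = (LINT t:A|lebesgue. 0)"
      using borel[OF B] by (simp add: set_lebesgue_integral_def)
  qed simp
qed

text \<open>Restriction to (-n, n) makes \<open>y\<close> integrable on the whole line, and
  intersections of intervals are intervals, so \<open>AE_zero_of_intervals\<close> applies to each
  restriction.\<close>

lemma AE_zero_of_test_functions: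
  fixes y :: "real \<Rightarrow> real"
  assumes loc: "\<And>a b. integrable lebesgue (\<lambda>t. indicator {a<..<b} t * y t)"
    and test: "\<And>\<phi>. test_function \<phi> \<Longrightarrow> (LINT t|lebesgue. \<phi> t * y t) = 0"
    and y: "y \<in> borel_measurable lebesgue"
  shows "AE t in lebesgue. y t = 0"
proof -
  have "AE t in lebesgue. indicator {- real n<..<real n} t * y t = 0" for n
  proof (rule AE_zero_of_intervals[OF loc])
    have "{a<..<b} \<inter> {- real n<..<real n} = {max a (- real n)<..<min b (real n)}" for a b by auto
    then show "(LINT t|lebesgue. indicator {a<..<b} t * (indicator {- real n<..<real n} t * y t)) = 0" for a b
      using integral_interval_zero[OF loc test y, of "max a (- real n)" "min b (real n)"]
      by (simp add: mult.assoc[symmetric] indicator_inter_arith[symmetric])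
  qed (rule integral_interval_zero[OF loc test y])
  then have "AE t in lebesgue. \<forall>n. indicator {- real n<..<real n} t * y t = 0"
    unfolding AE_all_countable by blast
  then show ?thesis
  proof eventually_elim
    case (elim t)
    obtain n :: nat where "\<bar>t\<bar> < real n" using reals_Archimedean2 by blast
    then show ?case using elim[rule_format, of n] by (auto simp: indicator_def split: if_splits)
  qed
qed

text \<open>The exceptional null set of <r, h> = 0 depends on \<open>h\<close>, and a union over all
  \<open>h\<close> need not be null. Strong measurability resolves this: almost all values of
  \<open>r\<close> lie in the closure of a countable \<open>D\<close>, so the \<open>h\<close> in
  \<open>D\<close> suffice, and \<open>r t\<close> is orthogonal to itself.\<close>

lemma L2_zero_of_test_functions:
  assumes r: "r \<in> L2" and perp: "\<And>\<phi> h. test_function \<phi> \<Longrightarrow> L2_inner r (\<lambda>t. \<phi> t *\<^sub>R h) = 0"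
  shows "AE t in lebesgue. r t = 0"
proof -
  have zero: "AE t in lebesgue. inner (r t) h = 0" for h
  proof (rule AE_zero_of_test_functions)
    show "(LINT t|lebesgue. \<phi> t * inner (r t) h) = 0" if "test_function \<phi>" for \<phi>
      using perp[OF that] by (simp add: L2_inner_def)
    show m: "(\<lambda>t. inner (r t) h) \<in> borel_measurable lebesgue"
      by (intro borel_measurable_inner_strongly L2D(1)[OF r] strongly_measurable_const)
    fix a b :: real
    have "(\<lambda>t. indicator {a<..<b} t *\<^sub>R h) \<in> L2"
    proof (rule L2_bound)
      show "strongly_measurable (\<lambda>t. indicator {a<..<b} t *\<^sub>R h)"
        by (intro strongly_measurable_scaleR strongly_measurable_const borel_measurable_indicator) auto
      show "integrable lebesgue (\<lambda>t. (norm h)\<^sup>2 * indicator {a<..<b} t :: real)"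
        by (cases "a \<le> b") (auto intro!: integrable_mult_right integrable_real_indicator)
    qed (auto simp: indicator_def)
    from integrable_L2_inner[OF r this] show "integrable lebesgue (\<lambda>t. indicator {a<..<b} t * inner (r t) h)"
      by simp
  qed
  obtain D where D: "countable D" "AE t in lebesgue. r t \<in> closure D"
    using L2D(1)[OF r] by (auto simp: strongly_measurable_iff)
  have "AE t in lebesgue. \<forall>d\<in>D. inner (r t) d = 0"
    using zero D(1) by (simp add: AE_ball_countable)
  with D(2) show ?thesis
  proof eventually_elim
    case (elim t)
    have "closed {x. inner (r t) x = 0}" by (intro closed_Collect_eq continuous_intros)
    then have "closure D \<subseteq> {x. inner (r t) x = 0}" using elim(2) by (intro closure_minimal) auto
    then show ?case using elim(1) by auto
  qed
qed

text \<open>The algebraic tensor product of the test functions with the Hilbert space. Scalars are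
  absorbed into \<open>h\<close>, so closure under sums already gives a subspace.\<close>

inductive_set test_sums :: "(real \<Rightarrow> 'h::complex_hilbert) set" where
  test: "test_function \<phi> \<Longrightarrow> (\<lambda>t. \<phi> t *\<^sub>R h) \<in> test_sums"
| add: "f \<in> test_sums \<Longrightarrow> g \<in> test_sums \<Longrightarrow> (\<lambda>t. f t + g t) \<in> test_sums"

lemma test_sums_L2: "f \<in> test_sums \<Longrightarrow> f \<in> L2"
  by (induction rule: test_sums.induct) (auto intro: L2_test_function L2_add)

lemma test_sums_scaleR: "f \<in> test_sums \<Longrightarrow> (\<lambda>t. c *\<^sub>R f t) \<in> test_sums"
proof (induction rule: test_sums.induct)
  case (test \<phi> h)
  then show ?case using test_sums.test[of \<phi> "c *\<^sub>R h"] by (simp add: mult.commute)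
next
  case (add f g)
  then show ?case using test_sums.add by (simp add: scaleR_add_right)
qed

lemma test_sums_dense:
  assumes "f \<in> L2"
  shows "\<exists>s. (\<forall>n::nat. s n \<in> test_sums) \<and> (\<lambda>n. L2_norm (\<lambda>t. s n t - f t)) \<longlonglongrightarrow> 0"
proof (rule L2_dense[OF _ _ _ _ _ assms])
  show "test_sums \<noteq> ({} :: (real \<Rightarrow> 'a) set)" using test_sums.test[OF test_function_bump] by blast
  show "AE t in lebesgue. r t = 0" if "r \<in> L2" "\<And>s. s \<in> test_sums \<Longrightarrow> L2_inner r s = 0" for r :: "real \<Rightarrow> 'a"
    using that(1) by (rule L2_zero_of_test_functions) (intro that(2) test_sums.test)
qed (auto intro: test_sums_L2 test_sums.add test_sums_scaleR)


section \<open>The energy identity\<close>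

text \<open>The real part of the identity in \<open>has_distr_deriv\<close>. No information is lost,
  because \<open>h\<close> ranges over a complex space and \<open>scaleC \<i> h\<close> supplies the
  imaginary part.\<close>

definition weak_deriv :: "(real \<Rightarrow> 'h::complex_hilbert) \<Rightarrow> (real \<Rightarrow> 'h) \<Rightarrow> bool"
  where "weak_deriv g w \<longleftrightarrow> (\<forall>\<phi> h. test_function \<phi> \<longrightarrow>
    L2_inner g (\<lambda>t. deriv \<phi> t *\<^sub>R h) = - L2_inner w (\<lambda>t. \<phi> t *\<^sub>R h))"

text \<open>Antilinearity in the second argument gives <x, i y> = - i <x, y>, whose real part is the
  imaginary part of <x, y>.\<close>

lemma cinner_eq_Complex: "cinner x y = Complex (inner x y) (inner x (scaleC \<i> y))"
proof -
  have "cinner x (scaleC \<i> y) = - \<i> * cinner x y"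
    using cinner_commute[of x "scaleC \<i> y"] cinner_commute[of x y] by (simp add: cinner_scaleC_left)
  then show ?thesis by (simp add: inner_eq_Re_cinner complex_eq_iff)
qed

lemma integral_cinner_test:
  assumes "g \<in> L2" "test_function \<phi>"
  shows "(LINT t|lebesgue. complex_of_real (\<phi> t) * cinner (g t) h) =
    Complex (L2_inner g (\<lambda>t. \<phi> t *\<^sub>R h)) (L2_inner g (\<lambda>t. \<phi> t *\<^sub>R scaleC \<i> h))"
proof -
  have int: "integrable lebesgue (\<lambda>t. inner (g t) (\<phi> t *\<^sub>R k))" for k
    by (intro integrable_L2_inner L2_test_function assms)
  have "complex_of_real (\<phi> t) * cinner (g t) h = complex_of_real (inner (g t) (\<phi> t *\<^sub>R h))
      + \<i> * complex_of_real (inner (g t) (\<phi> t *\<^sub>R scaleC \<i> h))" for t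
    by (simp add: cinner_eq_Complex complex_eq_iff)
  then have "(LINT t|lebesgue. complex_of_real (\<phi> t) * cinner (g t) h) =
      (LINT t|lebesgue. complex_of_real (inner (g t) (\<phi> t *\<^sub>R h)))
      + (LINT t|lebesgue. \<i> * complex_of_real (inner (g t) (\<phi> t *\<^sub>R scaleC \<i> h)))"
    using int by (simp only:) (intro Bochner_Integration.integral_add integrable_mult_right integrable_of_real)
  also have "\<dots> = complex_of_real (L2_inner g (\<lambda>t. \<phi> t *\<^sub>R h))
      + \<i> * complex_of_real (L2_inner g (\<lambda>t. \<phi> t *\<^sub>R scaleC \<i> h))"
    unfolding L2_inner_def integral_mult_right_zero integral_complex_of_real ..
  finally show ?thesis by (simp add: complex_eq_iff)
qed

lemma has_distr_deriv_iff_weak_deriv: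
  assumes "g \<in> L2" "w \<in> L2"
  shows "has_distr_deriv g w \<longleftrightarrow> weak_deriv g w"
  unfolding has_distr_deriv_def weak_deriv_def
  by (auto simp: integral_cinner_test assms test_function_deriv complex_eq_iff)

lemma weak_derivD:
  "weak_deriv g w \<Longrightarrow> test_function \<phi> \<Longrightarrow>
    L2_inner g (\<lambda>t. deriv \<phi> t *\<^sub>R h) = - L2_inner w (\<lambda>t. \<phi> t *\<^sub>R h)"
  by (simp add: weak_deriv_def)

section \<open>Translations of weakly differentiable functions\<close>

lemma weak_deriv_shift:
  assumes "weak_deriv g w"
  shows "weak_deriv (\<lambda>t. g (t + a)) (\<lambda>t. w (t + a))"
  unfolding weak_deriv_def
proof (intro allI impI)
  fix \<phi> h assume \<phi>: "test_function \<phi>"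
  have "L2_inner (\<lambda>t. g (t + a)) (\<lambda>t. deriv \<phi> t *\<^sub>R h) = L2_inner g (\<lambda>t. deriv (\<lambda>t. \<phi> (t + - a)) t *\<^sub>R h)"
    using L2_inner_shift[of g a "\<lambda>t. deriv \<phi> (t - a) *\<^sub>R h"] test_function_deriv_shift[OF \<phi>, of "- a"] by simp
  also have "\<dots> = - L2_inner w (\<lambda>t. \<phi> (t + - a) *\<^sub>R h)"
    by (rule weak_derivD[OF assms test_function_shift[OF \<phi>]])
  also have "\<dots> = - L2_inner (\<lambda>t. w (t + a)) (\<lambda>t. \<phi> t *\<^sub>R h)"
    using L2_inner_shift[of w a "\<lambda>t. \<phi> (t - a) *\<^sub>R h"] by simp
  finally show "L2_inner (\<lambda>t. g (t + a)) (\<lambda>t. deriv \<phi> t *\<^sub>R h) = - L2_inner (\<lambda>t. w (t + a)) (\<lambda>t. \<phi> t *\<^sub>R h)" .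
qed

text \<open>The mean value inequality for x -> \<phi>(x) - \<phi>'(t) x on the ball of radius |k|
  about t. The constant is uniform in t because the second derivative is bounded.\<close>

lemma test_function_taylor:
  assumes \<phi>: "test_function \<phi>"
  shows "\<exists>M>0. \<forall>t k. \<bar>\<phi> (t + k) - \<phi> t - k * deriv \<phi> t\<bar> \<le> M * k\<^sup>2"
proof -
  obtain M where M: "0 < M" "\<And>t. \<bar>deriv (deriv \<phi>) t\<bar> \<le> M"
    using test_function_bounded[OF test_function_deriv[OF test_function_deriv[OF \<phi>]]] by metis
  have lip: "\<bar>deriv \<phi> x - deriv \<phi> y\<bar> \<le> M * \<bar>x - y\<bar>" for x y
    using field_differentiable_bound[of UNIV "deriv \<phi>" "deriv (deriv \<phi>)" M x y]
      test_function_has_derivative[OF test_function_deriv[OF \<phi>]] M(2) by simp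
  have "\<bar>\<phi> (t + k) - \<phi> t - k * deriv \<phi> t\<bar> \<le> M * k\<^sup>2" for t k
  proof -
    have "norm ((\<phi> (t + k) - deriv \<phi> t * (t + k)) - (\<phi> t - deriv \<phi> t * t)) \<le> (M * \<bar>k\<bar>) * norm (t + k - t)"
    proof (rule field_differentiable_bound)
      show "convex (cball t \<bar>k\<bar>)" by simp
      show "((\<lambda>x. \<phi> x - deriv \<phi> t * x) has_real_derivative deriv \<phi> z - deriv \<phi> t) (at z within cball t \<bar>k\<bar>)" for z
        by (rule has_field_derivative_at_within, rule DERIV_diff[OF test_function_has_derivative[OF \<phi>]])
          (auto intro!: derivative_eq_intros)
      show "norm (deriv \<phi> z - deriv \<phi> t) \<le> M * \<bar>k\<bar>" if "z \<in> cball t \<bar>k\<bar>" for z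
      proof -
        have "\<bar>z - t\<bar> \<le> \<bar>k\<bar>" using that by (simp add: dist_real_def)
        then have "M * \<bar>z - t\<bar> \<le> M * \<bar>k\<bar>" using M(1) by (intro mult_left_mono) auto
        then show ?thesis using lip[of z t] by simp
      qed
    qed (auto simp: dist_real_def)
    moreover have "(\<phi> (t + k) - deriv \<phi> t * (t + k)) - (\<phi> t - deriv \<phi> t * t) = \<phi> (t + k) - \<phi> t - k * deriv \<phi> t"
      by (simp add: algebra_simps)
    moreover have "(M * \<bar>k\<bar>) * norm (t + k - t) = M * k\<^sup>2" by (simp add: power2_eq_square)
    ultimately show ?thesis by (simp only: real_norm_def)
  qed
  then show ?thesis using M(1) by blast
qed

lemma L2_test_function_taylor:
  assumes \<phi>: "test_function \<phi>"
  shows "\<exists>C. \<forall>k. \<bar>k\<bar> \<le> 1 \<longrightarrow> L2_norm (\<lambda>t. (\<phi> (t + k) - \<phi> t - k * deriv \<phi> t) *\<^sub>R h) \<le> C * k\<^sup>2"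
proof -
  obtain M where M: "0 < M" "\<And>t k. \<bar>\<phi> (t + k) - \<phi> t - k * deriv \<phi> t\<bar> \<le> M * k\<^sup>2"
    using test_function_taylor[OF \<phi>] by blast
  obtain R where R: "0 < R" "\<And>t. \<bar>t\<bar> > R \<Longrightarrow> \<phi> t = 0" using test_function_bounded[OF \<phi>] by metis
  obtain R' where R': "0 < R'" "\<And>t. \<bar>t\<bar> > R' \<Longrightarrow> deriv \<phi> t = 0"
    using test_function_bounded[OF test_function_deriv[OF \<phi>]] by metis
  \<comment> \<open>The summand 1 leaves room for shifts with |k| <= 1, so the remainder is
    supported in one interval for all such \<open>k\<close>.\<close>
  define r where "r = R + R' + 1"
  have "0 < r" using R R' by (simp add: r_def)
  let ?f = "\<lambda>k t. (\<phi> (t + k) - \<phi> t - k * deriv \<phi> t) *\<^sub>R h"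
  have "L2_norm (?f k) \<le> (M * norm h * sqrt (2 * r)) * k\<^sup>2" if k: "\<bar>k\<bar> \<le> 1" for k
  proof (rule power2_le_imp_le)
    have int: "integrable lebesgue (\<lambda>t. (M * k\<^sup>2 * norm h)\<^sup>2 * indicator {-r..r} t :: real)"
      using \<open>0 < r\<close> by (intro integrable_mult_right integrable_real_indicator) (auto simp: emeasure_lborel_Icc_eq)
    have le: "(norm (?f k t))\<^sup>2 \<le> (M * k\<^sup>2 * norm h)\<^sup>2 * indicator {-r..r} t" for t
    proof (cases "t \<in> {-r..r}")
      case True
      have "norm (?f k t) \<le> M * k\<^sup>2 * norm h" using M(2)[of t k] by (simp add: mult_right_mono)
      then show ?thesis using True by (simp add: power_mono)
    next
      case False
      then have "\<bar>t\<bar> > r" by auto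
      then have "\<phi> t = 0" "deriv \<phi> t = 0" "\<phi> (t + k) = 0"
        using k R R' by (auto simp: r_def intro!: R(2) R'(2))
      then show ?thesis by simp
    qed
    have eq: "?f k = (\<lambda>t. \<phi> (t + k) *\<^sub>R h - \<phi> t *\<^sub>R h - k *\<^sub>R (deriv \<phi> t *\<^sub>R h))"
      by (simp add: fun_eq_iff algebra_simps)
    have "?f k \<in> L2" unfolding eq
      by (intro L2_diff L2_scaleR L2_test_function test_function_shift test_function_deriv \<phi>)
    have "(L2_norm (?f k))\<^sup>2 = (LINT t|lebesgue. (norm (?f k t))\<^sup>2)" by (rule L2_norm_power2_integral)
    also have "\<dots> \<le> (LINT t|lebesgue. (M * k\<^sup>2 * norm h)\<^sup>2 * indicator {-r..r} t)"
      by (intro integral_mono L2D(2) \<open>?f k \<in> L2\<close> int le)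
    also have "\<dots> = (M * k\<^sup>2 * norm h)\<^sup>2 * (2 * r)"
      using \<open>0 < r\<close> by simp
    also have "\<dots> = ((M * norm h * sqrt (2 * r)) * k\<^sup>2)\<^sup>2"
      using \<open>0 < r\<close> by (simp add: power_mult_distrib)
    finally show "(L2_norm (?f k))\<^sup>2 \<le> ((M * norm h * sqrt (2 * r)) * k\<^sup>2)\<^sup>2" .
    show "0 \<le> (M * norm h * sqrt (2 * r)) * k\<^sup>2" using M(1) \<open>0 < r\<close> by simp
  qed
  then show ?thesis by blast
qed

text \<open>Translation invariance moves the shift from \<open>y\<close> to the smooth factor, where
  Taylor's formula applies; the first-order term - k <y, \<phi>' h> equals k <w, \<phi> h> by the
  weak derivative.\<close>

lemma shift_has_derivative_test:
  assumes y: "y \<in> L2" "w \<in> L2" "weak_deriv y w" and \<phi>: "test_function \<phi>"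
  shows "((\<lambda>s. L2_inner (\<lambda>t. y (t + s)) (\<lambda>t. \<phi> t *\<^sub>R h)) has_real_derivative
    L2_inner w (\<lambda>t. \<phi> t *\<^sub>R h)) (at 0)"
proof -
  obtain C where C: "\<And>k. \<bar>k\<bar> \<le> 1 \<Longrightarrow> L2_norm (\<lambda>t. (\<phi> (t + k) - \<phi> t - k * deriv \<phi> t) *\<^sub>R h) \<le> C * k\<^sup>2"
    using L2_test_function_taylor[OF \<phi>] by blast
  note tests = \<phi> test_function_deriv[OF \<phi>]
  let ?\<Psi> = "\<lambda>s. L2_inner (\<lambda>t. y (t + s)) (\<lambda>t. \<phi> t *\<^sub>R h)"
  let ?D = "L2_inner w (\<lambda>t. \<phi> t *\<^sub>R h)"
  have est: "\<bar>?\<Psi> k - ?\<Psi> 0 - k * ?D\<bar> \<le> L2_norm y * (C * k\<^sup>2)" if k: "\<bar>k\<bar> \<le> 1" for k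
  proof -
    let ?r = "\<lambda>t. (\<phi> (t + - k) - \<phi> t - (- k) * deriv \<phi> t) *\<^sub>R h"
    have \<Psi>: "?\<Psi> k = L2_inner y (\<lambda>t. \<phi> (t + - k) *\<^sub>R h)"
      using L2_inner_shift[of y k "\<lambda>t. \<phi> (t - k) *\<^sub>R h"] by simp
    have eq: "?r = (\<lambda>t. \<phi> (t + - k) *\<^sub>R h - \<phi> t *\<^sub>R h - (- k) *\<^sub>R (deriv \<phi> t *\<^sub>R h))"
      by (simp add: fun_eq_iff algebra_simps)
    have r: "?r \<in> L2" unfolding eq
      by (intro L2_diff L2_scaleR L2_test_function test_function_shift tests)
    have "L2_inner y ?r = L2_inner y (\<lambda>t. \<phi> (t + - k) *\<^sub>R h) - L2_inner y (\<lambda>t. \<phi> t *\<^sub>R h)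
        - (- k) * L2_inner y (\<lambda>t. deriv \<phi> t *\<^sub>R h)"
      unfolding eq
      by (subst L2_inner_diff_right, (intro L2_diff L2_scaleR L2_test_function test_function_shift tests y)+)+
        (simp only: L2_inner_scaleR_right)
    then have "?\<Psi> k - ?\<Psi> 0 - k * ?D = L2_inner y ?r"
      using weak_derivD[OF y(3) \<phi>] by (simp add: \<Psi>)
    then show ?thesis
      using order_trans[OF L2_Cauchy_Schwarz[OF y(1) r] mult_left_mono[OF C[of "- k"] L2_norm_nonneg]] k by simp
  qed
  have "((\<lambda>k. (?\<Psi> (0 + k) - ?\<Psi> 0) / k - ?D) \<longlongrightarrow> 0) (at 0)"
  proof (rule Lim_null_comparison)
    show "\<forall>\<^sub>F k in at 0. norm ((?\<Psi> (0 + k) - ?\<Psi> 0) / k - ?D) \<le> L2_norm y * (C * \<bar>k\<bar>)"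
      unfolding eventually_at
    proof (intro exI[of _ 1] conjI ballI impI)
      fix k :: real assume k: "k \<noteq> 0 \<and> dist k 0 < 1"
      then have "(?\<Psi> (0 + k) - ?\<Psi> 0) / k - ?D = (?\<Psi> k - ?\<Psi> 0 - k * ?D) / k" by (simp add: field_simps)
      then have "norm ((?\<Psi> (0 + k) - ?\<Psi> 0) / k - ?D) \<le> L2_norm y * (C * k\<^sup>2) / \<bar>k\<bar>"
        using est[of k] k by (simp add: divide_right_mono)
      also have "\<dots> = L2_norm y * (C * \<bar>k\<bar>)" using k by (simp add: power2_eq_square field_simps)
      finally show "norm ((?\<Psi> (0 + k) - ?\<Psi> 0) / k - ?D) \<le> L2_norm y * (C * \<bar>k\<bar>)" .
    qed simp
    show "((\<lambda>k. L2_norm y * (C * \<bar>k\<bar>)) \<longlongrightarrow> 0) (at 0)"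
      by (auto intro!: tendsto_eq_intros)
  qed
  then show ?thesis unfolding has_field_derivative_iff by (simp add: LIM_zero_iff)
qed

lemma shift_has_derivative_test_sums:
  assumes y: "y \<in> L2" "w \<in> L2" "weak_deriv y w" and v: "v \<in> test_sums"
  shows "((\<lambda>s. L2_inner (\<lambda>t. y (t + s)) v) has_real_derivative L2_inner (\<lambda>t. w (t + s)) v) (at s)"
proof -
  have at0: "((\<lambda>s. L2_inner (\<lambda>t. y (t + s)) v) has_real_derivative L2_inner w v) (at 0)"
    if "y \<in> L2" "w \<in> L2" "weak_deriv y w" for y w
    using v
  proof induction
    case (test \<phi> h)
    then show ?case by (intro shift_has_derivative_test that)
  next
    case (add f g)
    then show ?case
      using DERIV_add[OF add.IH] by (simp add: L2_inner_add_right L2_shift test_sums_L2 that)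
  qed
  have "((\<lambda>k. L2_inner (\<lambda>t. y (t + (k + s))) v) has_real_derivative L2_inner (\<lambda>t. w (t + s)) v) (at 0)"
    using at0[OF L2_shift L2_shift weak_deriv_shift, OF y, of s] by (simp add: algebra_simps)
  then show ?thesis
    using DERIV_shift[of "\<lambda>s. L2_inner (\<lambda>t. y (t + s)) v" _ 0 s] by simp
qed

text \<open>The mean value inequality gives this Lipschitz estimate against test sums, and density
  extends it. It bounds all difference quotients uniformly, which is what the passage from test sums
  to arbitrary \<open>v\<close> requires.\<close>

lemma L2_shift_diff_bound:
  assumes y: "y \<in> L2" "w \<in> L2" "weak_deriv y w" and v: "v \<in> L2"
  shows "\<bar>L2_inner (\<lambda>t. y (t + k)) v - L2_inner y v\<bar> \<le> L2_norm w * L2_norm v * \<bar>k\<bar>"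
proof -
  have test: "\<bar>L2_inner (\<lambda>t. y (t + k)) v - L2_inner y v\<bar> \<le> L2_norm w * L2_norm v * \<bar>k\<bar>"
    if "v \<in> test_sums" for v
    using field_differentiable_bound[of UNIV "\<lambda>s. L2_inner (\<lambda>t. y (t + s)) v" "\<lambda>s. L2_inner (\<lambda>t. w (t + s)) v"
        "L2_norm w * L2_norm v" k 0]
      shift_has_derivative_test_sums[OF y that] L2_Cauchy_Schwarz[OF L2_shift[OF y(2)] test_sums_L2[OF that]]
    by (simp add: L2_norm_shift)
  obtain s where s: "\<And>n. s n \<in> test_sums" "(\<lambda>n::nat. L2_norm (\<lambda>t. s n t - v t)) \<longlonglongrightarrow> 0"
    using test_sums_dense[OF v] by blast
  note sL = test_sums_L2[OF s(1)]
  have lim: "(\<lambda>n. L2_inner f (s n)) \<longlonglongrightarrow> L2_inner f v" if "f \<in> L2" for f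
    using tendsto_L2_inner[OF sL v s(2) that] by (simp add: L2_inner_commute)
  show ?thesis
  proof (rule LIMSEQ_le)
    show "(\<lambda>n. \<bar>L2_inner (\<lambda>t. y (t + k)) (s n) - L2_inner y (s n)\<bar>) \<longlonglongrightarrow> \<bar>L2_inner (\<lambda>t. y (t + k)) v - L2_inner y v\<bar>"
      by (intro tendsto_intros lim L2_shift y)
    show "(\<lambda>n. L2_norm w * L2_norm (s n) * \<bar>k\<bar>) \<longlonglongrightarrow> L2_norm w * L2_norm v * \<bar>k\<bar>"
      by (intro tendsto_intros tendsto_L2_norm sL v s(2))
  qed (use test s(1) in blast)
qed

text \<open>Difference quotients that are uniformly bounded and converge on a dense set converge
  everywhere. Arbitrary \<open>v\<close> in \<open>L2\<close> must be allowed because the energy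
  identity takes for it a function that need not be differentiable.\<close>

lemma shift_has_derivative:
  assumes y: "y \<in> L2" "w \<in> L2" "weak_deriv y w" and v: "v \<in> L2"
  shows "((\<lambda>s. L2_inner (\<lambda>t. y (t + s)) v) has_real_derivative L2_inner w v) (at 0)"
proof -
  let ?q = "\<lambda>v k. (L2_inner (\<lambda>t. y (t + k)) v - L2_inner y v) / k"
  obtain s where s: "\<And>n. s n \<in> test_sums" "(\<lambda>n::nat. L2_norm (\<lambda>t. s n t - v t)) \<longlonglongrightarrow> 0"
    using test_sums_dense[OF v] by blast
  note sL = test_sums_L2[OF s(1)]
  have "(?q v \<longlongrightarrow> L2_inner w v) (at 0)"
  proof (rule tendstoI)
    fix e :: real assume "0 < e"
    have "\<forall>\<^sub>F n in sequentially. dist (L2_norm (\<lambda>t. s n t - v t)) 0 < e / (3 * (L2_norm w + 1))"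
      using \<open>0 < e\<close> L2_norm_nonneg[of w] by (intro tendstoD[OF s(2)]) auto
    \<comment> \<open>Each of the three errors gets e / 3; the added 1 keeps the denominator
      positive when \<open>w\<close> is null.\<close>
    then obtain n where n: "L2_norm (\<lambda>t. s n t - v t) < e / (3 * (L2_norm w + 1))"
      by (auto simp: eventually_sequentially L2_norm_nonneg)
    define d where "d t = v t - s n t" for t
    have dL: "d \<in> L2" unfolding d_def by (intro L2_diff v sL)
    have split: "L2_inner f v = L2_inner f (s n) + L2_inner f d" if "f \<in> L2" for f
      using L2_inner_add_right[OF sL[of n] dL that] by (simp add: d_def)
    have "L2_norm w * L2_norm d \<le> (L2_norm w + 1) * (e / (3 * (L2_norm w + 1)))"
      using n L2_norm_minus_commute[of "s n" v] L2_norm_nonneg[of w] L2_norm_nonneg[of d]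
      unfolding d_def[abs_def] by (intro mult_mono) auto
    also have "\<dots> = e / 3" using L2_norm_nonneg[of w] by (simp add: divide_simps)
    finally have wd: "L2_norm w * L2_norm d \<le> e / 3" .
    have "(?q (s n) \<longlongrightarrow> L2_inner w (s n)) (at 0)"
      using shift_has_derivative_test_sums[OF y s(1)[of n], of 0] by (simp add: has_field_derivative_iff)
    then have "\<forall>\<^sub>F k in at 0. dist (?q (s n) k) (L2_inner w (s n)) < e / 3"
      using \<open>0 < e\<close> by (intro tendstoD) auto
    moreover have "\<forall>\<^sub>F k :: real in at 0. k \<noteq> 0" by (simp add: eventually_at_filter)
    ultimately show "\<forall>\<^sub>F k in at 0. dist (?q v k) (L2_inner w v) < e"
    proof eventually_elim
      case (elim k)
      have "?q v k - L2_inner w v = (?q (s n) k - L2_inner w (s n)) + ?q d k - L2_inner w d"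
        by (simp add: split L2_shift y add_divide_distrib diff_divide_distrib)
      moreover have "\<bar>?q d k\<bar> \<le> L2_norm w * L2_norm d"
        using L2_shift_diff_bound[OF y dL, of k] elim(2) by (simp add: divide_le_eq)
      moreover have "\<bar>L2_inner w d\<bar> \<le> L2_norm w * L2_norm d" by (rule L2_Cauchy_Schwarz[OF y(2) dL])
      ultimately show ?case using elim(1) wd unfolding dist_real_def by linarith
    qed
  qed
  then show ?thesis by (simp add: has_field_derivative_iff)
qed

text \<open>The correlation \<open>s \<mapsto> \<langle>A u(\<cdot> + s), u\<rangle>\<close> is even, so its derivative at \<open>0\<close> vanishes.\<close>

lemma energy_identity:
  assumes A: "bounded_linear A" "\<And>x y. inner (A x) y = inner x (A y)"
    and u: "u \<in> L2" "w \<in> L2" "weak_deriv (\<lambda>t. A (u t)) w"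
  shows "L2_inner w u = 0"
proof -
  let ?\<Psi> = "\<lambda>s. L2_inner (\<lambda>t. A (u (t + s))) u"
  have even: "?\<Psi> (- s) = ?\<Psi> s" for s
  proof -
    have "?\<Psi> (- s) = L2_inner (\<lambda>t. A (u t)) (\<lambda>t. u (t + s))"
      using L2_inner_shift[of "\<lambda>t. A (u (t + - s))" s u] by simp
    also have "\<dots> = ?\<Psi> s" unfolding L2_inner_def by (simp add: A(2) inner_commute)
    finally show ?thesis .
  qed
  \<comment> \<open>Here \<open>A u\<close> is the differentiable function and \<open>u\<close>
    itself the fixed factor, so nothing is asked about derivatives of \<open>u\<close>.\<close>
  have D: "(?\<Psi> has_real_derivative L2_inner w u) (at 0)"
    by (rule shift_has_derivative[OF L2_bounded_linear[OF u(1) A(1)] u(2,3,1)])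
  have "((\<lambda>s. ?\<Psi> (- s)) has_real_derivative L2_inner w u * (- 1)) (at 0)"
    by (rule DERIV_chain2[where f = ?\<Psi>]) (use D in \<open>auto intro!: derivative_eq_intros\<close>)
  then have "(?\<Psi> has_real_derivative - L2_inner w u) (at 0)" by (simp only: even) simp
  from DERIV_unique[OF D this] show ?thesis by simp
qed


section \<open>The a priori bound and invertibility\<close>

text \<open>For y' = g + c y the hypothesis \<open>eq\<close> says that y y' integrates to 0. Hence
  the integral of g y is - c times that of y^2, and expanding the square of y' leaves the integral
  of g^2 minus c^2 times that of y^2, which is nonnegative. The sign of \<open>c\<close> does not
  enter.\<close>

lemma linear_ode_bound:
  fixes y g :: "real \<Rightarrow> real"
  assumes int: "integrable lebesgue (\<lambda>t. (y t)\<^sup>2)" "integrable lebesgue (\<lambda>t. (g t)\<^sup>2)"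
      "integrable lebesgue (\<lambda>t. g t * y t)"
    and eq: "(LINT t|lebesgue. (g t + c * y t) * y t) = 0"
  shows "c\<^sup>2 * (LINT t|lebesgue. (y t)\<^sup>2) \<le> (LINT t|lebesgue. (g t)\<^sup>2)"
proof -
  have "(LINT t|lebesgue. (g t + c * y t) * y t) = (LINT t|lebesgue. g t * y t + c * (y t)\<^sup>2)"
    by (simp add: algebra_simps power2_eq_square)
  also have "\<dots> = (LINT t|lebesgue. g t * y t) + c * (LINT t|lebesgue. (y t)\<^sup>2)"
    using int by simp
  finally have gy: "(LINT t|lebesgue. g t * y t) = - c * (LINT t|lebesgue. (y t)\<^sup>2)" using eq by simp
  have "0 \<le> (LINT t|lebesgue. (g t + c * y t)\<^sup>2)" by simp
  also have "\<dots> = (LINT t|lebesgue. (g t)\<^sup>2 + (2 * c) * (g t * y t) + c\<^sup>2 * (y t)\<^sup>2)"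
    by (simp add: algebra_simps power2_eq_square)
  also have "\<dots> = (LINT t|lebesgue. (g t)\<^sup>2) + (2 * c) * (LINT t|lebesgue. g t * y t) + c\<^sup>2 * (LINT t|lebesgue. (y t)\<^sup>2)"
    using int by simp
  finally show ?thesis by (simp add: gy power2_eq_square algebra_simps)
qed

lemma integrable_inner_mult:
  assumes "f \<in> L2" "g \<in> L2"
  shows "integrable lebesgue (\<lambda>t. inner (f t) a * inner (g t) b)"
proof -
  have "(\<lambda>t. inner (f t) a *\<^sub>R b) \<in> L2"
    by (rule L2_bounded_linear[OF assms(1)])
      (intro bounded_linear_intros)
  from integrable_L2_inner[OF this assms(2)] show ?thesis by (simp add: inner_commute)
qed

lemma integral_inner_sq_le:
  assumes "f \<in> L2"
  shows "(LINT t|lebesgue. (inner (f t) a)\<^sup>2) \<le> (norm a)\<^sup>2 * (L2_norm f)\<^sup>2"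
proof -
  have "(inner (f t) a)\<^sup>2 \<le> (norm a)\<^sup>2 * (norm (f t))\<^sup>2" for t
    using Cauchy_Schwarz_ineq[of "f t" a] by (simp add: power2_norm_eq_inner mult.commute)
  moreover have "integrable lebesgue (\<lambda>t. (inner (f t) a)\<^sup>2)"
    using integrable_inner_mult[OF assms assms, of a a] by (simp add: power2_eq_square)
  ultimately have "(LINT t|lebesgue. (inner (f t) a)\<^sup>2) \<le> (LINT t|lebesgue. (norm a)\<^sup>2 * (norm (f t))\<^sup>2)"
    using L2D(2)[OF assms] by (intro integral_mono) auto
  then show ?thesis by (simp add: L2_norm_power2_integral)
qed

text \<open>
  Pairing \<open>A u' - T u - c A u = f\<close> with \<open>e\<close> gives the scalar equation
  \<open>y' = c y + \<langle>A u, e'\<rangle> + \<langle>f, e\<rangle>\<close> for \<open>y = \<langle>A u, e\<rangle>\<close>; its energy identity is that of the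
  rank-one operator \<open>x \<mapsto> \<langle>x, A e\<rangle> A e\<close>.
\<close>

lemma generalized_kernel_bound:
  assumes A: "bounded_linear A" "\<And>x y. inner (A x) y = inner x (A y)"
    and T: "bounded_linear T" "\<And>x y. inner (T x) y = inner x (T y)"
    and e: "T e = A e'"
    and u: "u \<in> L2" "w \<in> L2" "weak_deriv (\<lambda>t. A (u t)) w"
  shows "c\<^sup>2 * (LINT t|lebesgue. (inner (A (u t)) e)\<^sup>2) \<le>
    2 * (norm e)\<^sup>2 * (L2_norm (\<lambda>t. w t - T (u t) - c *\<^sub>R A (u t)))\<^sup>2 + 2 * (LINT t|lebesgue. (inner (A (u t)) e')\<^sup>2)"
proof -
  define f where "f t = w t - T (u t) - c *\<^sub>R A (u t)" for t
  have AL: "(\<lambda>t. A (u t)) \<in> L2" and TL: "(\<lambda>t. T (u t)) \<in> L2"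
    using L2_bounded_linear u A T by blast+
  have f: "f \<in> L2" unfolding f_def by (intro L2_diff L2_scaleR u AL TL)
  have weak: "weak_deriv (\<lambda>t. inner (u t) (A e) *\<^sub>R A e) (\<lambda>t. inner (w t) e *\<^sub>R A e)"
    unfolding weak_deriv_def
  proof (intro allI impI)
    fix \<phi> h assume "test_function \<phi>"
    \<comment> \<open>This test vector makes the identity for \<open>A u\<close> produce <A u, e> <A
      e, h>, that is, the rank-one function paired with \<open>h\<close>.\<close>
    from weak_derivD[OF u(3) this, of "inner (A e) h *\<^sub>R e"]
    show "L2_inner (\<lambda>t. inner (u t) (A e) *\<^sub>R A e) (\<lambda>t. deriv \<phi> t *\<^sub>R h) =
        - L2_inner (\<lambda>t. inner (w t) e *\<^sub>R A e) (\<lambda>t. \<phi> t *\<^sub>R h)"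
      by (simp add: L2_inner_def A(2) mult_ac)
  qed
  have "L2_inner (\<lambda>t. inner (w t) e *\<^sub>R A e) u = 0"
  proof (rule energy_identity[where A = "\<lambda>x. inner x (A e) *\<^sub>R A e"])
    show "bounded_linear (\<lambda>x. inner x (A e) *\<^sub>R A e)" by (intro bounded_linear_intros)
    show "(\<lambda>t. inner (w t) e *\<^sub>R A e) \<in> L2"
      by (rule L2_bounded_linear[OF u(2)]) (intro bounded_linear_intros)
  qed (use u weak in \<open>auto simp: inner_commute\<close>)
  moreover have Ae: "inner (A e) (u t) = inner (A (u t)) e" for t by (metis A(2) inner_commute)
  moreover have "inner (w t) e = inner (f t) e + inner (A (u t)) e' + c * inner (A (u t)) e" for t
    by (simp add: f_def inner_simps T(2) e A(2))
  ultimately have eq: "(LINT t|lebesgue. (inner (f t) e + inner (A (u t)) e' + c * inner (A (u t)) e) * inner (A (u t)) e) = 0"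
    by (simp add: L2_inner_def Ae)
  have int: "integrable lebesgue (\<lambda>t. (inner (A (u t)) a)\<^sup>2)" "integrable lebesgue (\<lambda>t. (inner (f t) a)\<^sup>2)"
    "integrable lebesgue (\<lambda>t. inner (f t) a * inner (A (u t)) b)"
    "integrable lebesgue (\<lambda>t. inner (A (u t)) a * inner (A (u t)) b)" for a b
    using integrable_inner_mult[OF AL AL] integrable_inner_mult[OF f f] integrable_inner_mult[OF f AL]
    by (simp_all add: power2_eq_square)
  have sq: "(x + z)\<^sup>2 \<le> 2 * x\<^sup>2 + 2 * z\<^sup>2" for x z :: real
    using sum_squares_bound[of x z] by (simp add: power2_sum)
  have intg: "integrable lebesgue (\<lambda>t. (inner (f t) e + inner (A (u t)) e')\<^sup>2)"
    using int by (simp add: power2_sum mult.assoc)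
  have "c\<^sup>2 * (LINT t|lebesgue. (inner (A (u t)) e)\<^sup>2) \<le> (LINT t|lebesgue. (inner (f t) e + inner (A (u t)) e')\<^sup>2)"
    by (rule linear_ode_bound[OF _ intg _ eq]) (use int in \<open>simp_all add: distrib_right\<close>)
  also have "\<dots> \<le> (LINT t|lebesgue. 2 * (inner (f t) e)\<^sup>2 + 2 * (inner (A (u t)) e')\<^sup>2)"
    using int intg by (intro integral_mono sq) auto
  also have "\<dots> = 2 * (LINT t|lebesgue. (inner (f t) e)\<^sup>2) + 2 * (LINT t|lebesgue. (inner (A (u t)) e')\<^sup>2)"
    using int by simp
  also have "\<dots> \<le> 2 * ((norm e)\<^sup>2 * (L2_norm f)\<^sup>2) + 2 * (LINT t|lebesgue. (inner (A (u t)) e')\<^sup>2)"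
    using integral_inner_sq_le[OF f, of e] by simp
  finally show ?thesis by (simp add: f_def[abs_def] mult.assoc)
qed

text \<open>If x exceeded the bound, then a <= x, so q a^2 <= q a x, and division by x would give x
  <= (p + q) a. The constant is cruder than the root of the quadratic but free of square
  roots.\<close>

lemma le_of_quadratic_le:
  fixes x a p q :: real
  assumes "x\<^sup>2 \<le> p * a * x + q * a\<^sup>2" "0 \<le> x" "0 \<le> a" "0 \<le> p" "0 \<le> q"
  shows "x \<le> (p + q + 1) * a"
proof (rule ccontr)
  assume "\<not> ?thesis"
  then have less: "(p + q + 1) * a < x" by simp
  then have "0 < x" using assms by (smt (verit) mult_nonneg_nonneg)
  have "a \<le> x" using less assms by (smt (verit) mult_right_mono mult_cancel_right1)
  then have "q * a\<^sup>2 \<le> q * a * x" using assms by (simp add: power2_eq_square mult_left_mono mult.assoc)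
  then have "x * x \<le> (p * a + q * a) * x" using assms(1) by (simp add: power2_eq_square algebra_simps)
  then have "x \<le> p * a + q * a" using \<open>0 < x\<close> by simp
  then show False using less assms(3) by (simp add: algebra_simps)
qed

lemma a_priori_bound:
  fixes A T :: "'h::complex_hilbert \<Rightarrow> 'h"
  assumes A: "bounded_linear A" "\<And>x y. inner (A x) y = inner x (A y)"
    and T: "bounded_linear T" "\<And>x y. inner (T x) y = inner x (T y)"
    and F: "finite F" "\<And>e. e \<in> F \<Longrightarrow> \<exists>e'. T e' = 0 \<and> T e = A e'"
    and "0 < \<kappa>" and coer: "\<And>u. (norm u)\<^sup>2 \<le> \<kappa> * (- inner (T u) u + (\<Sum>e\<in>F. (inner (A u) e)\<^sup>2))"
    and M: "\<And>x. \<bar>inner (A x) x\<bar> \<le> M * (norm x)\<^sup>2"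
    and c: "c \<noteq> 0" "\<kappa> * \<bar>c\<bar> * M \<le> 1 / 2"
  shows "\<exists>C. \<forall>u w. u \<in> L2 \<longrightarrow> w \<in> L2 \<longrightarrow> weak_deriv (\<lambda>t. A (u t)) w \<longrightarrow>
    L2_norm u \<le> C * L2_norm (\<lambda>t. w t - T (u t) - c *\<^sub>R A (u t))"
proof -
  obtain e' where e': "\<And>e. e \<in> F \<Longrightarrow> T (e' e) = 0" "\<And>e. e \<in> F \<Longrightarrow> T e = A (e' e)"
    using F(2) by metis
  \<comment> \<open>The chain is traversed from its end: \<open>T (e' e) = 0 = A 0\<close> bounds
    the integral of <A u, e' e>^2 by 2 |e' e|^2 |f|^2 / c^2, and the equation for \<open>e\<close>
    then divides by c^2 once more.\<close>
  define N where "N e = (2 * (norm e)\<^sup>2 + 4 * (norm (e' e))\<^sup>2 / c\<^sup>2) / c\<^sup>2" for e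
  define S where "S = (\<Sum>e\<in>F. N e)"
  have N: "0 \<le> N e" for e by (simp add: N_def)
  have S: "0 \<le> S" by (simp add: S_def N sum_nonneg)
  \<comment> \<open>Once the smallness of \<open>c\<close> has absorbed half of |u|^2, there remains
    |u|^2 <= 2 \<kappa> |f| |u| + 2 \<kappa> S |f|^2.\<close>
  have "L2_norm u \<le> (2 * \<kappa> + 2 * \<kappa> * S + 1) * L2_norm (\<lambda>t. w t - T (u t) - c *\<^sub>R A (u t))"
    if u: "u \<in> L2" "w \<in> L2" "weak_deriv (\<lambda>t. A (u t)) w" for u w
  proof -
    define f where "f t = w t - T (u t) - c *\<^sub>R A (u t)" for t
    have AL: "(\<lambda>t. A (u t)) \<in> L2" and TL: "(\<lambda>t. T (u t)) \<in> L2"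
      using L2_bounded_linear u A T by blast+
    have f: "f \<in> L2" unfolding f_def by (intro L2_diff L2_scaleR u AL TL)
    have Y: "(LINT t|lebesgue. (inner (A (u t)) e)\<^sup>2) \<le> N e * (L2_norm f)\<^sup>2" if "e \<in> F" for e
    proof -
      have "c\<^sup>2 * (LINT t|lebesgue. (inner (A (u t)) (e' e))\<^sup>2) \<le> 2 * (norm (e' e))\<^sup>2 * (L2_norm f)\<^sup>2"
        using generalized_kernel_bound[OF A T _ u, of "e' e" 0 c] e'(1)[OF that] linear_0[OF bounded_linear.linear[OF A(1)]]
        by (simp add: f_def[abs_def])
      then have 1: "(LINT t|lebesgue. (inner (A (u t)) (e' e))\<^sup>2) \<le> 2 * (norm (e' e))\<^sup>2 * (L2_norm f)\<^sup>2 / c\<^sup>2"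
        using c(1) by (simp add: field_simps)
      have "c\<^sup>2 * (LINT t|lebesgue. (inner (A (u t)) e)\<^sup>2) \<le> 2 * (norm e)\<^sup>2 * (L2_norm f)\<^sup>2
          + 2 * (LINT t|lebesgue. (inner (A (u t)) (e' e))\<^sup>2)"
        using generalized_kernel_bound[OF A T e'(2)[OF that] u, of c] by (simp add: f_def[abs_def])
      also have "\<dots> \<le> 2 * (norm e)\<^sup>2 * (L2_norm f)\<^sup>2 + 2 * (2 * (norm (e' e))\<^sup>2 * (L2_norm f)\<^sup>2 / c\<^sup>2)"
        using 1 by simp
      also have "\<dots> = c\<^sup>2 * (N e * (L2_norm f)\<^sup>2)"
        using c(1) by (simp add: N_def field_simps)
      finally show ?thesis using c(1) by simp
    qed
    have intA: "integrable lebesgue (\<lambda>t. inner (A (u t)) (u t))" by (intro integrable_L2_inner AL u)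
    have intT: "integrable lebesgue (\<lambda>t. inner (T (u t)) (u t))" by (intro integrable_L2_inner TL u)
    have intY: "integrable lebesgue (\<lambda>t. (inner (A (u t)) e)\<^sup>2)" for e
      using integrable_inner_mult[OF AL AL, of e e] by (simp add: power2_eq_square)
    have "L2_inner f u = L2_inner w u - L2_inner (\<lambda>t. T (u t)) u - c * L2_inner (\<lambda>t. A (u t)) u"
      unfolding f_def by (simp add: L2_inner_diff_left L2_diff L2_scaleR u AL TL L2_inner_scaleR_left)
    then have T_eq: "- L2_inner (\<lambda>t. T (u t)) u = L2_inner f u + c * L2_inner (\<lambda>t. A (u t)) u"
      using energy_identity[OF A u] by simp
    have "\<bar>L2_inner (\<lambda>t. A (u t)) u\<bar> \<le> (LINT t|lebesgue. \<bar>inner (A (u t)) (u t)\<bar>)"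
      unfolding L2_inner_def by (rule integral_abs_bound)
    also have "\<dots> \<le> (LINT t|lebesgue. M * (norm (u t))\<^sup>2)"
      using intA L2D(2)[OF u(1)] by (intro integral_mono M) auto
    also have "\<dots> = M * (L2_norm u)\<^sup>2" by (simp add: L2_norm_power2_integral)
    finally have "\<bar>c\<bar> * \<bar>L2_inner (\<lambda>t. A (u t)) u\<bar> \<le> \<bar>c\<bar> * (M * (L2_norm u)\<^sup>2)"
      by (rule mult_left_mono) simp
    then have "c * L2_inner (\<lambda>t. A (u t)) u \<le> \<bar>c\<bar> * (M * (L2_norm u)\<^sup>2)"
      using abs_ge_self[of "c * L2_inner (\<lambda>t. A (u t)) u"] unfolding abs_mult by (rule order_trans[rotated])
    then have "\<kappa> * (c * L2_inner (\<lambda>t. A (u t)) u) \<le> \<kappa> * (\<bar>c\<bar> * (M * (L2_norm u)\<^sup>2))"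
      by (rule mult_left_mono) (use \<open>0 < \<kappa>\<close> in simp)
    also have "\<dots> = \<kappa> * \<bar>c\<bar> * M * (L2_norm u)\<^sup>2" by simp
    also have "\<dots> \<le> 1 / 2 * (L2_norm u)\<^sup>2" using c(2) by (intro mult_right_mono) auto
    finally have small: "\<kappa> * (c * L2_inner (\<lambda>t. A (u t)) u) \<le> 1 / 2 * (L2_norm u)\<^sup>2" .
    have fu: "L2_inner f u \<le> L2_norm f * L2_norm u" using L2_Cauchy_Schwarz[OF f u(1)] by simp
    have "(L2_norm u)\<^sup>2 = (LINT t|lebesgue. (norm (u t))\<^sup>2)" by (rule L2_norm_power2_integral)
    also have "\<dots> \<le> (LINT t|lebesgue. \<kappa> * (- inner (T (u t)) (u t) + (\<Sum>e\<in>F. (inner (A (u t)) e)\<^sup>2)))"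
      using L2D(2)[OF u(1)] intT intY by (intro integral_mono coer) auto
    also have "\<dots> = \<kappa> * (- L2_inner (\<lambda>t. T (u t)) u + (\<Sum>e\<in>F. LINT t|lebesgue. (inner (A (u t)) e)\<^sup>2))"
      using intT intY by (simp add: L2_inner_def)
    also have "\<dots> \<le> \<kappa> * (L2_norm f * L2_norm u + c * L2_inner (\<lambda>t. A (u t)) u + (\<Sum>e\<in>F. N e * (L2_norm f)\<^sup>2))"
    proof (rule mult_left_mono)
      have "(\<Sum>e\<in>F. LINT t|lebesgue. (inner (A (u t)) e)\<^sup>2) \<le> (\<Sum>e\<in>F. N e * (L2_norm f)\<^sup>2)"
        by (rule sum_mono) (rule Y)
      then show "- L2_inner (\<lambda>t. T (u t)) u + (\<Sum>e\<in>F. LINT t|lebesgue. (inner (A (u t)) e)\<^sup>2)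
          \<le> L2_norm f * L2_norm u + c * L2_inner (\<lambda>t. A (u t)) u + (\<Sum>e\<in>F. N e * (L2_norm f)\<^sup>2)"
        using fu T_eq by linarith
    qed (use \<open>0 < \<kappa>\<close> in simp)
    also have "\<dots> \<le> \<kappa> * (L2_norm f * L2_norm u) + 1 / 2 * (L2_norm u)\<^sup>2 + \<kappa> * (S * (L2_norm f)\<^sup>2)"
      using small by (simp add: S_def sum_distrib_right distrib_left)
    finally have "(L2_norm u)\<^sup>2 \<le> 2 * \<kappa> * L2_norm f * L2_norm u + 2 * \<kappa> * S * (L2_norm f)\<^sup>2" by simp
    then have "L2_norm u \<le> (2 * \<kappa> + 2 * \<kappa> * S + 1) * L2_norm f"
      by (rule le_of_quadratic_le) (use \<open>0 < \<kappa>\<close> S in \<open>auto simp: L2_norm_nonneg\<close>)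
    then show ?thesis by (simp add: f_def[abs_def])
  qed
  then show ?thesis by blast
qed

section \<open>The graph of the operator and its range\<close>

lemma weak_deriv_test_function:
  assumes "test_function \<phi>"
  shows "weak_deriv (\<lambda>t. \<phi> t *\<^sub>R k) (\<lambda>t. deriv \<phi> t *\<^sub>R k)"
  unfolding weak_deriv_def
proof (intro allI impI)
  fix \<psi> h assume "test_function \<psi>"
  from test_function_by_parts[OF assms this]
  have "(LINT t|lebesgue. inner k h * (deriv \<psi> t * \<phi> t)) = - (LINT t|lebesgue. inner k h * (\<psi> t * deriv \<phi> t))"
    by simp
  then show "L2_inner (\<lambda>t. \<phi> t *\<^sub>R k) (\<lambda>t. deriv \<psi> t *\<^sub>R h) = - L2_inner (\<lambda>t. deriv \<phi> t *\<^sub>R k) (\<lambda>t. \<psi> t *\<^sub>R h)"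
    by (simp add: L2_inner_def mult_ac)
qed

lemma weak_deriv_add:
  assumes "g \<in> L2" "w \<in> L2" "weak_deriv g w" "g' \<in> L2" "w' \<in> L2" "weak_deriv g' w'"
  shows "weak_deriv (\<lambda>t. g t + g' t) (\<lambda>t. w t + w' t)"
  using assms(3,6) unfolding weak_deriv_def
  by (simp add: L2_inner_add_left assms L2_test_function test_function_deriv)

lemma weak_deriv_scaleR:
  "weak_deriv g w \<Longrightarrow> weak_deriv (\<lambda>t. c *\<^sub>R g t) (\<lambda>t. c *\<^sub>R w t)"
  unfolding weak_deriv_def L2_inner_scaleR_left by simp

text \<open>For a fixed test function both sides of the defining identity are continuous on
  \<open>L2\<close>; this makes the operator closed.\<close>

lemma weak_deriv_lim:
  assumes g: "\<And>n. g n \<in> L2" "g0 \<in> L2" "(\<lambda>n::nat. L2_norm (\<lambda>t. g n t - g0 t)) \<longlonglongrightarrow> 0"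
    and w: "\<And>n. w n \<in> L2" "w0 \<in> L2" "(\<lambda>n::nat. L2_norm (\<lambda>t. w n t - w0 t)) \<longlonglongrightarrow> 0"
    and weak: "\<And>n. weak_deriv (g n) (w n)"
  shows "weak_deriv g0 w0"
  unfolding weak_deriv_def
proof (intro allI impI)
  fix \<phi> h assume \<phi>: "test_function \<phi>"
  have "(\<lambda>n. L2_inner (g n) (\<lambda>t. deriv \<phi> t *\<^sub>R h)) \<longlonglongrightarrow> L2_inner g0 (\<lambda>t. deriv \<phi> t *\<^sub>R h)"
    by (intro tendsto_L2_inner g L2_test_function test_function_deriv \<phi>)
  moreover have "(\<lambda>n. - L2_inner (w n) (\<lambda>t. \<phi> t *\<^sub>R h)) \<longlonglongrightarrow> - L2_inner w0 (\<lambda>t. \<phi> t *\<^sub>R h)"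
    by (intro tendsto_minus tendsto_L2_inner w L2_test_function \<phi>)
  ultimately show "L2_inner g0 (\<lambda>t. deriv \<phi> t *\<^sub>R h) = - L2_inner w0 (\<lambda>t. \<phi> t *\<^sub>R h)"
    using LIMSEQ_unique by (simp add: weak_derivD[OF weak \<phi>])
qed

lemma L2_norm_bounded_linear_tendsto:
  assumes "\<And>n. u n \<in> L2" "u0 \<in> L2" "(\<lambda>n::nat. L2_norm (\<lambda>t. u n t - u0 t)) \<longlonglongrightarrow> 0" "bounded_linear L"
  shows "(\<lambda>n. L2_norm (\<lambda>t. L (u n t) - L (u0 t))) \<longlonglongrightarrow> 0"
proof -
  interpret L: bounded_linear L by fact
  obtain K where K: "0 < K" "\<And>x. norm (L x) \<le> norm x * K" using L.pos_bounded by blast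
  have "L2_norm (\<lambda>t. L (u n t) - L (u0 t)) \<le> L2_norm (\<lambda>t. u n t - u0 t) * K" for n
  proof (rule power2_le_imp_le)
    have d: "(\<lambda>t. u n t - u0 t) \<in> L2" by (intro L2_diff assms)
    have "(norm (L (u n t - u0 t)))\<^sup>2 \<le> K\<^sup>2 * (norm (u n t - u0 t))\<^sup>2" for t
      using power_mono[OF K(2)[of "u n t - u0 t"] norm_ge_zero, of 2] by (simp add: power_mult_distrib mult.commute)
    then have "(LINT t|lebesgue. (norm (L (u n t - u0 t)))\<^sup>2) \<le> (LINT t|lebesgue. K\<^sup>2 * (norm (u n t - u0 t))\<^sup>2)"
      using L2D(2)[OF L2_bounded_linear[OF d assms(4)]] L2D(2)[OF d] by (intro integral_mono) auto
    then show "(L2_norm (\<lambda>t. L (u n t) - L (u0 t)))\<^sup>2 \<le> (L2_norm (\<lambda>t. u n t - u0 t) * K)\<^sup>2"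
      by (simp add: L2_norm_power2_integral L.diff power_mult_distrib mult.commute)
  qed (use K in \<open>simp add: L2_norm_nonneg\<close>)
  then show ?thesis
    using Lim_null_comparison[where f = "\<lambda>n. L2_norm (\<lambda>t. L (u n t) - L (u0 t))"
        and g = "\<lambda>n. L2_norm (\<lambda>t. u n t - u0 t) * K"] tendsto_mult_left_zero[OF assms(3), of K]
    by (simp add: L2_norm_nonneg)
qed

text \<open>Any witness \<open>w\<close> equals f + T u + c A u almost everywhere, and
  \<open>weak_deriv\<close> does not see null sets, so the existential quantifier disappears and the
  graph is visibly linear.\<close>

lemma lin_op_iff:
  assumes "bounded_linear A" "bounded_linear T"
  shows "(u, f) \<in> lin_op A T c \<longleftrightarrow> u \<in> L2 \<and> f \<in> L2 \<and>
    weak_deriv (\<lambda>t. A (u t)) (\<lambda>t. f t + T (u t) + c *\<^sub>R A (u t))"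
proof -
  have cong: "weak_deriv g w' \<longleftrightarrow> weak_deriv g w"
    if "w \<in> L2" "AE t in lebesgue. w t = w' t" for g w w' :: "real \<Rightarrow> 'a"
  proof -
    have "L2_inner w (\<lambda>t. \<phi> t *\<^sub>R h) = L2_inner w' (\<lambda>t. \<phi> t *\<^sub>R h)" if "test_function \<phi>" for \<phi> h
      unfolding L2_inner_def
      using borel_measurable_integrable[OF integrable_L2_inner[OF \<open>w \<in> L2\<close> L2_test_function[OF that]]]
        borel_measurable_integrable[OF integrable_L2_inner[OF L2_cong_AE[OF \<open>w \<in> L2\<close> \<open>AE t in lebesgue. w t = w' t\<close>] L2_test_function[OF that]]]
        \<open>AE t in lebesgue. w t = w' t\<close>
      by (intro integral_cong_AE) auto
    then show ?thesis by (simp add: weak_deriv_def)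
  qed
  show ?thesis
  proof
    assume "(u, f) \<in> lin_op A T c"
    then obtain w where w: "u \<in> L2" "f \<in> L2" "w \<in> L2" "has_distr_deriv (\<lambda>t. A (u t)) w"
      "AE t in lebesgue. f t = w t - T (u t) - c *\<^sub>R A (u t)" by (auto simp: lin_op_def)
    have eq: "AE t in lebesgue. w t = f t + T (u t) + c *\<^sub>R A (u t)"
      using w(5) by eventually_elim simp
    then show "u \<in> L2 \<and> f \<in> L2 \<and> weak_deriv (\<lambda>t. A (u t)) (\<lambda>t. f t + T (u t) + c *\<^sub>R A (u t))"
      using iffD2[OF cong[OF w(3) eq]] w(1,2,4)
        has_distr_deriv_iff_weak_deriv[OF L2_bounded_linear[OF w(1) assms(1)] w(3)] by blast
  next
    assume *: "u \<in> L2 \<and> f \<in> L2 \<and> weak_deriv (\<lambda>t. A (u t)) (\<lambda>t. f t + T (u t) + c *\<^sub>R A (u t))"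
    then have L: "(\<lambda>t. A (u t)) \<in> L2" "(\<lambda>t. T (u t)) \<in> L2" using L2_bounded_linear assms by blast+
    then have "(\<lambda>t. f t + T (u t) + c *\<^sub>R A (u t)) \<in> L2" using * by (intro L2_add L2_scaleR) auto
    then show "(u, f) \<in> lin_op A T c"
      using * has_distr_deriv_iff_weak_deriv[OF L(1)] unfolding lin_op_def by force
  qed
qed

text \<open>These pairs supply enough of the range: orthogonality to the second components is the
  adjoint equation in weak form.\<close>

lemma lin_op_test_function:
  assumes "bounded_linear A" "bounded_linear T" "test_function \<phi>"
  shows "(\<lambda>t. \<phi> t *\<^sub>R h, \<lambda>t. deriv \<phi> t *\<^sub>R A h - \<phi> t *\<^sub>R T h - c *\<^sub>R (\<phi> t *\<^sub>R A h)) \<in> lin_op A T c"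
    (is "(?u, ?f) \<in> _")
proof -
  interpret A: bounded_linear A by fact
  interpret T: bounded_linear T by fact
  have "?f \<in> L2" by (intro L2_diff L2_scaleR L2_test_function test_function_deriv assms(3))
  moreover have "weak_deriv (\<lambda>t. A (?u t)) (\<lambda>t. ?f t + T (?u t) + c *\<^sub>R A (?u t))"
    using weak_deriv_test_function[OF assms(3), of "A h"] by (simp add: A.scaleR T.scaleR)
  ultimately show ?thesis
    using L2_test_function[OF assms(3)] by (simp only: lin_op_iff[OF assms(1,2)] simp_thms)
qed

text \<open>\<open>adj_bound\<close> is the estimate for the formal adjoint - A \<partial> - T - c
  A, written with \<open>- A\<close> and \<open>- c\<close> so that \<open>a_priori_bound\<close>
  applies verbatim. A function orthogonal to the range solves the adjoint equation weakly with
  right-hand side 0, so its differentiability comes with the equation and membership in the domain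
  of the adjoint is automatic.\<close>

lemma boundedly_invertible_lin_op:
  fixes A T :: "'h::complex_hilbert \<Rightarrow> 'h"
  assumes A: "bounded_linear A" "\<And>x y. inner (A x) y = inner x (A y)"
    and T: "bounded_linear T" "\<And>x y. inner (T x) y = inner x (T y)"
    and bound: "\<And>u w. u \<in> L2 \<Longrightarrow> w \<in> L2 \<Longrightarrow> weak_deriv (\<lambda>t. A (u t)) w \<Longrightarrow>
      L2_norm u \<le> C * L2_norm (\<lambda>t. w t - T (u t) - c *\<^sub>R A (u t))"
    and adj_bound: "\<And>u w. u \<in> L2 \<Longrightarrow> w \<in> L2 \<Longrightarrow> weak_deriv (\<lambda>t. - A (u t)) w \<Longrightarrow>
      L2_norm u \<le> C' * L2_norm (\<lambda>t. w t - T (u t) - (- c) *\<^sub>R (- A (u t)))"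
  shows "boundedly_invertible (lin_op A T c)"
proof -
  interpret A: bounded_linear A by fact
  interpret T: bounded_linear T by fact
  note iff = lin_op_iff[OF A(1) T(1)]
  have AL: "(\<lambda>t. A (u t)) \<in> L2" and TL: "(\<lambda>t. T (u t)) \<in> L2" if "u \<in> L2" for u :: "real \<Rightarrow> 'h"
    using L2_bounded_linear that A T by blast+
  have est: "L2_norm u \<le> C * L2_norm f" if "(u, f) \<in> lin_op A T c" for u f
    using that bound[of u "\<lambda>t. f t + T (u t) + c *\<^sub>R A (u t)"] by (simp add: iff L2_add L2_scaleR AL TL)
  have lin: "(\<lambda>t. u t + a *\<^sub>R v t, \<lambda>t. f t + a *\<^sub>R g t) \<in> lin_op A T c"
    if "(u, f) \<in> lin_op A T c" "(v, g) \<in> lin_op A T c" for u v f g a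
  proof -
    have uv: "u \<in> L2" "f \<in> L2" "v \<in> L2" "g \<in> L2" using that by (auto simp: iff)
    have "weak_deriv (\<lambda>t. A (u t) + a *\<^sub>R A (v t))
      (\<lambda>t. (f t + T (u t) + c *\<^sub>R A (u t)) + a *\<^sub>R (g t + T (v t) + c *\<^sub>R A (v t)))"
      using that by (intro weak_deriv_add weak_deriv_scaleR L2_add L2_scaleR AL TL uv) (auto simp: iff)
    moreover have "(\<lambda>t. (f t + T (u t) + c *\<^sub>R A (u t)) + a *\<^sub>R (g t + T (v t) + c *\<^sub>R A (v t)))
      = (\<lambda>t. (f t + a *\<^sub>R g t) + T (u t + a *\<^sub>R v t) + c *\<^sub>R A (u t + a *\<^sub>R v t))"
      by (simp add: fun_eq_iff A.add A.scaleR T.add T.scaleR algebra_simps)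
    ultimately show ?thesis using uv by (simp add: iff L2_add L2_scaleR A.add A.scaleR)
  qed
  have surj: "\<exists>u. (u, f) \<in> lin_op A T c" if f: "f \<in> L2" for f
  proof -
    let ?S = "{f. \<exists>u. (u, f) \<in> lin_op A T c}"
    have zero: "((\<lambda>_. 0), (\<lambda>_. 0)) \<in> lin_op A T c"
      using lin_op_test_function[OF A(1) T(1) test_function_bump, of _ _ _ 0] by (simp add: A.zero T.zero)
    have "\<exists>s. (\<forall>n::nat. s n \<in> ?S) \<and> (\<lambda>n. L2_norm (\<lambda>t. s n t - f t)) \<longlonglongrightarrow> 0"
    proof (rule L2_dense[OF _ _ _ _ _ f])
      show "?S \<subseteq> L2" by (auto simp: iff)
      show "?S \<noteq> {}" using zero by blast
      show "(\<lambda>t. f t + g t) \<in> ?S" if "f \<in> ?S" "g \<in> ?S" for f g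
        using that lin[of _ f _ g 1] by auto
      show "(\<lambda>t. a *\<^sub>R f t) \<in> ?S" if "f \<in> ?S" for f a
        using that lin[OF zero, of _ f a] by auto
      fix r assume r: "r \<in> L2" and perp: "\<And>s. s \<in> ?S \<Longrightarrow> L2_inner r s = 0"
      have rA: "(\<lambda>t. - A (r t)) \<in> L2" by (intro L2_uminus AL r)
      let ?w = "\<lambda>t. T (r t) + c *\<^sub>R A (r t)"
      have w: "?w \<in> L2" by (intro L2_add L2_scaleR AL TL r)
      have "weak_deriv (\<lambda>t. - A (r t)) ?w"
        unfolding weak_deriv_def
      proof (intro allI impI)
        fix \<phi> h assume \<phi>: "test_function \<phi>"
        note tests = \<phi> test_function_deriv[OF \<phi>]
        let ?p1 = "\<lambda>t. deriv \<phi> t *\<^sub>R A h" and ?p2 = "\<lambda>t. \<phi> t *\<^sub>R T h" and ?p3 = "\<lambda>t. c *\<^sub>R (\<phi> t *\<^sub>R A h)"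
        have p: "?p1 \<in> L2" "?p2 \<in> L2" "?p3 \<in> L2"
          by (intro L2_scaleR L2_test_function tests)+
        have "(\<lambda>t. ?p1 t - ?p2 t - ?p3 t) \<in> ?S" using lin_op_test_function[OF A(1) T(1) \<phi>] by blast
        then have "0 = L2_inner r (\<lambda>t. ?p1 t - ?p2 t - ?p3 t)" by (rule perp[symmetric])
        also have "\<dots> = L2_inner r ?p1 - L2_inner r ?p2 - L2_inner r ?p3"
          by (simp only: L2_inner_diff_right[OF L2_diff[OF p(1,2)] p(3) r] L2_inner_diff_right[OF p(1,2) r])
        also have "L2_inner r (\<lambda>t. deriv \<phi> t *\<^sub>R A h) = - L2_inner (\<lambda>t. - A (r t)) (\<lambda>t. deriv \<phi> t *\<^sub>R h)"
          by (simp add: L2_inner_def A(2))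
        also have "L2_inner r (\<lambda>t. \<phi> t *\<^sub>R T h) = L2_inner (\<lambda>t. T (r t)) (\<lambda>t. \<phi> t *\<^sub>R h)"
          by (simp add: L2_inner_def T(2))
        also have "L2_inner r ?p3 = L2_inner (\<lambda>t. c *\<^sub>R A (r t)) (\<lambda>t. \<phi> t *\<^sub>R h)"
          by (simp add: L2_inner_def A(2) mult_ac)
        finally show "L2_inner (\<lambda>t. - A (r t)) (\<lambda>t. deriv \<phi> t *\<^sub>R h) = - L2_inner ?w (\<lambda>t. \<phi> t *\<^sub>R h)"
          using L2_inner_add_left[OF TL[OF r] L2_scaleR[OF AL[OF r], of c] L2_test_function[OF \<phi>, of h]] by simp
      qed
      moreover have "L2_norm (\<lambda>t. ?w t - T (r t) - (- c) *\<^sub>R (- A (r t))) = 0" by (simp add: L2_norm_def)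
      ultimately have "L2_norm r \<le> 0" using adj_bound[OF r w] by (metis mult_zero_right)
      then have "L2_norm r = 0" using L2_norm_nonneg[of r] by simp
      then show "AE t in lebesgue. r t = 0" using L2_norm_eq_0 r by blast
    qed
    then obtain s u where s: "\<And>n::nat. (u n, s n) \<in> lin_op A T c"
      and lim: "(\<lambda>n. L2_norm (\<lambda>t. s n t - f t)) \<longlonglongrightarrow> 0" by auto metis
    have uL: "u n \<in> L2" and sL: "s n \<in> L2" for n using s by (auto simp: iff)
    have "\<exists>g\<in>L2. (\<lambda>n. L2_norm (\<lambda>t. u n t - g t)) \<longlonglongrightarrow> 0"
    proof (rule L2_complete[OF uL])
      fix e :: real assume "0 < e"
      have "\<forall>\<^sub>F n in sequentially. dist (L2_norm (\<lambda>t. s n t - f t)) 0 < e / (2 * (\<bar>C\<bar> + 1))"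
        using \<open>0 < e\<close> by (intro tendstoD[OF lim]) (simp add: add_nonneg_pos)
      then obtain N where N: "\<And>n. n \<ge> N \<Longrightarrow> L2_norm (\<lambda>t. s n t - f t) < e / (2 * (\<bar>C\<bar> + 1))"
        by (auto simp: eventually_sequentially L2_norm_nonneg)
      have "L2_norm (\<lambda>t. u m t - u n t) < e" if "m \<ge> N" "n \<ge> N" for m n
      proof -
        have "L2_norm (\<lambda>t. u m t - u n t) \<le> C * L2_norm (\<lambda>t. s m t - s n t)"
          using est[OF lin[OF s[of m] s[of n], of "-1"]] by simp
        \<comment> \<open>\<open>C\<close> may have any sign; \<open>\<bar>C\<bar> + 1\<close> is
          positive and could be divided by in the choice of \<open>N\<close>.\<close>
        also have "\<dots> \<le> (\<bar>C\<bar> + 1) * L2_norm (\<lambda>t. s m t - s n t)"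
          by (intro mult_right_mono L2_norm_nonneg) auto
        also have "\<dots> \<le> (\<bar>C\<bar> + 1) * (L2_norm (\<lambda>t. s m t - f t) + L2_norm (\<lambda>t. s n t - f t))"
          using L2_norm_diff_triangle[OF sL[of m] f sL[of n]] L2_norm_minus_commute[of f "s n"]
          by (intro mult_left_mono) auto
        also have "\<dots> < (\<bar>C\<bar> + 1) * (e / (2 * (\<bar>C\<bar> + 1)) + e / (2 * (\<bar>C\<bar> + 1)))"
          using N that by (intro mult_strict_left_mono add_strict_mono) auto
        also have "\<dots> = e" by (simp add: field_simps add_nonneg_eq_0_iff)
        finally show ?thesis .
      qed
      then show "\<exists>N. \<forall>m\<ge>N. \<forall>n\<ge>N. L2_norm (\<lambda>t. u m t - u n t) < e" by blast
    qed
    then obtain g where g: "g \<in> L2" "(\<lambda>n. L2_norm (\<lambda>t. u n t - g t)) \<longlonglongrightarrow> 0" by blast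
    have limL: "(\<lambda>n. L2_norm (\<lambda>t. L (u n t) - L (g t))) \<longlonglongrightarrow> 0" if "bounded_linear L" for L
      by (rule L2_norm_bounded_linear_tendsto[OF uL g that])
    have "weak_deriv (\<lambda>t. A (g t)) (\<lambda>t. f t + T (g t) + c *\<^sub>R A (g t))"
    proof (rule weak_deriv_lim[OF AL[OF uL] AL[OF g(1)] limL[OF A(1)]])
      let ?v = "\<lambda>n t. s n t + T (u n t) + c *\<^sub>R A (u n t)" and ?z = "\<lambda>t. f t + T (g t) + c *\<^sub>R A (g t)"
      let ?L = "\<lambda>x. T x + c *\<^sub>R A x"
      show w: "?v n \<in> L2" "?z \<in> L2" for n by (intro L2_add L2_scaleR AL TL uL sL g f)+
      show "weak_deriv (\<lambda>t. A (u n t)) (?v n)" for n using s by (simp add: iff)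
      have L: "bounded_linear ?L" by (intro bounded_linear_add T(1) bounded_linear_const_scaleR A(1))
      have "(\<lambda>n. L2_norm (\<lambda>t. s n t - f t) + L2_norm (\<lambda>t. ?L (u n t) - ?L (g t))) \<longlonglongrightarrow> 0 + 0"
        by (rule tendsto_add[OF lim limL[OF L]])
      moreover have "L2_norm (\<lambda>t. ?v n t - ?z t) \<le> L2_norm (\<lambda>t. s n t - f t) + L2_norm (\<lambda>t. ?L (u n t) - ?L (g t))" for n
        using L2_norm_triangle[OF L2_diff[OF sL[of n] f] L2_diff[OF L2_bounded_linear[OF uL[of n] L] L2_bounded_linear[OF g(1) L]]]
        by (simp add: algebra_simps)
      ultimately show "(\<lambda>n. L2_norm (\<lambda>t. ?v n t - ?z t)) \<longlonglongrightarrow> 0"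
        using Lim_null_comparison[where f = "\<lambda>n. L2_norm (\<lambda>t. ?v n t - ?z t)"
            and g = "\<lambda>n. L2_norm (\<lambda>t. s n t - f t) + L2_norm (\<lambda>t. ?L (u n t) - ?L (g t))" and net = sequentially]
        by (simp add: L2_norm_nonneg)
    qed
    then have "(g, f) \<in> lin_op A T c" using g f by (simp add: iff)
    then show ?thesis by blast
  qed
  have inj: "AE t in lebesgue. u t = v t"
    if G: "(u, f) \<in> lin_op A T c" "(v, g) \<in> lin_op A T c" and eq: "AE t in lebesgue. f t = g t" for u v f g
  proof -
    have L: "u \<in> L2" "f \<in> L2" "v \<in> L2" "g \<in> L2" using G by (auto simp: iff)
    have "AE t in lebesgue. f t - g t = 0" using eq by eventually_elim simp
    then have "L2_norm (\<lambda>t. f t - g t) = L2_norm (\<lambda>_. 0 :: 'h)" by (intro L2_norm_cong_AE L2_diff L)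
    then have "L2_norm (\<lambda>t. f t - g t) = 0" by (simp add: L2_norm_def)
    then have "L2_norm (\<lambda>t. u t - v t) = 0"
      using est[OF lin[OF G, of "-1"]] L2_norm_nonneg[of "\<lambda>t. u t - v t"] by simp
    then have "AE t in lebesgue. u t - v t = 0" by (intro L2_norm_eq_0 L2_diff L)
    then show ?thesis by eventually_elim simp
  qed
  have "\<exists>C. \<forall>(u, f)\<in>lin_op A T c. L2_norm u \<le> C * L2_norm f" using est by blast
  then show ?thesis unfolding boundedly_invertible_def using surj inj by blast
qed

section \<open>From the complex hypotheses to the real ones\<close>

lemma selfadjointD:
  assumes "selfadjoint M"
  shows "bounded_linear M" "inner (M x) y = inner x (M y)"
  using assms by (auto simp: selfadjoint_def bounded_clinear_def is_adjoint_def inner_eq_Re_cinner)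

lemma is_adjoint_unique:
  assumes "is_adjoint M N"
  shows "cadjoint M = N"
  unfolding cadjoint_def
proof (rule the_equality)
  show "is_adjoint M N" by (rule assms)
  fix N' assume N': "is_adjoint M N'"
  show "N' = N"
  proof
    fix y
    have "inner x (N' y) = inner x (N y)" for x
      using assms N' by (simp add: is_adjoint_def inner_eq_Re_cinner)
    then have "inner (N' y - N y) (N' y - N y) = 0" unfolding inner_diff_right by simp
    then show "N' y = N y" by simp
  qed
qed

text \<open>On a common null vector of \<open>A\<close> and \<open>T\<close> the forms of K A - T
  and of its adjoint - A K - T both vanish, the latter because \<open>A\<close> moves onto
  \<open>v\<close>; strict positivity leaves only v = 0. This is where the compensator
  enters.\<close>

lemma kawashima_injective:
  assumes A: "selfadjoint A" and kaw: "kawashima A V T" and v: "T v = 0" "A v = 0"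
  shows "v = 0"
proof -
  obtain K \<gamma> where T: "selfadjoint T" and K: "skewadjoint K" and "0 < \<gamma>"
    and ge: "op_ge (op_Re (\<lambda>x. K (A x) - T x)) \<gamma>"
    using kaw by (auto simp: kawashima_def)
  have cinner_simps: "cinner (x - y) z = cinner x z - cinner y z" "cinner x (y - z) = cinner x y - cinner x z"
    "cinner x (- y) = - cinner x y" for x y z :: 'a
    by (simp_all add: cinner_eq_Complex complex_eq_iff inner_diff_left inner_diff_right cvec.scale_right_diff_distrib)
  have "is_adjoint (\<lambda>x. K (A x) - T x) (\<lambda>x. - A (K x) - T x)"
    using A T K unfolding is_adjoint_def selfadjoint_def skewadjoint_def by (simp add: cinner_simps)
  then have adj: "cadjoint (\<lambda>x. K (A x) - T x) = (\<lambda>x. - A (K x) - T x)" by (rule is_adjoint_unique)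
  have K0: "K 0 = 0"
    using K by (simp add: skewadjoint_def bounded_clinear_def linear_0 bounded_linear.linear)
  have "inner (A (K v)) v = 0" using selfadjointD(2)[OF A, of "K v" v] v by simp
  then have "\<gamma> * (norm v)\<^sup>2 \<le> 0"
    using ge[unfolded op_ge_def, rule_format, of v]
    by (simp add: op_Re_def adj v K0 inner_eq_Re_cinner[symmetric])
  then show ?thesis using \<open>0 < \<gamma>\<close> by (simp add: mult_le_0_iff)
qed

text \<open>Splitting complex coefficients into real and imaginary parts adds the multiples by i to
  the generators. Thus ker \<open>T\<close> stays finite-dimensional over the reals, as the
  compactness argument requires.\<close>

lemma cspan_subset_span:
  "cvec.span S \<subseteq> span (S \<union> scaleC \<i> ` S)"
proof
  fix x assume "x \<in> cvec.span S"
  then show "x \<in> span (S \<union> scaleC \<i> ` S)"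
  proof (induction rule: cvec.span_induct_alt)
    case base
    then show ?case by (rule span_zero)
  next
    case (step c x y)
    have "scaleC c x = Re c *\<^sub>R x + Im c *\<^sub>R scaleC \<i> x"
    proof -
      have "c = complex_of_real (Re c) + complex_of_real (Im c) * \<i>" by (simp add: complex_eq_iff)
      then have "scaleC c x = scaleC (complex_of_real (Re c) + complex_of_real (Im c) * \<i>) x" by (rule arg_cong)
      then show ?thesis by (simp only: scaleC_add_left scaleC_scaleC[symmetric] scaleC_of_real)
    qed
    moreover have "x \<in> span (S \<union> scaleC \<i> ` S)" "scaleC \<i> x \<in> span (S \<union> scaleC \<i> ` S)"
      using step(1) by (intro span_base; blast)+
    ultimately show ?case using step by (simp only:) (intro span_add span_scale; assumption)
  qed
qed

text \<open>Both signs of \<open>c\<close> are treated at once: the two operators of the theorem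
  take one sign each, and the adjoint problem reverses it.\<close>

lemma kawashima_boundedly_invertible:
  assumes A: "selfadjoint A" and V: "cvec.subspace V" "closed V"
    and fin: "cfinite_dim (orth_compl V)" and kaw: "kawashima A V T"
  shows "\<exists>\<eta>\<^sub>0>0. \<forall>c. c \<noteq> 0 \<and> \<bar>c\<bar> < \<eta>\<^sub>0 \<longrightarrow> boundedly_invertible (lin_op A T c)"
proof -
  have T: "selfadjoint T" and ker: "{x. T x = 0} = orth_compl V"
    using kaw by (auto simp: kawashima_def)
  obtain \<delta> where \<delta>: "0 < \<delta>" "\<And>v. v \<in> V \<Longrightarrow> inner (T v) v \<le> - \<delta> * (norm v)\<^sup>2"
    using kaw by (auto simp: kawashima_def inner_eq_Re_cinner)
  have sub: "subspace V"
    using cvec.subspace_0[OF V(1)] cvec.subspace_add[OF V(1)] cvec.subspace_scale[OF V(1)]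
    by (auto simp: subspace_def scaleC_of_real[symmetric])
  have kerV: "T x = 0 \<longleftrightarrow> (\<forall>v\<in>V. inner x v = 0)" for x
  proof -
    have "T x = 0 \<longleftrightarrow> (\<forall>v\<in>V. cinner x v = 0)" using ker by (auto simp: orth_compl_def)
    \<comment> \<open>\<open>V\<close> is invariant under multiplication by i, so vanishing real
      parts force vanishing imaginary parts.\<close>
    also have "\<dots> \<longleftrightarrow> (\<forall>v\<in>V. inner x v = 0)"
      using cvec.subspace_scale[OF V(1), of _ \<i>] by (auto simp: cinner_eq_Complex complex_eq_iff)
    finally show ?thesis .
  qed
  obtain S where S: "finite S" "{x. T x = 0} \<subseteq> span S"
  proof -
    obtain S where "finite S" "cvec.span S = orth_compl V" using fin by (auto simp: cfinite_dim_def)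
    then show thesis using cspan_subset_span[of S] ker by (intro that[of "S \<union> scaleC \<i> ` S"]) auto
  qed
  obtain F \<kappa> where F: "finite F" "0 < \<kappa>" "\<And>e. e \<in> F \<Longrightarrow> \<exists>e'. T e' = 0 \<and> T e = A e'"
    "\<And>u. (norm u)\<^sup>2 \<le> \<kappa> * (- inner (T u) u + (\<Sum>e\<in>F. (inner (A u) e)\<^sup>2))"
    by (rule generalized_kernel_detects[OF selfadjointD[OF A] selfadjointD[OF T] sub V(2) kerV \<delta> S])
      (use kawashima_injective[OF A kaw] in blast)+
  interpret A: bounded_linear A by (rule selfadjointD[OF A])
  obtain M where M: "0 < M" "\<And>x. norm (A x) \<le> norm x * M" using A.pos_bounded by blast
  have AM: "\<bar>inner (A x) x\<bar> \<le> M * (norm x)\<^sup>2" for x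
    using order_trans[OF Cauchy_Schwarz_ineq2 mult_right_mono[OF M(2) norm_ge_zero], of x x]
    by (simp add: power2_eq_square mult_ac)
  show ?thesis
  \<comment> \<open>The threshold comes from the condition
    \<open>\<kappa> * \<bar>c\<bar> * M \<le> 1 / 2\<close> of
    \<open>a_priori_bound\<close>.\<close>
  proof (intro exI[of _ "1 / (2 * \<kappa> * M)"] conjI allI impI)
    show "0 < 1 / (2 * \<kappa> * M)" using M F by simp
    fix c assume c: "c \<noteq> 0 \<and> \<bar>c\<bar> < 1 / (2 * \<kappa> * M)"
    then have small: "\<kappa> * \<bar>c\<bar> * M \<le> 1 / 2" using M(1) F(2) by (simp add: field_simps)
    obtain C where C: "\<forall>u w. u \<in> L2 \<longrightarrow> w \<in> L2 \<longrightarrow> weak_deriv (\<lambda>t. A (u t)) w \<longrightarrow>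
        L2_norm u \<le> C * L2_norm (\<lambda>t. w t - T (u t) - c *\<^sub>R A (u t))"
      using a_priori_bound[OF selfadjointD[OF A] selfadjointD[OF T] F(1,3,2,4) AM _ small] c by blast
    \<comment> \<open>The same \<open>F\<close>, \<open>\<kappa>\<close> and \<open>M\<close> serve
      \<open>- A\<close>: the chain uses \<open>- e'\<close> for \<open>e'\<close>, and the squares
      in the coercivity inequality ignore the sign.\<close>
    have negF: "\<exists>e'. T e' = 0 \<and> T e = - A e'" if "e \<in> F" for e
    proof -
      obtain e' where e': "T e' = 0" "T e = A e'" using F(3)[OF \<open>e \<in> F\<close>] by blast
      then show ?thesis
        using linear_neg[OF A.linear] linear_neg[OF bounded_linear.linear[OF selfadjointD(1)[OF T]]]
        by (intro exI[of _ "- e'"]) simp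
    qed
    obtain C' where C': "\<forall>u w. u \<in> L2 \<longrightarrow> w \<in> L2 \<longrightarrow> weak_deriv (\<lambda>t. - A (u t)) w \<longrightarrow>
        L2_norm u \<le> C' * L2_norm (\<lambda>t. w t - T (u t) - (- c) *\<^sub>R (- A (u t)))"
    proof -
      have "\<exists>C. \<forall>u w. u \<in> L2 \<longrightarrow> w \<in> L2 \<longrightarrow> weak_deriv (\<lambda>t. - A (u t)) w \<longrightarrow>
        L2_norm u \<le> C * L2_norm (\<lambda>t. w t - T (u t) - (- c) *\<^sub>R (- A (u t)))"
        by (rule a_priori_bound[where F = F and \<kappa> = \<kappa> and M = M])
          (use F small c AM negF selfadjointD[OF T] selfadjointD(2)[OF A] in
            \<open>auto intro: bounded_linear_minus A.bounded_linear_axioms\<close>)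
      then show thesis using that by blast
    qed
    show "boundedly_invertible (lin_op A T c)"
      by (rule boundedly_invertible_lin_op[OF selfadjointD[OF A] selfadjointD[OF T], where C = C and C' = C'])
        (use C C' in blast)+
  qed
qed

theorem theorem1p1:
  fixes A :: "'h::complex_hilbert \<Rightarrow> 'h"
    and V :: "'h set"
    and B :: "'h \<Rightarrow> 'h \<Rightarrow> 'h"
    and u_plus u_minus :: 'h
  assumes "selfadjoint A"
    and "cvec.subspace V" and "closed V" and "V \<noteq> UNIV"
    and "cfinite_dim (orth_compl V)"
    and "bounded_cbilinear_sym B"
    and "\<And>u w. B u w \<in> V"
    and "Qmap B u_plus = 0" and "Qmap B u_minus = 0"
    and "kawashima A V (dQ B u_plus)"
    and "kawashima A V (dQ B u_minus)"
  shows "\<exists>\<eta>\<^sub>0>0. \<forall>\<eta>. 0 < \<eta> \<and> \<eta> < \<eta>\<^sub>0 \<longrightarrow>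
    boundedly_invertible (lin_op A (dQ B u_plus) \<eta>) \<and>
    boundedly_invertible (lin_op A (dQ B u_minus) (- \<eta>))"
proof -
  obtain \<eta>\<^sub>1 where "0 < \<eta>\<^sub>1"
    "\<And>c. c \<noteq> 0 \<Longrightarrow> \<bar>c\<bar> < \<eta>\<^sub>1 \<Longrightarrow> boundedly_invertible (lin_op A (dQ B u_plus) c)"
    using kawashima_boundedly_invertible assms by metis
  moreover obtain \<eta>\<^sub>2 where "0 < \<eta>\<^sub>2"
    "\<And>c. c \<noteq> 0 \<Longrightarrow> \<bar>c\<bar> < \<eta>\<^sub>2 \<Longrightarrow> boundedly_invertible (lin_op A (dQ B u_minus) c)"
    using kawashima_boundedly_invertible assms by metis
  \<comment> \<open>\<open>lin_op\<close> subtracts \<open>c *\<^sub>R A\<close>, so the two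
    instances are c = \<eta> and c = - \<eta>, both nonzero and of absolute value below the
    minimum.\<close>
  ultimately show ?thesis by (intro exI[of _ "min \<eta>\<^sub>1 \<eta>\<^sub>2"]) auto
qed

end
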